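(* Let $F\colon M\to N$ be a smooth map with $N$ connected and $M\ne\emptyset$, let $\varpi=(\omega,\eta)\in\Omega^2(F)$ be a $d_F$-closed relative $2$-form, and let a Lie group $G$ (with Lie algebra $\mathfrak g$) act on $F$ preserving $\varpi$. Suppose a comoment map $f\colon\mathfrak g\to C^\infty(N)$ exists, i.e. a linear map with $d_Ff(x)=-\iota_{v_x}\varpi$ for all $x\in\mathfrak g$. Then: (i) (Uniqueness) $f$ is the unique comoment map for the action. (ii) (Automatic strictness) $f$ is a homomorphism of Lie algebras: $f([x,y])=\{f(x),f(y)\}$ for all $x,y\in\mathfrak g$. In particular the Kostant--Souriau cocycle $\tau(x,y)=f([x,y])-\{f(x),f(y)\}$ vanishes identically, and $f$ is a strict relative homotopy moment map. (iii) (Automatic equivariance) $f$ is infinitesimally equivariant: $\mathcal L_{v_x}f(y)=f([x,y])$ for all $x,y\in\mathfrak g$; if moreover $G$ is connected, $f$ is $G$-equivariant: $f(\mathrm{Ad}_gx)=f(x)\circ g_N^{-1}$ for all $g\in G$, $x\in\mathfrak g$. (iv) (No constants) If $\varpi$ is strongly nondegenerate, each $\sigma\in\mathrm{Ham}^0(F,\varpi)$ admits a unique Hamiltonian $F$-pair $v_\sigma$, and the resulting map $\mathrm{Ham}^0(F,\varpi)\to\mathfrak X(F)$, $\sigma\mapsto v_\sigma$, is well defined and injective. Without nondegeneracy: (a) if $\sigma\in\mathrm{Ham}^0(F,\varpi)$ admits the zero pair as Hamiltonian $F$-pair, then $d_F\sigma=0$ and hence $\sigma=0$; (b) two Hamiltonians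 admitting a common Hamiltonian $F$-pair differ by a $d_F$-closed function and hence are equal. (In every case the central term of the classical Kostant--Souriau extension $0\to\mathbb R\to C^\infty\to\mathfrak{ham}\to0$ is absent.)
   Context: $\Omega^k(F)=\Omega^k(N)\oplus\Omega^{k-1}(M)$, $d_F(\alpha,\beta)=(d\alpha,F^*\alpha-d\beta)$; in particular $\Omega^0(F)=C^\infty(N)$ and $d_Fh=(dh,F^*h)$. An $F$-pair is $v=(v_N,v_M)$ with $v_N\in\mathfrak X(N)$, $v_M\in\mathfrak X(M)$, $dF\circ v_M=v_N\circ F$; $\mathfrak X(F)$ is the Lie algebra of $F$-pairs. $\iota_v(\alpha,\beta)=(\iota_{v_N}\alpha,-\iota_{v_M}\beta)$, $\mathcal L_v(\alpha,\beta)=(\mathcal L_{v_N}\alpha,\mathcal L_{v_M}\beta)$, $\iota(v_1\wedge\dots\wedge v_k)=\iota_{v_k}\cdots\iota_{v_1}$. $\mathrm{Ham}^0(F,\varpi)=\{\sigma\in C^\infty(N):\exists\,v_\sigma\in\mathfrak X(F),\ d_F\sigma=-\iota_{v_\sigma}\varpi\}$; such a $v_\sigma$ is a Hamiltonian $F$-pair for $\sigma$. Bracket: $\{\sigma_1,\sigma_2\}=\iota(v_{\sigma_1}\wedge v_{\sigma_2})\varpi\in C^\infty(N)$. $G$ acts on $F$ by pairs $g=(g_N,g_M)$ with $F\circ g_M=g_N\circ F$; preserving $\varpi$ means $g_N^*\omega=\omega$, $g_M^*\eta=\eta$. Fundamental vector fields: $v_x|_p=\frac{d}{dt}\big|_0\exp(-tx)\cdot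 p$, giving $F$-pairs $v_x=(v_x^N,v_x^M)$ with $[v_x,v_y]=v_{[x,y]}$. Strict relative homotopy moment map (degree $n=1$): the linear map $f$ satisfies $d_Ff(x)+\iota_{v_x}\varpi=0$ and $f([x,y])=\iota(v_x\wedge v_y)\varpi$ for all $x,y$. $\varpi$ is strongly nondegenerate if for every $v\in\mathfrak X(F)$, $\iota_v\varpi=0$ implies $v=0$. *)

theory Defs
  imports
    "HOL-Analysis.Analysis"
    "HOL-Algebra.Group_Action"
    "HOL-Library.Function_Algebras"
begin

(* Zero, sums, differences and negatives of functions (hence of tangent vectors, vector fields and
   forms) are the pointwise ones of HOL-Library.Function_Algebras, and those of pairs are
   componentwise. *)

section \<open>Smooth manifolds\<close>

primrec Ck_on :: "nat \<Rightarrow> 'a::real_normed_vector set \<Rightarrow> ('a \<Rightarrow> 'b::real_normed_vector) \<Rightarrow> bool" where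
  "Ck_on 0 S f \<longleftrightarrow> continuous_on S f"
| "Ck_on (Suc k) S f \<longleftrightarrow>
     (\<forall>x\<in>S. f differentiable (at x)) \<and> (\<forall>v. Ck_on k S (\<lambda>x. frechet_derivative f (at x) v))"

(* To be used on open subsets of finite-dimensional spaces, where this is the usual notion. *)
definition Cinf_on :: "'a::real_normed_vector set \<Rightarrow> ('a \<Rightarrow> 'b::real_normed_vector) \<Rightarrow> bool" where
  "Cinf_on S f \<longleftrightarrow> (\<forall>k. Ck_on k S f)"

(* A chart (U, phi); only the values of phi on U matter. *)
type_synonym ('m, 'e) chart = "'m set \<times> ('m \<Rightarrow> 'e)"

definition is_chart :: "('m::topological_space, 'e::real_normed_vector) chart \<Rightarrow> bool" where
  "is_chart c \<longleftrightarrow> open (fst c) \<and> open (snd c ` fst c) \<and>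
     homeomorphism (fst c) (snd c ` fst c) (snd c) (inv_into (fst c) (snd c))"

(* The whole type 'm is the underlying space; it is made a manifold by an atlas (not necessarily
   maximal) of charts in a finite-dimensional real vector space 'e. Euclidean_space is avoided for
   'e since it forces positive dimension: points and discrete groups are manifolds too. *)
definition smooth_manifold ::
  "('m::{second_countable_topology,t2_space}, 'e::{real_inner,banach}) chart set \<Rightarrow> bool" where
  "smooth_manifold A \<longleftrightarrow>
     (\<exists>B::'e set. finite B \<and> span B = UNIV) \<and>
     (\<forall>c\<in>A. is_chart c) \<and> (\<Union>c\<in>A. fst c) = UNIV \<and>
     (\<forall>c\<in>A. \<forall>d\<in>A. Cinf_on (snd c ` (fst c \<inter> fst d)) (snd d \<circ> inv_into (fst c) (snd c)))"

definition std_atlas :: "('e::real_normed_vector, 'e) chart set" where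
  "std_atlas = {(UNIV, \<lambda>x. x)}"

definition prod_atlas :: "('m, 'e) chart set \<Rightarrow> ('n, 'f) chart set \<Rightarrow> ('m \<times> 'n, 'e \<times> 'f) chart set"
  where "prod_atlas A B = {(fst c \<times> fst d, map_prod (snd c) (snd d)) |c d. c \<in> A \<and> d \<in> B}"

(* Smoothness of F on an open set S. *)
definition smooth_map ::
  "('m::topological_space, 'e::real_normed_vector) chart set \<Rightarrow> 'm set \<Rightarrow>
   ('n::topological_space, 'f::real_normed_vector) chart set \<Rightarrow> ('m \<Rightarrow> 'n) \<Rightarrow> bool" where
  "smooth_map A S B F \<longleftrightarrow> continuous_on S F \<and>
     (\<forall>c\<in>A. \<forall>d\<in>B. Cinf_on (snd c ` (fst c \<inter> S \<inter> F -` fst d))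
                          (snd d \<circ> F \<circ> inv_into (fst c) (snd c)))"

definition smooth_fun_on ::
  "('m::topological_space, 'e::real_normed_vector) chart set \<Rightarrow> 'm set \<Rightarrow> ('m \<Rightarrow> real) \<Rightarrow> bool" where
  "smooth_fun_on A U h \<longleftrightarrow> smooth_map A U std_atlas h"

definition Cinf :: "('m::topological_space, 'e::real_normed_vector) chart set \<Rightarrow> ('m \<Rightarrow> real) set"
  where "Cinf A = {h. smooth_fun_on A UNIV h}"

definition smooth_near ::
  "('m::topological_space, 'e::real_normed_vector) chart set \<Rightarrow> 'm \<Rightarrow> ('m \<Rightarrow> real) \<Rightarrow> bool" where
  "smooth_near A p h \<longleftrightarrow> (\<exists>U. open U \<and> p \<in> U \<and> smooth_fun_on A U h)"

section \<open>Tangent vectors and vector fields\<close>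

(* A tangent vector at p is the class of a smooth curve through p, represented by the operator
   differentiating functions along the curve. The operator acts on all functions that are smooth
   near p and is set to 0 on other functions, so that tangent vectors can be compared by =. *)
type_synonym 'm tvec = "('m \<Rightarrow> real) \<Rightarrow> real"

definition velocity ::
  "('m::topological_space, 'e::real_normed_vector) chart set \<Rightarrow> (real \<Rightarrow> 'm) \<Rightarrow> real \<Rightarrow> 'm tvec" where
  "velocity A \<gamma> t = (\<lambda>h. if smooth_near A (\<gamma> t) h then deriv (\<lambda>s. h (\<gamma> s)) t else 0)"

definition tangent_space ::
  "('m::topological_space, 'e::real_normed_vector) chart set \<Rightarrow> 'm \<Rightarrow> 'm tvec set" where
  "tangent_space A p = {velocity A \<gamma> 0 |\<gamma>. \<gamma> 0 = p \<and>
     (\<exists>\<epsilon>>0. smooth_map std_atlas {-\<epsilon><..<\<epsilon>} A \<gamma>)}"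

definition tscale :: "real \<Rightarrow> 'm tvec \<Rightarrow> 'm tvec" where
  "tscale a v = (\<lambda>h. a * v h)"

definition differential ::
  "('n::topological_space, 'f::real_normed_vector) chart set \<Rightarrow> ('m \<Rightarrow> 'n) \<Rightarrow> 'm \<Rightarrow> 'm tvec \<Rightarrow> 'n tvec"
  where "differential B F p v = (\<lambda>h. if smooth_near B (F p) h then v (h \<circ> F) else 0)"

definition vector_field_on ::
  "('m::topological_space, 'e::real_normed_vector) chart set \<Rightarrow> 'm set \<Rightarrow> ('m \<Rightarrow> 'm tvec) \<Rightarrow> bool" where
  "vector_field_on A U X \<longleftrightarrow> (\<forall>p\<in>U. X p \<in> tangent_space A p) \<and>
     (\<forall>V h. open V \<and> V \<subseteq> U \<and> smooth_fun_on A V h \<longrightarrow> smooth_fun_on A V (\<lambda>p. X p h))"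

definition vector_fields ::
  "('m::topological_space, 'e::real_normed_vector) chart set \<Rightarrow> ('m \<Rightarrow> 'm tvec) set" where
  "vector_fields A = {X. vector_field_on A UNIV X}"

definition vf_bracket ::
  "('m::topological_space, 'e::real_normed_vector) chart set \<Rightarrow>
   ('m \<Rightarrow> 'm tvec) \<Rightarrow> ('m \<Rightarrow> 'm tvec) \<Rightarrow> 'm \<Rightarrow> 'm tvec" where
  "vf_bracket A X Y p = (\<lambda>h. if smooth_near A p h
     then X p (\<lambda>q. Y q h) - Y p (\<lambda>q. X q h) else 0)"

definition lie_deriv :: "('m \<Rightarrow> 'm tvec) \<Rightarrow> ('m \<Rightarrow> real) \<Rightarrow> 'm \<Rightarrow> real" where
  "lie_deriv X h = (\<lambda>p. X p h)"

section \<open>Differential forms\<close>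

(* A k-form sends a point p and a list of k tangent vectors at p to a real number;
   all other values are 0, so that forms can be compared by =. *)
type_synonym 'm form = "'m \<Rightarrow> 'm tvec list \<Rightarrow> real"

definition tangent_list ::
  "('m::topological_space, 'e::real_normed_vector) chart set \<Rightarrow> nat \<Rightarrow> 'm \<Rightarrow> 'm tvec list \<Rightarrow> bool" where
  "tangent_list A k p vs \<longleftrightarrow> length vs = k \<and> set vs \<subseteq> tangent_space A p"

definition forms ::
  "('m::topological_space, 'e::real_normed_vector) chart set \<Rightarrow> nat \<Rightarrow> 'm form set" where
  "forms A k = {\<alpha>.
     (\<forall>p vs. \<not> tangent_list A k p vs \<longrightarrow> \<alpha> p vs = 0) \<and>
     (\<forall>p vs i u w a b. tangent_list A k p vs \<and> i < k \<and> u \<in> tangent_space A p \<and> w \<in> tangent_space A p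
        \<longrightarrow> \<alpha> p (vs[i := tscale a u + tscale b w]) = a * \<alpha> p (vs[i := u]) + b * \<alpha> p (vs[i := w])) \<and>
     (\<forall>p vs i j. tangent_list A k p vs \<and> i < j \<and> j < k \<and> vs ! i = vs ! j \<longrightarrow> \<alpha> p vs = 0) \<and>
     (\<forall>U Xs. open U \<and> length Xs = k \<and> (\<forall>X\<in>set Xs. vector_field_on A U X)
        \<longrightarrow> smooth_fun_on A U (\<lambda>p. \<alpha> p (map (\<lambda>X. X p) Xs)))}"

definition zero_form :: "('m \<Rightarrow> real) \<Rightarrow> 'm form" where
  "zero_form h = (\<lambda>p vs. if vs = [] then h p else 0)"

definition pullback ::
  "('m::topological_space, 'e::real_normed_vector) chart set \<Rightarrow>
   ('n::topological_space, 'f::real_normed_vector) chart set \<Rightarrow> ('m \<Rightarrow> 'n) \<Rightarrow> nat \<Rightarrow> 'n form \<Rightarrow> 'm form"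
  where "pullback A B F k \<alpha> = (\<lambda>p vs. if tangent_list A k p vs
     then \<alpha> (F p) (map (differential B F p) vs) else 0)"

definition interior :: "('m \<Rightarrow> 'm tvec) \<Rightarrow> 'm form \<Rightarrow> 'm form" where
  "interior X \<alpha> = (\<lambda>p vs. \<alpha> p (X p # vs))"

(* The value at p of (d alpha)(X_0, ..., X_k) by the invariant (Cartan) formula;
   nths Xs (-{i}) is Xs with the i-th entry omitted. *)
definition cartan_formula ::
  "('m::topological_space, 'e::real_normed_vector) chart set \<Rightarrow> nat \<Rightarrow> 'm form \<Rightarrow>
   ('m \<Rightarrow> 'm tvec) list \<Rightarrow> 'm \<Rightarrow> real" where
  "cartan_formula A k \<alpha> Xs p =
     (\<Sum>i\<le>k. (-1) ^ i * (Xs ! i) p (\<lambda>q. \<alpha> q (map (\<lambda>X. X q) (nths Xs (- {i}))))) +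
     (\<Sum>j\<le>k. \<Sum>i<j. (-1) ^ (i + j) *
        \<alpha> p (vf_bracket A (Xs ! i) (Xs ! j) p # map (\<lambda>X. X p) (nths Xs (- {i, j}))))"

(* The common value of the formula for all vector fields extending vs to a neighbourhood of p. *)
definition ext_deriv ::
  "('m::topological_space, 'e::real_normed_vector) chart set \<Rightarrow> nat \<Rightarrow> 'm form \<Rightarrow> 'm form" where
  "ext_deriv A k \<alpha> = (\<lambda>p vs. if tangent_list A (Suc k) p vs
     then THE r. \<forall>U Xs. open U \<and> p \<in> U \<and> (\<forall>X\<in>set Xs. vector_field_on A U X) \<and> map (\<lambda>X. X p) Xs = vs
            \<longrightarrow> cartan_formula A k \<alpha> Xs p = r
     else 0)"

section \<open>Relative forms of a smooth map\<close>

(* Below A is the atlas of M, B the atlas of N, and F maps M to N. The components of relative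
   forms and of F-pairs are ordered as (N, M). *)
type_synonym ('n, 'm) rel_form = "'n form \<times> 'm form"
type_synonym ('n, 'm) rel_field = "('n \<Rightarrow> 'n tvec) \<times> ('m \<Rightarrow> 'm tvec)"

definition rel_forms ::
  "('m::topological_space, 'e::real_normed_vector) chart set \<Rightarrow>
   ('n::topological_space, 'f::real_normed_vector) chart set \<Rightarrow> nat \<Rightarrow> ('n, 'm) rel_form set" where
  "rel_forms A B k = forms B k \<times> (if k = 0 then {0} else forms A (k - 1))"

definition rel_d ::
  "('m::topological_space, 'e::real_normed_vector) chart set \<Rightarrow>
   ('n::topological_space, 'f::real_normed_vector) chart set \<Rightarrow> ('m \<Rightarrow> 'n) \<Rightarrow> nat \<Rightarrow>
   ('n, 'm) rel_form \<Rightarrow> ('n, 'm) rel_form" where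
  "rel_d A B F k \<theta> = (ext_deriv B k (fst \<theta>),
     pullback A B F k (fst \<theta>) - (if k = 0 then 0 else ext_deriv A (k - 1) (snd \<theta>)))"

(* A function on N as an element of Omega^0(F), and back. *)
definition rel_of_fun :: "('n \<Rightarrow> real) \<Rightarrow> ('n, 'm) rel_form" where
  "rel_of_fun h = (zero_form h, 0)"

definition fun_of_rel :: "('n, 'm) rel_form \<Rightarrow> 'n \<Rightarrow> real" where
  "fun_of_rel \<theta> = (\<lambda>p. fst \<theta> p [])"

definition F_pairs ::
  "('m::topological_space, 'e::real_normed_vector) chart set \<Rightarrow>
   ('n::topological_space, 'f::real_normed_vector) chart set \<Rightarrow> ('m \<Rightarrow> 'n) \<Rightarrow> ('n, 'm) rel_field set" where
  "F_pairs A B F = {v. fst v \<in> vector_fields B \<and> snd v \<in> vector_fields A \<and>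
     (\<forall>p. differential B F p (snd v p) = fst v (F p))}"

definition rel_interior :: "('n, 'm) rel_field \<Rightarrow> ('n, 'm) rel_form \<Rightarrow> ('n, 'm) rel_form" where
  "rel_interior v \<theta> = (interior (fst v) (fst \<theta>), - interior (snd v) (snd \<theta>))"

definition rel_interior2 ::
  "('n, 'm) rel_field \<Rightarrow> ('n, 'm) rel_field \<Rightarrow> ('n, 'm) rel_form \<Rightarrow> ('n, 'm) rel_form" where
  "rel_interior2 v w \<theta> = rel_interior w (rel_interior v \<theta>)"

definition strongly_nondegenerate ::
  "('m::topological_space, 'e::real_normed_vector) chart set \<Rightarrow>
   ('n::topological_space, 'f::real_normed_vector) chart set \<Rightarrow> ('m \<Rightarrow> 'n) \<Rightarrow> ('n, 'm) rel_form \<Rightarrow> bool" where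
  "strongly_nondegenerate A B F \<theta> \<longleftrightarrow> (\<forall>v\<in>F_pairs A B F. rel_interior v \<theta> = 0 \<longrightarrow> v = 0)"

definition hamiltonian_pair ::
  "('m::topological_space, 'e::real_normed_vector) chart set \<Rightarrow>
   ('n::topological_space, 'f::real_normed_vector) chart set \<Rightarrow> ('m \<Rightarrow> 'n) \<Rightarrow> ('n, 'm) rel_form \<Rightarrow>
   ('n \<Rightarrow> real) \<Rightarrow> ('n, 'm) rel_field \<Rightarrow> bool" where
  "hamiltonian_pair A B F \<theta> \<sigma> v \<longleftrightarrow>
     v \<in> F_pairs A B F \<and> rel_d A B F 0 (rel_of_fun \<sigma>) = - rel_interior v \<theta>"

definition Ham0 ::
  "('m::topological_space, 'e::real_normed_vector) chart set \<Rightarrow>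
   ('n::topological_space, 'f::real_normed_vector) chart set \<Rightarrow> ('m \<Rightarrow> 'n) \<Rightarrow> ('n, 'm) rel_form \<Rightarrow>
   ('n \<Rightarrow> real) set" where
  "Ham0 A B F \<theta> = {\<sigma>\<in>Cinf B. \<exists>v. hamiltonian_pair A B F \<theta> \<sigma> v}"

(* The bracket does not depend on the choice of the Hamiltonian F-pairs. *)
definition ham_bracket ::
  "('m::topological_space, 'e::real_normed_vector) chart set \<Rightarrow>
   ('n::topological_space, 'f::real_normed_vector) chart set \<Rightarrow> ('m \<Rightarrow> 'n) \<Rightarrow> ('n, 'm) rel_form \<Rightarrow>
   ('n \<Rightarrow> real) \<Rightarrow> ('n \<Rightarrow> real) \<Rightarrow> 'n \<Rightarrow> real" where
  "ham_bracket A B F \<theta> \<sigma>\<^sub>1 \<sigma>\<^sub>2 = fun_of_rel (rel_interior2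
     (SOME v. hamiltonian_pair A B F \<theta> \<sigma>\<^sub>1 v) (SOME v. hamiltonian_pair A B F \<theta> \<sigma>\<^sub>2 v) \<theta>)"

section \<open>Lie groups and their actions\<close>

definition lie_group ::
  "('g::{second_countable_topology,t2_space}) monoid \<Rightarrow> ('g, 'k::{real_inner,banach}) chart set \<Rightarrow> bool"
  where "lie_group G C \<longleftrightarrow> smooth_manifold C \<and> group G \<and> carrier G = UNIV \<and>
     smooth_map (prod_atlas C C) UNIV C (\<lambda>(a, b). a \<otimes>\<^bsub>G\<^esub> b) \<and>
     smooth_map C UNIV C (m_inv G)"

definition lie_algebra ::
  "'g::topological_space monoid \<Rightarrow> ('g, 'k::real_normed_vector) chart set \<Rightarrow> 'g tvec set" where
  "lie_algebra G C = tangent_space C \<one>\<^bsub>G\<^esub>"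

definition left_invariant_field ::
  "'g::topological_space monoid \<Rightarrow> ('g, 'k::real_normed_vector) chart set \<Rightarrow> 'g tvec \<Rightarrow> 'g \<Rightarrow> 'g tvec" where
  "left_invariant_field G C x a = differential C (\<lambda>b. a \<otimes>\<^bsub>G\<^esub> b) \<one>\<^bsub>G\<^esub> x"

definition lie_bracket ::
  "'g::topological_space monoid \<Rightarrow> ('g, 'k::real_normed_vector) chart set \<Rightarrow>
   'g tvec \<Rightarrow> 'g tvec \<Rightarrow> 'g tvec" where
  "lie_bracket G C x y = vf_bracket C (left_invariant_field G C x) (left_invariant_field G C y) \<one>\<^bsub>G\<^esub>"

definition integral_curve ::
  "('m::topological_space, 'e::real_normed_vector) chart set \<Rightarrow> ('m \<Rightarrow> 'm tvec) \<Rightarrow> (real \<Rightarrow> 'm) \<Rightarrow> bool" where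
  "integral_curve A X \<gamma> \<longleftrightarrow> continuous_on UNIV \<gamma> \<and> (\<forall>t h. smooth_near A (\<gamma> t) h
     \<longrightarrow> ((\<lambda>s. h (\<gamma> s)) has_real_derivative X (\<gamma> t) h) (at t))"

definition lie_exp ::
  "'g::topological_space monoid \<Rightarrow> ('g, 'k::real_normed_vector) chart set \<Rightarrow> 'g tvec \<Rightarrow> 'g" where
  "lie_exp G C x =
     (THE \<gamma>. integral_curve C (left_invariant_field G C x) \<gamma> \<and> \<gamma> 0 = \<one>\<^bsub>G\<^esub>) 1"

definition lie_Ad ::
  "'g::topological_space monoid \<Rightarrow> ('g, 'k::real_normed_vector) chart set \<Rightarrow> 'g \<Rightarrow> 'g tvec \<Rightarrow> 'g tvec" where
  "lie_Ad G C a x = differential C (\<lambda>b. a \<otimes>\<^bsub>G\<^esub> b \<otimes>\<^bsub>G\<^esub> inv\<^bsub>G\<^esub> a) \<one>\<^bsub>G\<^esub> x"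

definition smooth_action ::
  "'g::topological_space monoid \<Rightarrow> ('g, 'k::real_normed_vector) chart set \<Rightarrow>
   ('m::topological_space, 'e::real_normed_vector) chart set \<Rightarrow> ('g \<Rightarrow> 'm \<Rightarrow> 'm) \<Rightarrow> bool" where
  "smooth_action G C A \<rho> \<longleftrightarrow> group_action G UNIV \<rho> \<and>
     smooth_map (prod_atlas C A) UNIV A (\<lambda>(a, p). \<rho> a p)"

(* The minus sign in exp(-tx) makes this a homomorphism for the bracket of left-invariant fields. *)
definition fundamental_field ::
  "'g::topological_space monoid \<Rightarrow> ('g, 'k::real_normed_vector) chart set \<Rightarrow>
   ('m::topological_space, 'e::real_normed_vector) chart set \<Rightarrow> ('g \<Rightarrow> 'm \<Rightarrow> 'm) \<Rightarrow>
   'g tvec \<Rightarrow> 'm \<Rightarrow> 'm tvec" where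
  "fundamental_field G C A \<rho> x p = velocity A (\<lambda>t. \<rho> (lie_exp G C (tscale (- t) x)) p) 0"

(* rN and rM are the two components of the action on F. *)
definition action_on_map ::
  "'g::topological_space monoid \<Rightarrow> ('g, 'k::real_normed_vector) chart set \<Rightarrow>
   ('m::topological_space, 'e::real_normed_vector) chart set \<Rightarrow>
   ('n::topological_space, 'f::real_normed_vector) chart set \<Rightarrow> ('m \<Rightarrow> 'n) \<Rightarrow>
   ('g \<Rightarrow> 'n \<Rightarrow> 'n) \<Rightarrow> ('g \<Rightarrow> 'm \<Rightarrow> 'm) \<Rightarrow> bool" where
  "action_on_map G C A B F rN rM \<longleftrightarrow> smooth_action G C B rN \<and> smooth_action G C A rM \<and>
     (\<forall>g p. F (rM g p) = rN g (F p))"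

definition preserves_rel_form ::
  "('m::topological_space, 'e::real_normed_vector) chart set \<Rightarrow>
   ('n::topological_space, 'f::real_normed_vector) chart set \<Rightarrow>
   ('g \<Rightarrow> 'n \<Rightarrow> 'n) \<Rightarrow> ('g \<Rightarrow> 'm \<Rightarrow> 'm) \<Rightarrow> nat \<Rightarrow> ('n, 'm) rel_form \<Rightarrow> bool" where
  "preserves_rel_form A B rN rM k \<theta> \<longleftrightarrow>
     (\<forall>g. pullback B B (rN g) k (fst \<theta>) = fst \<theta> \<and> pullback A A (rM g) (k - 1) (snd \<theta>) = snd \<theta>)"

definition fundamental_pair ::
  "'g::topological_space monoid \<Rightarrow> ('g, 'k::real_normed_vector) chart set \<Rightarrow>
   ('m::topological_space, 'e::real_normed_vector) chart set \<Rightarrow>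
   ('n::topological_space, 'f::real_normed_vector) chart set \<Rightarrow>
   ('g \<Rightarrow> 'n \<Rightarrow> 'n) \<Rightarrow> ('g \<Rightarrow> 'm \<Rightarrow> 'm) \<Rightarrow> 'g tvec \<Rightarrow> ('n, 'm) rel_field" where
  "fundamental_pair G C A B rN rM x = (fundamental_field G C B rN x, fundamental_field G C A rM x)"

section \<open>Comoment maps\<close>

(* Maps on the Lie algebra are total functions of which only the values on lie_algebra G C count. *)
definition linear_to_fun ::
  "'g::topological_space monoid \<Rightarrow> ('g, 'k::real_normed_vector) chart set \<Rightarrow>
   ('n::topological_space, 'f::real_normed_vector) chart set \<Rightarrow> ('g tvec \<Rightarrow> 'n \<Rightarrow> real) \<Rightarrow> bool" where
  "linear_to_fun G C B f \<longleftrightarrow> (\<forall>x\<in>lie_algebra G C. f x \<in> Cinf B) \<and>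
     (\<forall>x\<in>lie_algebra G C. \<forall>y\<in>lie_algebra G C. \<forall>a b p.
        f (tscale a x + tscale b y) p = a * f x p + b * f y p)"

definition comoment_map ::
  "'g::topological_space monoid \<Rightarrow> ('g, 'k::real_normed_vector) chart set \<Rightarrow>
   ('m::topological_space, 'e::real_normed_vector) chart set \<Rightarrow>
   ('n::topological_space, 'f::real_normed_vector) chart set \<Rightarrow> ('m \<Rightarrow> 'n) \<Rightarrow>
   ('g \<Rightarrow> 'n \<Rightarrow> 'n) \<Rightarrow> ('g \<Rightarrow> 'm \<Rightarrow> 'm) \<Rightarrow> ('n, 'm) rel_form \<Rightarrow> ('g tvec \<Rightarrow> 'n \<Rightarrow> real) \<Rightarrow> bool" where
  "comoment_map G C A B F rN rM \<theta> f \<longleftrightarrow> linear_to_fun G C B f \<and>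
     (\<forall>x\<in>lie_algebra G C.
        rel_d A B F 0 (rel_of_fun (f x)) = - rel_interior (fundamental_pair G C A B rN rM x) \<theta>)"

definition strict_moment_map ::
  "'g::topological_space monoid \<Rightarrow> ('g, 'k::real_normed_vector) chart set \<Rightarrow>
   ('m::topological_space, 'e::real_normed_vector) chart set \<Rightarrow>
   ('n::topological_space, 'f::real_normed_vector) chart set \<Rightarrow> ('m \<Rightarrow> 'n) \<Rightarrow>
   ('g \<Rightarrow> 'n \<Rightarrow> 'n) \<Rightarrow> ('g \<Rightarrow> 'm \<Rightarrow> 'm) \<Rightarrow> ('n, 'm) rel_form \<Rightarrow> ('g tvec \<Rightarrow> 'n \<Rightarrow> real) \<Rightarrow> bool" where
  "strict_moment_map G C A B F rN rM \<theta> f \<longleftrightarrow> linear_to_fun G C B f \<and>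
     (\<forall>x\<in>lie_algebra G C.
        rel_d A B F 0 (rel_of_fun (f x)) + rel_interior (fundamental_pair G C A B rN rM x) \<theta> = 0) \<and>
     (\<forall>x\<in>lie_algebra G C. \<forall>y\<in>lie_algebra G C.
        rel_of_fun (f (lie_bracket G C x y)) =
        rel_interior2 (fundamental_pair G C A B rN rM x) (fundamental_pair G C A B rN rM y) \<theta>)"

definition kostant_souriau_cocycle ::
  "'g::topological_space monoid \<Rightarrow> ('g, 'k::real_normed_vector) chart set \<Rightarrow>
   ('m::topological_space, 'e::real_normed_vector) chart set \<Rightarrow>
   ('n::topological_space, 'f::real_normed_vector) chart set \<Rightarrow> ('m \<Rightarrow> 'n) \<Rightarrow> ('n, 'm) rel_form \<Rightarrow>
   ('g tvec \<Rightarrow> 'n \<Rightarrow> real) \<Rightarrow> 'g tvec \<Rightarrow> 'g tvec \<Rightarrow> 'n \<Rightarrow> real" where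
  "kostant_souriau_cocycle G C A B F \<theta> f x y = f (lie_bracket G C x y) - ham_bracket A B F \<theta> (f x) (f y)"

end

theory Submission
  imports Defs
begin

text \<open>
A comoment map is pinned down without any freedom to add constants. The equation
\<open>d\<^sub>F f(x) = - \<iota>\<^bsub>v\<^sub>x\<^esub> \<theta>\<close>, with \<open>\<theta> = (\<omega>, \<eta>)\<close>, has two components: on \<open>N\<close> it prescribes the
differential of \<open>f(x)\<close>, and on \<open>M\<close> it prescribes the function \<open>f(x) \<circ> F\<close> itself. Two solutions
therefore differ by a constant, because \<open>N\<close> is connected, and that constant is zero at any point in
the image of \<open>F\<close> (\<open>relative_function_eqI\<close>). Uniqueness and the absence of constants in the last
part of the theorem are immediate.

The other parts come from applying this uniqueness to the action of one group element \<open>a\<close>. Since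
\<open>a\<close> preserves \<open>\<omega>\<close> and \<open>\<eta>\<close> and carries the fundamental field of \<open>Ad(a\<inverse>) x\<close> to that of
\<open>x\<close>, the functions \<open>f(x) \<circ> a\<close> and \<open>f(Ad(a\<inverse>) x)\<close> have the same differential and the same pullback
along \<open>F\<close>; hence they agree (\<open>equivariant\<close>). Differentiating \<open>f(y) \<circ> a = f(Ad(a\<inverse>) y)\<close> with respect
to \<open>a\<close> at the unit in the direction \<open>x\<close> gives \<open>- v\<^sub>x f(y)\<close> on the left; on the right, \<open>f\<close> is linear
on a finite-dimensional space and the derivative of \<open>Ad(a\<inverse>) y\<close> is \<open>- [x, y]\<close>, so the
right-hand side is \<open>- f([x, y])\<close> (\<open>infinitesimally_equivariant\<close>). Finally
\<open>v\<^sub>x f(y) = - \<omega>(v\<^sub>y, v\<^sub>x) = \<omega>(v\<^sub>x, v\<^sub>y)\<close>, which is the bracket of \<open>f(x)\<close> and \<open>f(y)\<close>, and this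
number is the same for all choices of Hamiltonian pairs.

Two facts about Lie groups carry the differentiation. First, \<open>v\<^sub>x h(p) = - x(b \<mapsto> h(b \<cdot> p))\<close>
(\<open>fund_apply\<close>), which rests on the existence and uniqueness of the integral curve that defines
the exponential map: a solution near the unit comes from a Picard iteration in a chart
(\<open>integral_curve_local\<close>), it is prolonged by multiplication in the group
(\<open>integral_curve_global\<close>), and two solutions \<open>\<gamma>\<close>, \<open>\<delta>\<close> agree because \<open>\<gamma> \<delta>\<inverse>\<close> has zero velocity
(\<open>integral_curves_agree\<close>). Secondly, the derivative of \<open>Ad(a\<inverse>) y\<close> is \<open>- [x, y]\<close>
(\<open>Ad_derivative\<close>), where the two terms of the bracket come from the two occurrences of \<open>a\<close> in
\<open>a\<inverse> b a\<close>, with the symmetry of second derivatives exchanging the order of differentiation in one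
of them.
\<close>

section \<open>Differential calculus in finite-dimensional inner product spaces\<close>

text \<open>The expansion property of an orthonormal basis; it says that \<open>D\<close> is a finite Parseval frame. The model
spaces may be of dimension zero, which the type class of Euclidean spaces excludes, so finite
dimension enters through such a set \<open>D\<close> instead.\<close>

definition onb :: "'a::real_inner set \<Rightarrow> bool" where
  "onb D \<longleftrightarrow> finite D \<and> (\<forall>x. (\<Sum>d\<in>D. (x \<bullet> d) *\<^sub>R d) = x)"

lemma onbD:
  assumes "onb D" shows "finite D" "(\<Sum>d\<in>D. (x \<bullet> d) *\<^sub>R d) = x"
  using assms by (auto simp: onb_def)

lemma ex_onb:
  assumes "finite B" "span B = (UNIV :: 'a::real_inner set)"
  shows "\<exists>D::'a set. onb D"
proof -
  obtain C0 where C0: "finite C0" "span C0 = (UNIV::'a set)" "pairwise orthogonal C0"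
    using basis_orthogonal[OF assms(1)] assms(2) by auto
  define C where "C = C0 - {0}"
  have C: "finite C" "span C = (UNIV::'a set)" "pairwise orthogonal C" "0 \<notin> C"
    using C0 by (auto simp: C_def span_delete_0 pairwise_def)
  have orth: "c \<bullet> d = 0" if "c \<in> C" "d \<in> C" "c \<noteq> d" for c d
    using C(3) that by (auto simp: pairwise_def orthogonal_def)
  have sgn1: "sgn c \<bullet> sgn c = 1" if "c \<in> C" for c
    using that C(4) by (metis norm_eq_1 norm_sgn)
  have inj: "inj_on sgn C"
  proof (rule inj_onI, rule ccontr)
    fix c d assume cd: "c \<in> C" "d \<in> C" "sgn c = sgn d" "c \<noteq> d"
    have "sgn c \<bullet> sgn d = inverse (norm c) * (inverse (norm d) * (c \<bullet> d))"
      unfolding sgn_div_norm by simp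
    then show False using cd sgn1[of c] orth[of c d] by simp
  qed
  have "onb (sgn ` C)" unfolding onb_def
  proof (intro conjI allI)
    show "finite (sgn ` C)" using C by simp
    fix x :: 'a
    have "x \<in> range (\<lambda>u. \<Sum>c\<in>C. u c *\<^sub>R c)" using C(2) span_finite[OF C(1)] by simp
    then obtain u where u: "x = (\<Sum>c\<in>C. u c *\<^sub>R c)" by (rule rangeE)
    have xd: "x \<bullet> d = u d * (d \<bullet> d)" if "d \<in> C" for d
    proof -
      have "x \<bullet> d = (\<Sum>c\<in>C. u c * (c \<bullet> d))" by (simp add: u inner_sum_left)
      also have "\<dots> = (\<Sum>c\<in>C. if c = d then u d * (d \<bullet> d) else 0)"
        by (rule sum.cong) (auto simp: orth that)
      finally show ?thesis using that C(1) by simp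
    qed
    have "(\<Sum>d\<in>sgn ` C. (x \<bullet> d) *\<^sub>R d) = (\<Sum>d\<in>C. (x \<bullet> sgn d) *\<^sub>R sgn d)"
      by (simp add: sum.reindex[OF inj])
    also have "\<dots> = (\<Sum>c\<in>C. u c *\<^sub>R c)"
    proof (rule sum.cong)
      fix d assume d: "d \<in> C"
      then have "norm d \<noteq> 0" using C(4) by auto
      then show "(x \<bullet> sgn d) *\<^sub>R sgn d = u d *\<^sub>R d"
        by (simp add: sgn_div_norm xd[OF d] power2_norm_eq_inner[symmetric] power2_eq_square)
    qed simp
    finally show "(\<Sum>d\<in>sgn ` C. (x \<bullet> d) *\<^sub>R d) = x" using u by simp
  qed
  then show ?thesis by blast
qed

lemma linear_onb:
  assumes "onb D" "linear L" shows "L x = (\<Sum>d\<in>D. (x \<bullet> d) *\<^sub>R L d)"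
proof -
  have "L x = L (\<Sum>d\<in>D. (x \<bullet> d) *\<^sub>R d)" by (simp add: onbD[OF assms(1)])
  also have "\<dots> = (\<Sum>d\<in>D. (x \<bullet> d) *\<^sub>R L d)"
    using assms(2) by (simp add: linear_sum linear_cmul)
  finally show ?thesis .
qed

lemma has_derivative_cong_open:
  assumes "open U" "x \<in> U" "\<And>y. y \<in> U \<Longrightarrow> f y = g y"
  shows "(f has_derivative D) (at x) \<longleftrightarrow> (g has_derivative D) (at x)"
proof
  show "(g has_derivative D) (at x)" if "(f has_derivative D) (at x)"
    by (rule has_derivative_transform_within_open[OF that assms(1,2)]) (rule assms(3))
  show "(f has_derivative D) (at x)" if "(g has_derivative D) (at x)"
    by (rule has_derivative_transform_within_open[OF that assms(1,2)]) (rule assms(3)[symmetric])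
qed

lemma frechet_derivative_cong_open:
  assumes "open U" "x \<in> U" "\<And>y. y \<in> U \<Longrightarrow> f y = g y"
  shows "frechet_derivative f (at x) = frechet_derivative g (at x)"
  using has_derivative_cong_open[OF assms] by (simp add: frechet_derivative_def)

lemma frechet_eqI: "(f has_derivative D) (at x) \<Longrightarrow> frechet_derivative f (at x) = D"
  using frechet_derivative_at by metis

lemma frechet_works:
  "f differentiable (at x) \<Longrightarrow> (f has_derivative frechet_derivative f (at x)) (at x)"
  by (simp add: frechet_derivative_works[symmetric])

lemma Ck_on_mono: "Ck_on k S f \<Longrightarrow> T \<subseteq> S \<Longrightarrow> Ck_on k T f"
  by (induction k arbitrary: f) (simp add: continuous_on_subset, auto)

lemma Ck_on_SucD: "Ck_on (Suc k) S f \<Longrightarrow> Ck_on k S f"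
proof (induction k arbitrary: f)
  case 0
  then show ?case
    by (auto intro!: continuous_at_imp_continuous_on differentiable_imp_continuous_within)
next
  case (Suc k)
  from Suc.prems have *: "\<And>x. x \<in> S \<Longrightarrow> f differentiable (at x)"
    "\<And>v. Ck_on (Suc k) S (\<lambda>x. frechet_derivative f (at x) v)"
    by (simp_all only: Ck_on.simps(2)[of "Suc k" S f])
  show ?case using * Suc.IH by simp
qed

text \<open>The iterated derivatives at a point depend only on the germ of the function there. This is how
chart expressions, which agree with smooth functions only on small open sets, are recognised as
smooth.\<close>

lemma Ck_on_local:
  "(\<And>x. x \<in> S \<Longrightarrow> \<exists>U g. open U \<and> x \<in> U \<and> Ck_on k U g \<and> (\<forall>y\<in>U. f y = g y)) \<Longrightarrow> Ck_on k S f"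
proof (induction k arbitrary: f)
  case 0
  show ?case unfolding Ck_on.simps
  proof (rule continuous_at_imp_continuous_on, rule ballI)
    fix x assume "x \<in> S"
    from 0[OF this] obtain U g where U: "open U" "x \<in> U" "continuous_on U g" "\<forall>y\<in>U. f y = g y" by auto
    then have "continuous_on U f" by (metis continuous_on_cong)
    then show "continuous (at x) f" using U continuous_on_eq_continuous_at by blast
  qed
next
  case (Suc k)
  show ?case unfolding Ck_on.simps
  proof (intro conjI ballI allI)
    fix x assume "x \<in> S"
    from Suc.prems[OF this] obtain U g where U: "open U" "x \<in> U" "Ck_on (Suc k) U g" "\<forall>y\<in>U. f y = g y"
      by blast
    then have "g differentiable (at x)" by simp
    then show "f differentiable (at x)"
      using has_derivative_cong_open[of U x f g] U unfolding differentiable_def by auto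
  next
    fix v
    show "Ck_on k S (\<lambda>x. frechet_derivative f (at x) v)"
    proof (rule Suc.IH)
      fix x assume "x \<in> S"
      from Suc.prems[OF this] obtain U g where U: "open U" "x \<in> U" "Ck_on (Suc k) U g" "\<forall>y\<in>U. f y = g y"
        by blast
      show "\<exists>U g. open U \<and> x \<in> U \<and> Ck_on k U g \<and> (\<forall>y\<in>U. frechet_derivative f (at y) v = g y)"
        using U frechet_derivative_cong_open[of U _ f g]
        by (intro exI[of _ U] exI[of _ "\<lambda>y. frechet_derivative g (at y) v"]) auto
    qed
  qed
qed

lemma Ck_on_cong:
  assumes "Ck_on k S f" "open S" "\<And>x. x \<in> S \<Longrightarrow> g x = f x"
  shows "Ck_on k S g"
proof (rule Ck_on_local)
  fix x assume "x \<in> S"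
  then show "\<exists>U h. open U \<and> x \<in> U \<and> Ck_on k U h \<and> (\<forall>y\<in>U. g y = h y)"
    using assms by (intro exI[of _ S] exI[of _ f]) simp
qed

lemma Ck_on_const: "Ck_on k S (\<lambda>x. c)"
proof (induction k arbitrary: c)
  case 0
  show ?case by (simp add: continuous_on_const)
next
  case (Suc k)
  have "frechet_derivative (\<lambda>x. c) (at x) v = 0" for x v
    by (subst frechet_eqI[of _ "\<lambda>x. 0"]) (rule has_derivative_const, rule refl)
  then show ?case using Suc.IH[of 0] by simp
qed

lemma Ck_on_linear_comp:
  assumes L: "bounded_linear L" and S: "open S"
  shows "Ck_on k S f \<Longrightarrow> Ck_on k S (\<lambda>x. L (f x))"
proof (induction k arbitrary: f)
  case 0
  then show ?case using L by (simp add: bounded_linear.continuous_on)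
next
  case (Suc k)
  have d: "((\<lambda>x. L (f x)) has_derivative (\<lambda>v. L (frechet_derivative f (at x) v))) (at x)" if "x \<in> S" for x
    using Suc.prems that by (intro bounded_linear.has_derivative[OF L]) (auto intro: frechet_works)
  show ?case unfolding Ck_on.simps
  proof (intro conjI ballI allI)
    show "x \<in> S \<Longrightarrow> (\<lambda>x. L (f x)) differentiable at x" for x
      using d unfolding differentiable_def by blast
    show "Ck_on k S (\<lambda>x. frechet_derivative (\<lambda>x. L (f x)) (at x) v)" for v
      by (rule Ck_on_cong[OF Suc.IH[of "\<lambda>x. frechet_derivative f (at x) v"] S])
        (use Suc.prems in \<open>simp_all add: frechet_eqI[OF d]\<close>)
  qed
qed

lemma Ck_on_id: "Ck_on k S (\<lambda>x. x)"
proof (cases k)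
  case 0
  then show ?thesis by (simp add: continuous_on_id)
next
  case (Suc j)
  have "frechet_derivative (\<lambda>x. x) (at x) v = v" for x v :: 'a
    by (subst frechet_eqI[of _ "\<lambda>x. x"]) (rule has_derivative_ident, rule refl)
  then show ?thesis by (simp add: Suc Ck_on_const)
qed

lemma Ck_on_add:
  assumes S: "open S"
  shows "Ck_on k S f \<Longrightarrow> Ck_on k S g \<Longrightarrow> Ck_on k S (\<lambda>x. f x + g x)"
proof (induction k arbitrary: f g)
  case 0
  then show ?case by (simp add: continuous_on_add)
next
  case (Suc k)
  have d: "((\<lambda>x. f x + g x) has_derivative
      (\<lambda>v. frechet_derivative f (at x) v + frechet_derivative g (at x) v)) (at x)" if "x \<in> S" for x
    using Suc.prems that by (intro has_derivative_add) (auto intro: frechet_works)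
  show ?case unfolding Ck_on.simps
  proof (intro conjI ballI allI)
    show "x \<in> S \<Longrightarrow> (\<lambda>x. f x + g x) differentiable at x" for x
      using d unfolding differentiable_def by blast
    show "Ck_on k S (\<lambda>x. frechet_derivative (\<lambda>x. f x + g x) (at x) v)" for v
      by (rule Ck_on_cong[OF Suc.IH[of "\<lambda>x. frechet_derivative f (at x) v"
              "\<lambda>x. frechet_derivative g (at x) v"] S])
        (use Suc.prems in \<open>simp_all add: frechet_eqI[OF d]\<close>)
  qed
qed

lemma Ck_on_scaleR:
  fixes a :: "'a::real_normed_vector \<Rightarrow> real"
  assumes S: "open S"
  shows "Ck_on k S a \<Longrightarrow> Ck_on k S g \<Longrightarrow> Ck_on k S (\<lambda>x. a x *\<^sub>R g x)"
proof (induction k arbitrary: a g)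
  case 0
  then show ?case by (simp add: continuous_on_scaleR)
next
  case (Suc k)
  have d: "((\<lambda>x. a x *\<^sub>R g x) has_derivative
      (\<lambda>v. a x *\<^sub>R frechet_derivative g (at x) v + frechet_derivative a (at x) v *\<^sub>R g x)) (at x)"
    if "x \<in> S" for x
    using Suc.prems that by (intro has_derivative_scaleR) (auto intro: frechet_works)
  show ?case unfolding Ck_on.simps
  proof (intro conjI ballI allI)
    show "x \<in> S \<Longrightarrow> (\<lambda>x. a x *\<^sub>R g x) differentiable at x" for x
      using d unfolding differentiable_def by blast
    fix v
    have "Ck_on k S (\<lambda>x. a x *\<^sub>R frechet_derivative g (at x) v + frechet_derivative a (at x) v *\<^sub>R g x)"
      using Suc.prems Ck_on_SucD[OF Suc.prems(1)] Ck_on_SucD[OF Suc.prems(2)]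
      by (intro Ck_on_add[OF S] Suc.IH) auto
    then show "Ck_on k S (\<lambda>x. frechet_derivative (\<lambda>x. a x *\<^sub>R g x) (at x) v)"
      by (rule Ck_on_cong[OF _ S]) (auto simp: frechet_eqI[OF d])
  qed
qed

lemma Ck_on_sum:
  assumes "open S" "\<And>i. i \<in> I \<Longrightarrow> Ck_on k S (f i)"
  shows "Ck_on k S (\<lambda>x. \<Sum>i\<in>I. f i x)"
  using assms(2)
  by (induction I rule: infinite_finite_induct) (simp_all add: Ck_on_const Ck_on_add[OF assms(1)])

text \<open>\<^const>\<open>Ck_on\<close> differentiates in one fixed direction at a time, whereas the chain rule feeds the moving
direction \<open>f'(x) v\<close> into \<open>g'\<close>. Expanding that direction in an orthonormal basis of the middle space
leaves derivatives of \<open>g\<close> in fixed directions, weighted by scalar functions, to which the induction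
hypothesis applies.\<close>

lemma Ck_on_compose:
  fixes f :: "'a::real_normed_vector \<Rightarrow> 'b::real_inner"
  assumes D: "onb (D::'b set)" and S: "open S" and fST: "f ` S \<subseteq> T"
  shows "Ck_on k S f \<Longrightarrow> Ck_on k T g \<Longrightarrow> Ck_on k S (\<lambda>x. g (f x))"
proof (induction k arbitrary: g)
  case 0
  then show ?case using fST by (auto intro: continuous_on_compose2[of T g S f])
next
  case (Suc k)
  let ?f' = "\<lambda>x. frechet_derivative f (at x)" and ?g' = "\<lambda>y. frechet_derivative g (at y)"
  have fk: "Ck_on k S f" using Suc.prems Ck_on_SucD by blast
  have d: "((\<lambda>x. g (f x)) has_derivative (\<lambda>v. ?g' (f x) (?f' x v))) (at x)" if "x \<in> S" for x
  proof -
    have "(f has_derivative ?f' x) (at x)" "(g has_derivative ?g' (f x)) (at (f x))"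
      using Suc.prems fST that by (auto intro!: frechet_works)
    from diff_chain_at[OF this] show ?thesis by (simp add: o_def)
  qed
  show ?case unfolding Ck_on.simps
  proof (intro conjI ballI allI)
    show "x \<in> S \<Longrightarrow> (\<lambda>x. g (f x)) differentiable at x" for x
      using d unfolding differentiable_def by blast
    fix v
    have 1: "Ck_on k S (\<lambda>x. \<Sum>c\<in>D. (?f' x v \<bullet> c) *\<^sub>R ?g' (f x) c)"
    proof (intro Ck_on_sum[OF S] Ck_on_scaleR[OF S])
      show "Ck_on k S (\<lambda>x. ?f' x v \<bullet> c)" for c
        using Suc.prems by (intro Ck_on_linear_comp[OF bounded_linear_inner_left S]) auto
      show "Ck_on k S (\<lambda>x. ?g' (f x) c)" for c
        proof (rule Suc.IH[OF fk])
        show "Ck_on k T (\<lambda>y. ?g' y c)" using Suc.prems by simp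
      qed
    qed
    show "Ck_on k S (\<lambda>x. frechet_derivative (\<lambda>x. g (f x)) (at x) v)"
    proof (rule Ck_on_cong[OF 1 S])
      fix x assume x: "x \<in> S"
      have "linear (?g' (f x))" using Suc.prems fST x by (auto intro!: linear_frechet_derivative)
      then show "frechet_derivative (\<lambda>x. g (f x)) (at x) v = (\<Sum>c\<in>D. (?f' x v \<bullet> c) *\<^sub>R ?g' (f x) c)"
        unfolding frechet_eqI[OF d[OF x]] by (rule linear_onb[OF D])
    qed
  qed
qed

lemma Cinf_on_compose:
  fixes f :: "'a::real_normed_vector \<Rightarrow> 'b::real_inner"
  assumes "onb (D::'b set)" "open S" "f ` S \<subseteq> T" "Cinf_on S f" "Cinf_on T g"
  shows "Cinf_on S (\<lambda>x. g (f x))"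
  unfolding Cinf_on_def
proof
  fix k
  show "Ck_on k S (\<lambda>x. g (f x))"
  proof (rule Ck_on_compose[OF assms(1-3)])
    show "Ck_on k S f" "Ck_on k T g" using assms(4,5) by (simp_all add: Cinf_on_def)
  qed
qed

lemma Cinf_on_Pair:
  assumes "open S" "Cinf_on S f" "Cinf_on S g"
  shows "Cinf_on S (\<lambda>x. (f x, g x))"
proof -
  have "Ck_on k S (\<lambda>x. (f x, 0) + (0, g x))" for k
  proof (intro Ck_on_add assms(1))
    show "Ck_on k S (\<lambda>x. (f x, 0))"
      using assms(2) by (intro Ck_on_linear_comp[OF _ assms(1), of "\<lambda>a. (a, 0)"])
        (auto simp: Cinf_on_def intro!: bounded_linear_Pair bounded_linear_ident bounded_linear_zero)
    show "Ck_on k S (\<lambda>x. (0, g x))"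
      using assms(3) by (intro Ck_on_linear_comp[OF _ assms(1), of "\<lambda>a. (0, a)"])
        (auto simp: Cinf_on_def intro!: bounded_linear_Pair bounded_linear_ident bounded_linear_zero)
  qed
  then show ?thesis by (simp add: Cinf_on_def)
qed

lemma Cinf_on_linear:
  assumes "bounded_linear L" "open S" shows "Cinf_on S L"
  unfolding Cinf_on_def using Ck_on_linear_comp[OF assms Ck_on_id] by blast

lemma Cinf_on_D:
  assumes "Cinf_on S f"
  shows "continuous_on S f" "x \<in> S \<Longrightarrow> f differentiable (at x)"
    "Cinf_on S (\<lambda>x. frechet_derivative f (at x) v)" "T \<subseteq> S \<Longrightarrow> Cinf_on T f"
proof -
  have *: "Ck_on k S f" for k using assms by (simp add: Cinf_on_def)
  show "continuous_on S f" using *[of 0] by simp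
  show "x \<in> S \<Longrightarrow> f differentiable (at x)" using *[of "Suc 0"] by simp
  show "Cinf_on S (\<lambda>x. frechet_derivative f (at x) v)"
    unfolding Cinf_on_def
  proof
    show "Ck_on k S (\<lambda>x. frechet_derivative f (at x) v)" for k using *[of "Suc k"] by simp
  qed
  show "T \<subseteq> S \<Longrightarrow> Cinf_on T f"
    unfolding Cinf_on_def using * Ck_on_mono[of _ S f T] by simp
qed

lemmas Cinf_on_continuous = Cinf_on_D(1) and Cinf_on_differentiable = Cinf_on_D(2)
  and Cinf_on_frechet = Cinf_on_D(3) and Cinf_on_mono = Cinf_on_D(4)

lemma Cinf_on_local:
  "(\<And>x. x \<in> S \<Longrightarrow> \<exists>U g. open U \<and> x \<in> U \<and> Cinf_on U g \<and> (\<forall>y\<in>U. f y = g y)) \<Longrightarrow> Cinf_on S f"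
  unfolding Cinf_on_def
proof (rule allI, rule Ck_on_local)
  fix k x
  assume "x \<in> S" and *: "\<And>x. x \<in> S \<Longrightarrow> \<exists>U g. open U \<and> x \<in> U \<and> (\<forall>k. Ck_on k U g) \<and> (\<forall>y\<in>U. f y = g y)"
  from *[OF this(1)] obtain U g where "open U" "x \<in> U" "\<forall>k. Ck_on k U g" "\<forall>y\<in>U. f y = g y"
    by blast
  then show "\<exists>U g. open U \<and> x \<in> U \<and> Ck_on k U g \<and> (\<forall>y\<in>U. f y = g y)"
    by (intro exI[of _ U] exI[of _ g]) simp
qed

text \<open>The second difference \<open>f(z + ha + hb) - f(z + ha) - f(z + hb) + f(z)\<close> is symmetric in \<open>a\<close> and \<open>b\<close>.
Two applications of the mean value theorem turn it into \<open>h\<^sup>2\<close> times a mixed second derivative at a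
nearby point, taken in either order.\<close>

lemma mixed_partials_meet:
  fixes f :: "'a::real_normed_vector \<Rightarrow> real"
  assumes f: "Cinf_on W f" and r: "r > 0" "ball z r \<subseteq> W"
  shows "\<exists>y1 y2. dist z y1 < r \<and> dist z y2 < r \<and>
    frechet_derivative (\<lambda>y. frechet_derivative f (at y) a) (at y1) b =
    frechet_derivative (\<lambda>y. frechet_derivative f (at y) b) (at y2) a"
proof -
  \<comment> \<open>step size for which the whole parallelogram stays inside the ball\<close>
  define h where "h = r / (2 * (norm a + norm b + 1))"
  have h: "h > 0" using r by (auto simp: h_def add_nonneg_pos)
  have hr: "h * (norm a + norm b + 1) < r"
  proof -
    have "norm a + norm b + 1 > 0" by (simp add: add_nonneg_pos)
    then have "h * (norm a + norm b + 1) = r / 2" by (simp only: h_def) (simp add: field_simps)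
    then show ?thesis using r by simp
  qed
  have inb: "z + s *\<^sub>R v + t *\<^sub>R w \<in> ball z r"
    if "norm v + norm w = norm a + norm b" "0 \<le> s" "s \<le> h" "0 \<le> t" "t \<le> h" for s t v w
  proof -
    have "norm (s *\<^sub>R v + t *\<^sub>R w) \<le> s * norm v + t * norm w"
      using that by (intro order_trans[OF norm_triangle_ineq]) auto
    also have "\<dots> \<le> h * norm v + h * norm w" using that by (intro add_mono mult_right_mono) auto
    also have "\<dots> = h * (norm a + norm b)" by (simp add: that(1)[symmetric] algebra_simps)
    also have "\<dots> < h * (norm a + norm b + 1)" using h by simp
    finally show ?thesis using hr by (simp add: dist_norm algebra_simps norm_minus_commute)
  qed
  have D1: "((\<lambda>s. g (p + s *\<^sub>R v)) has_real_derivative frechet_derivative g (at (p + s *\<^sub>R v)) v) (at s)"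
    if "g differentiable (at (p + s *\<^sub>R v))" for g :: "'a \<Rightarrow> real" and p v s
  proof -
    have "((\<lambda>s. p + s *\<^sub>R v) has_vector_derivative v) (at s)"
      by (auto intro!: derivative_eq_intros simp: has_vector_derivative_def)
    moreover have "(g has_derivative frechet_derivative g (at (p + s *\<^sub>R v))) (at (p + s *\<^sub>R v) within range (\<lambda>s. p + s *\<^sub>R v))"
      using frechet_works[OF that] has_derivative_at_withinI by blast
    ultimately have "((g \<circ> (\<lambda>s. p + s *\<^sub>R v)) has_vector_derivative frechet_derivative g (at (p + s *\<^sub>R v)) v) (at s)"
      by (rule vector_derivative_diff_chain_within)
    then show ?thesis by (simp add: o_def has_real_derivative_iff_has_vector_derivative)
  qed
  have key: "\<exists>y. dist z y < r \<and> f (z + h *\<^sub>R v + h *\<^sub>R w) - f (z + h *\<^sub>R v) - (f (z + h *\<^sub>R w) - f z)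
      = h * (h * frechet_derivative (\<lambda>y. frechet_derivative f (at y) v) (at y) w)"
    if n: "norm v + norm w = norm a + norm b" for v w
  proof -
    let ?f' = "\<lambda>y. frechet_derivative f (at y) v"
    have *: "((\<lambda>s. f (z + h *\<^sub>R w + s *\<^sub>R v) - f (z + s *\<^sub>R v)) has_real_derivative
        ?f' (z + h *\<^sub>R w + s *\<^sub>R v) - ?f' (z + s *\<^sub>R v)) (at s)" if "0 \<le> s" "s \<le> h" for s
    proof (rule DERIV_diff[OF D1[where g = f and p = "z + h *\<^sub>R w" and s = s and v = v]
            D1[where g = f and p = z and s = s and v = v]])
      show "f differentiable at (z + h *\<^sub>R w + s *\<^sub>R v)"
      proof (rule Cinf_on_differentiable[OF f])
        have "z + h *\<^sub>R w + s *\<^sub>R v = z + s *\<^sub>R v + h *\<^sub>R w"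
          by (simp only: add.assoc add.commute[of "h *\<^sub>R w"])
        moreover have "z + s *\<^sub>R v + h *\<^sub>R w \<in> ball z r"
          by (rule inb[OF n that]) (use h in simp_all)
        ultimately show "z + h *\<^sub>R w + s *\<^sub>R v \<in> W" using r(2) by (simp only: subset_iff)
      qed
      show "f differentiable at (z + s *\<^sub>R v)"
      proof (rule Cinf_on_differentiable[OF f])
        have "z + s *\<^sub>R v + 0 *\<^sub>R w \<in> ball z r"
          by (rule inb[OF n that]) (use h in simp_all)
        then show "z + s *\<^sub>R v \<in> W" using r(2) unfolding scaleR_zero_left add_0_right by (rule set_mp[rotated])
      qed
    qed
    obtain s where s: "0 < s" "s < h" "f (z + h *\<^sub>R w + h *\<^sub>R v) - f (z + h *\<^sub>R v) - (f (z + h *\<^sub>R w + 0 *\<^sub>R v) - f (z + 0 *\<^sub>R v))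
      = (h - 0) * (?f' (z + h *\<^sub>R w + s *\<^sub>R v) - ?f' (z + s *\<^sub>R v))"
      using MVT2[OF h *] by blast
    have "((\<lambda>t. ?f' (z + s *\<^sub>R v + t *\<^sub>R w)) has_real_derivative
        frechet_derivative ?f' (at (z + s *\<^sub>R v + t *\<^sub>R w)) w) (at t)" if "0 \<le> t" "t \<le> h" for t
      using inb[OF n _ _ that, of s] s r
      by (intro D1 Cinf_on_differentiable[OF Cinf_on_frechet[OF f]]) auto
    from MVT2[OF h this] obtain t where t: "0 < t" "t < h"
      "?f' (z + s *\<^sub>R v + h *\<^sub>R w) - ?f' (z + s *\<^sub>R v + 0 *\<^sub>R w)
        = (h - 0) * frechet_derivative ?f' (at (z + s *\<^sub>R v + t *\<^sub>R w)) w" by blast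
    show ?thesis using inb[OF n, of s t] s t
      by (intro exI[of _ "z + s *\<^sub>R v + t *\<^sub>R w"]) (auto simp: algebra_simps)
  qed
  obtain y1 where y1: "dist z y1 < r" "f (z + h *\<^sub>R a + h *\<^sub>R b) - f (z + h *\<^sub>R a) - (f (z + h *\<^sub>R b) - f z)
      = h * (h * frechet_derivative (\<lambda>y. frechet_derivative f (at y) a) (at y1) b)"
    using key[of a b] by auto
  obtain y2 where y2: "dist z y2 < r" "f (z + h *\<^sub>R b + h *\<^sub>R a) - f (z + h *\<^sub>R b) - (f (z + h *\<^sub>R a) - f z)
      = h * (h * frechet_derivative (\<lambda>y. frechet_derivative f (at y) b) (at y2) a)"
    using key[of b a] by (auto simp: add.commute)
  have "h * (h * frechet_derivative (\<lambda>y. frechet_derivative f (at y) a) (at y1) b)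
      = h * (h * frechet_derivative (\<lambda>y. frechet_derivative f (at y) b) (at y2) a)"
    unfolding y1(2)[symmetric] y2(2)[symmetric] by (simp add: algebra_simps)
  then show ?thesis using y1(1) y2(1) h by auto
qed

lemma mixed_partials_commute:
  fixes f :: "'a::real_normed_vector \<Rightarrow> real"
  assumes f: "Cinf_on W f" and W: "open W" "z \<in> W"
  shows "frechet_derivative (\<lambda>y. frechet_derivative f (at y) a) (at z) b =
    frechet_derivative (\<lambda>y. frechet_derivative f (at y) b) (at z) a"
    (is "?P z = ?Q z")
proof (rule ccontr)
  assume ne: "?P z \<noteq> ?Q z"
  define e where "e = dist (?P z) (?Q z) / 2"
  have e: "e > 0" using ne by (simp add: e_def)
  have cont: "continuous (at z) ?P" "continuous (at z) ?Q"
    using W Cinf_on_continuous[OF Cinf_on_frechet[OF Cinf_on_frechet[OF f]]]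
    by (auto simp: continuous_on_eq_continuous_at)
  obtain r1 where r1: "r1 > 0" "\<And>y. dist y z < r1 \<Longrightarrow> dist (?P y) (?P z) < e"
    using cont(1)[unfolded continuous_at_eps_delta, rule_format, OF e] by blast
  obtain r2 where r2: "r2 > 0" "\<And>y. dist y z < r2 \<Longrightarrow> dist (?Q y) (?Q z) < e"
    using cont(2)[unfolded continuous_at_eps_delta, rule_format, OF e] by blast
  obtain r3 where r3: "r3 > 0" "ball z r3 \<subseteq> W" using W open_contains_ball by blast
  let ?r = "min r1 (min r2 r3)"
  obtain y1 y2 where y: "dist z y1 < ?r" "dist z y2 < ?r" "?P y1 = ?Q y2"
    using mixed_partials_meet[OF f, of ?r z a b] r1 r2 r3 by (auto simp: subset_iff)
  have "dist (?P z) (?Q z) \<le> dist (?P y1) (?P z) + dist (?Q y2) (?Q z)"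
    using y(3) by (metis dist_commute dist_triangle3)
  also have "\<dots> < e + e" using y r1(2)[of y1] r2(2)[of y2] by (intro add_strict_mono) (auto simp: dist_commute)
  finally show False by (simp add: e_def)
qed

section \<open>Smooth maps between manifolds\<close>

text \<open>The part of \<^const>\<open>smooth_manifold\<close> that local arguments use, for arbitrary topological spaces and hence
also for the model spaces and their products.\<close>

definition atlas :: "('m::topological_space, 'e::real_inner) chart set \<Rightarrow> bool" where
  "atlas A \<longleftrightarrow> (\<exists>D::'e set. onb D) \<and> (\<forall>c\<in>A. is_chart c) \<and> (\<Union>c\<in>A. fst c) = UNIV \<and>
     (\<forall>c\<in>A. \<forall>d\<in>A. Cinf_on (snd c ` (fst c \<inter> fst d)) (snd d \<circ> inv_into (fst c) (snd c)))"

lemma smooth_manifold_atlas: "smooth_manifold A \<Longrightarrow> atlas A"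
  unfolding smooth_manifold_def atlas_def using ex_onb by blast

abbreviation cinv :: "('m, 'e) chart \<Rightarrow> 'e \<Rightarrow> 'm" where
  "cinv c \<equiv> inv_into (fst c) (snd c)"

lemma is_chartD:
  assumes "is_chart c"
  shows "open (fst c)" "open (snd c ` fst c)" "continuous_on (fst c) (snd c)"
    "continuous_on (snd c ` fst c) (cinv c)" "inj_on (snd c) (fst c)"
    "p \<in> fst c \<Longrightarrow> cinv c (snd c p) = p"
    "u \<in> snd c ` fst c \<Longrightarrow> snd c (cinv c u) = u"
    "u \<in> snd c ` fst c \<Longrightarrow> cinv c u \<in> fst c"
proof -
  have h: "homeomorphism (fst c) (snd c ` fst c) (snd c) (cinv c)" and "open (fst c)" "open (snd c ` fst c)"
    using assms by (auto simp: is_chart_def)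
  then show "open (fst c)" "open (snd c ` fst c)" "continuous_on (fst c) (snd c)"
    "continuous_on (snd c ` fst c) (cinv c)"
    by (auto simp: homeomorphism_def)
  show "inj_on (snd c) (fst c)" using h by (auto simp: homeomorphism_def intro: inj_on_inverseI)
  show "p \<in> fst c \<Longrightarrow> cinv c (snd c p) = p" using h by (simp add: homeomorphism_def)
  show "u \<in> snd c ` fst c \<Longrightarrow> snd c (cinv c u) = u" by (rule f_inv_into_f)
  show "u \<in> snd c ` fst c \<Longrightarrow> cinv c u \<in> fst c" by (rule inv_into_into)
qed

lemma is_chartI:
  assumes "open U" "open (\<phi> ` U)" "continuous_on U \<phi>" "continuous_on (\<phi> ` U) \<psi>"
    "\<And>p. p \<in> U \<Longrightarrow> \<psi> (\<phi> p) = p"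
  shows "is_chart (U, \<phi>)"
proof -
  have inj: "inj_on \<phi> U" using assms(5) by (metis inj_onI)
  have "continuous_on (\<phi> ` U) (inv_into U \<phi>)"
    using assms(4) by (rule continuous_on_eq) (auto simp: inj assms(5))
  then show ?thesis
    using assms(1-3) inj by (auto simp: is_chart_def homeomorphism_def image_image)
qed

lemma chart_image_open:
  assumes "is_chart c" "open W"
  shows "open (snd c ` (fst c \<inter> W))"
proof -
  have "snd c ` (fst c \<inter> W) = snd c ` fst c \<inter> cinv c -` W"
    using is_chartD(6-8)[OF assms(1)] by force
  then show ?thesis
    using continuous_open_preimage[OF is_chartD(4,2)[OF assms(1)] assms(2)] by simp
qed

lemma atlasD:
  fixes A :: "('m::topological_space, 'e::real_inner) chart set"
  assumes "atlas A"
  shows "\<exists>D::'e set. onb D" "c \<in> A \<Longrightarrow> is_chart c" "\<exists>c\<in>A. p \<in> fst c"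
    "c \<in> A \<Longrightarrow> d \<in> A \<Longrightarrow> Cinf_on (snd c ` (fst c \<inter> fst d)) (snd d \<circ> cinv c)"
  using assms unfolding atlas_def by blast+

lemma smooth_map_cont: "smooth_map A S B F \<Longrightarrow> continuous_on S F"
  by (simp add: smooth_map_def)

lemma smooth_map_open_vimage:
  "smooth_map A S B F \<Longrightarrow> open S \<Longrightarrow> open T \<Longrightarrow> open (S \<inter> F -` T)"
  by (rule continuous_open_preimage) (simp_all add: smooth_map_cont)

lemma smooth_map_subset:
  assumes "smooth_map A S B F" "T \<subseteq> S" shows "smooth_map A T B F"
  unfolding smooth_map_def
proof (intro conjI ballI)
  show "continuous_on T F" using assms smooth_map_cont continuous_on_subset by blast
  fix c d assume "c \<in> A" "d \<in> B"
  then have "Cinf_on (snd c ` (fst c \<inter> S \<inter> F -` fst d)) (snd d \<circ> F \<circ> cinv c)"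
    using assms(1) by (simp add: smooth_map_def)
  then show "Cinf_on (snd c ` (fst c \<inter> T \<inter> F -` fst d)) (snd d \<circ> F \<circ> cinv c)"
    by (rule Cinf_on_mono) (use assms(2) in auto)
qed

text \<open>Near a point, factor the chart expression of \<open>G \<circ> F\<close> through a chart of the middle manifold around
the image point.\<close>

lemma smooth_map_compose:
  assumes A: "atlas A" and B: "atlas B" and D: "atlas D"
    and F: "smooth_map A S B F" and G: "smooth_map B T D G"
    and S: "open S" and T: "open T" and FST: "F ` S \<subseteq> T"
  shows "smooth_map A S D (G \<circ> F)"
  unfolding smooth_map_def
proof (intro conjI ballI)
  show "continuous_on S (G \<circ> F)"
    using continuous_on_compose[OF smooth_map_cont[OF F] continuous_on_subset[OF smooth_map_cont[OF G] FST]] .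
  fix c e assume c: "c \<in> A" and e: "e \<in> D"
  have cc: "is_chart c" using A c by (rule atlasD)
  obtain E :: "'d set" where E: "onb E" using atlasD(1)[OF B] by blast
  show "Cinf_on (snd c ` (fst c \<inter> S \<inter> (G \<circ> F) -` fst e)) (snd e \<circ> (G \<circ> F) \<circ> cinv c)"
  proof (rule Cinf_on_local)
    fix x assume "x \<in> snd c ` (fst c \<inter> S \<inter> (G \<circ> F) -` fst e)"
    then obtain p where p: "x = snd c p" "p \<in> fst c" "p \<in> S" "G (F p) \<in> fst e" by auto
    obtain d where d: "d \<in> B" "F p \<in> fst d" using atlasD(3)[OF B] by blast
    have dc: "is_chart d" and ec: "is_chart e" using B D d e atlasD(2) by blast+
    have oV: "open (fst d \<inter> (T \<inter> G -` fst e))"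
      using is_chartD(1)[OF dc] is_chartD(1)[OF ec] smooth_map_open_vimage[OF G T] by blast
    define V where "V = S \<inter> F -` (fst d \<inter> (T \<inter> G -` fst e))"
    have V: "open V" unfolding V_def by (rule smooth_map_open_vimage[OF F S oV])
    let ?W = "snd c ` (fst c \<inter> V)"
    have W: "open ?W" by (rule chart_image_open[OF cc V])
    have f: "Cinf_on ?W (snd d \<circ> F \<circ> cinv c)"
    proof (rule Cinf_on_mono)
      show "Cinf_on (snd c ` (fst c \<inter> S \<inter> F -` fst d)) (snd d \<circ> F \<circ> cinv c)"
        using F c d by (simp add: smooth_map_def)
    qed (auto simp: V_def)
    have g: "Cinf_on (snd d ` (fst d \<inter> T \<inter> G -` fst e)) (snd e \<circ> G \<circ> cinv d)"
      using G d e by (simp add: smooth_map_def)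
    have fW: "(snd d \<circ> F \<circ> cinv c) ` ?W \<subseteq> snd d ` (fst d \<inter> T \<inter> G -` fst e)"
      using is_chartD(6)[OF cc] by (auto simp: V_def)
    have "Cinf_on ?W (\<lambda>x. (snd e \<circ> G \<circ> cinv d) ((snd d \<circ> F \<circ> cinv c) x))"
      by (rule Cinf_on_compose[OF E W fW f g])
    moreover have "\<forall>y\<in>?W. (snd e \<circ> (G \<circ> F) \<circ> cinv c) y = (snd e \<circ> G \<circ> cinv d) ((snd d \<circ> F \<circ> cinv c) y)"
      using is_chartD(6)[OF cc] is_chartD(6)[OF dc] by (auto simp: V_def)
    moreover have "x \<in> ?W" using p d FST by (auto simp: V_def)
    ultimately show "\<exists>U g. open U \<and> x \<in> U \<and> Cinf_on U g \<and> (\<forall>y\<in>U. (snd e \<circ> (G \<circ> F) \<circ> cinv c) y = g y)"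
      using W by (intro exI[of _ ?W] exI[of _ "\<lambda>x. (snd e \<circ> G \<circ> cinv d) ((snd d \<circ> F \<circ> cinv c) x)"]) simp
  qed
qed

text \<open>Smoothness at a point composes without any bookkeeping of domains; smoothness on an open set is
recovered by \<open>smooth_map_of_smooth_at\<close> below.\<close>

definition smooth_at ::
  "('m::topological_space, 'e::real_normed_vector) chart set \<Rightarrow>
   ('n::topological_space, 'f::real_normed_vector) chart set \<Rightarrow> ('m \<Rightarrow> 'n) \<Rightarrow> 'm \<Rightarrow> bool" where
  "smooth_at A B F p \<longleftrightarrow> (\<exists>U. open U \<and> p \<in> U \<and> smooth_map A U B F)"

lemma smooth_near_iff: "smooth_near A p h \<longleftrightarrow> smooth_at A std_atlas h p"
  by (simp add: smooth_near_def smooth_at_def smooth_fun_on_def)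

lemma smooth_atI: "smooth_map A U B F \<Longrightarrow> open U \<Longrightarrow> p \<in> U \<Longrightarrow> smooth_at A B F p"
  by (auto simp: smooth_at_def)

lemma smooth_atE:
  assumes "smooth_at A B F p" obtains U where "open U" "p \<in> U" "smooth_map A U B F"
  using assms by (auto simp: smooth_at_def)

lemma smooth_at_nearby: "smooth_at A B F p \<Longrightarrow> \<exists>U. open U \<and> p \<in> U \<and> (\<forall>q\<in>U. smooth_at A B F q)"
  by (auto simp: smooth_at_def)

lemma smooth_map_UNIV_at: "smooth_map A UNIV B F \<Longrightarrow> smooth_at A B F p"
  by (rule smooth_atI[where U = UNIV]) simp_all

lemma smooth_at_isCont: "smooth_at A B F p \<Longrightarrow> isCont F p"
  by (metis smooth_atE smooth_map_cont continuous_on_eq_continuous_at)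

lemma smooth_at_compose:
  assumes A: "atlas A" and B: "atlas B" and D: "atlas D"
    and F: "smooth_at A B F p" and G: "smooth_at B D G (F p)"
  shows "smooth_at A D (\<lambda>x. G (F x)) p"
proof -
  obtain U where U: "open U" "p \<in> U" "smooth_map A U B F" using F by (rule smooth_atE)
  obtain V where V: "open V" "F p \<in> V" "smooth_map B V D G" using G by (rule smooth_atE)
  have o: "open (U \<inter> F -` V)" by (rule smooth_map_open_vimage[OF U(3,1) V(1)])
  have "smooth_map A (U \<inter> F -` V) D (G \<circ> F)"
    by (rule smooth_map_compose[OF A B D smooth_map_subset[OF U(3)] V(3) o V(1)]) auto
  then show ?thesis using o U V by (auto simp: o_def intro: smooth_atI)
qed

lemma smooth_map_of_smooth_at:
  assumes A: "atlas A" and B: "atlas B" and S: "open S" and F: "\<And>p. p \<in> S \<Longrightarrow> smooth_at A B F p"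
  shows "smooth_map A S B F"
  unfolding smooth_map_def
proof (intro conjI ballI)
  have "S = \<Union>{U. open U \<and> U \<subseteq> S \<and> continuous_on U F}"
  proof
    show "S \<subseteq> \<Union>{U. open U \<and> U \<subseteq> S \<and> continuous_on U F}"
    proof
      fix p assume p: "p \<in> S"
      then obtain U where "open U" "p \<in> U" "continuous_on U F" using F smooth_map_cont by (metis smooth_atE)
      then show "p \<in> \<Union>{U. open U \<and> U \<subseteq> S \<and> continuous_on U F}"
        using p S continuous_on_subset[of U F "U \<inter> S"] by (intro UnionI[of "U \<inter> S"]) auto
    qed
  qed blast
  moreover have "continuous_on (\<Union>{U. open U \<and> U \<subseteq> S \<and> continuous_on U F}) F"
    by (rule continuous_on_open_Union) auto
  ultimately show "continuous_on S F" by metis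
  fix c d assume c: "c \<in> A" and d: "d \<in> B"
  have cc: "is_chart c" and dc: "is_chart d" using A B c d atlasD(2) by blast+
  show "Cinf_on (snd c ` (fst c \<inter> S \<inter> F -` fst d)) (snd d \<circ> F \<circ> cinv c)"
  proof (rule Cinf_on_local)
    fix x assume "x \<in> snd c ` (fst c \<inter> S \<inter> F -` fst d)"
    then obtain p where p: "x = snd c p" "p \<in> fst c" "p \<in> S" "F p \<in> fst d" by auto
    obtain U where U: "open U" "p \<in> U" "smooth_map A U B F" using F[OF p(3)] by (rule smooth_atE)
    have o: "open (snd c ` (fst c \<inter> (U \<inter> F -` fst d)))"
      by (rule chart_image_open[OF cc smooth_map_open_vimage[OF U(3,1) is_chartD(1)[OF dc]]])
    moreover have "Cinf_on (snd c ` (fst c \<inter> (U \<inter> F -` fst d))) (snd d \<circ> F \<circ> cinv c)"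
      using U(3) c d by (simp add: smooth_map_def Int_assoc)
    ultimately show "\<exists>U g. open U \<and> x \<in> U \<and> Cinf_on U g \<and> (\<forall>y\<in>U. (snd d \<circ> F \<circ> cinv c) y = g y)"
      using p U by (intro exI[of _ "snd c ` (fst c \<inter> (U \<inter> F -` fst d))"] exI[of _ "snd d \<circ> F \<circ> cinv c"]) auto
  qed
qed

lemma smooth_at_cong:
  assumes A: "atlas A" and "smooth_at A B F p" and U: "open U" "p \<in> U" and eq: "\<And>q. q \<in> U \<Longrightarrow> F q = G q"
    and B: "atlas B"
  shows "smooth_at A B G p"
proof -
  obtain V where V: "open V" "p \<in> V" "smooth_map A V B F" using assms(2) by (rule smooth_atE)
  let ?W = "V \<inter> U"
  have W: "open ?W" "p \<in> ?W" using U V by auto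
  have F: "smooth_map A ?W B F" using V(3) by (rule smooth_map_subset) simp
  have "smooth_map A ?W B G"
    unfolding smooth_map_def
  proof (intro conjI ballI)
    show "continuous_on ?W G" using smooth_map_cont[OF F] by (rule continuous_on_eq) (simp add: eq)
    fix c d assume c: "c \<in> A" and d: "d \<in> B"
    have cc: "is_chart c" and dc: "is_chart d" using A B c d atlasD(2) by blast+
    have s: "fst c \<inter> ?W \<inter> F -` fst d = fst c \<inter> ?W \<inter> G -` fst d" using eq by auto
    have "Cinf_on (snd c ` (fst c \<inter> ?W \<inter> G -` fst d)) (snd d \<circ> F \<circ> cinv c)"
      using F c d unfolding s[symmetric] by (simp add: smooth_map_def)
    moreover have "open (snd c ` (fst c \<inter> ?W \<inter> G -` fst d))"
      using chart_image_open[OF cc smooth_map_open_vimage[OF F W(1) is_chartD(1)[OF dc]]] s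
      by (simp add: Int_assoc)
    moreover have "(snd d \<circ> G \<circ> cinv c) y = (snd d \<circ> F \<circ> cinv c) y"
      if "y \<in> snd c ` (fst c \<inter> ?W \<inter> G -` fst d)" for y
      using that is_chartD(6)[OF cc] eq by auto
    ultimately show "Cinf_on (snd c ` (fst c \<inter> ?W \<inter> G -` fst d)) (snd d \<circ> G \<circ> cinv c)"
      unfolding Cinf_on_def using Ck_on_cong by blast
  qed
  then show ?thesis using W by (rule smooth_atI)
qed

lemma smooth_at_const:
  shows "smooth_at A B (\<lambda>x. q) p"
proof (rule smooth_atI)
  show "smooth_map A UNIV B (\<lambda>x. q)"
    by (simp add: smooth_map_def continuous_on_const o_def Cinf_on_def Ck_on_const)
qed auto

lemma smooth_at_ident: assumes "atlas A" shows "smooth_at A A (\<lambda>x. x) p"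
proof (rule smooth_atI)
  show "smooth_map A UNIV A (\<lambda>x. x)"
    using assms by (simp add: smooth_map_def atlas_def o_def continuous_on_id vimage_def)
qed auto

lemma inv_into_UNIV_ident: "inv_into UNIV (\<lambda>x. x) = (\<lambda>x. x)"
  by (auto simp: fun_eq_iff intro!: inv_into_f_eq)

lemma atlas_std: assumes "onb (D :: 'e::real_inner set)" shows "atlas (std_atlas :: ('e, 'e) chart set)"
proof -
  have "is_chart (UNIV :: 'e set, \<lambda>x::'e. x)" by (rule is_chartI[of _ _ "\<lambda>x. x"]) (auto simp: continuous_on_id)
  then show ?thesis
    using assms by (auto simp: atlas_def std_atlas_def inv_into_UNIV_ident o_def Cinf_on_def Ck_on_id)
qed

lemma onb_real: "onb {1::real}"
  by (simp add: onb_def)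

lemma atlas_real [simp]: "atlas (std_atlas :: (real, real) chart set)"
  using atlas_std onb_real by blast

lemma atlas_std_of: "atlas (A :: ('m::topological_space, 'e::real_inner) chart set) \<Longrightarrow> atlas (std_atlas :: ('e, 'e) chart set)"
  using atlasD(1) atlas_std by blast

lemma smooth_at_compose_real:
  assumes "atlas Q" "atlas A" "smooth_at A std_atlas h q" "smooth_at Q A F p" "F p = q"
  shows "smooth_at Q (std_atlas :: (real, real) chart set) (\<lambda>x. h (F x)) p"
  using smooth_at_compose[OF assms(1,2) atlas_real assms(4)] assms(3,5) by simp

lemma smooth_at_std_iff:
  "smooth_at std_atlas std_atlas f x \<longleftrightarrow> (\<exists>U. open U \<and> x \<in> U \<and> Cinf_on U f)"
proof -
  have "smooth_map std_atlas U std_atlas f \<longleftrightarrow> Cinf_on U f" for U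
    by (auto simp: smooth_map_def std_atlas_def inv_into_UNIV_ident o_def Cinf_on_continuous)
  then show ?thesis by (simp add: smooth_at_def)
qed

lemma smooth_at_std: "Cinf_on U f \<Longrightarrow> open U \<Longrightarrow> x \<in> U \<Longrightarrow> smooth_at std_atlas std_atlas f x"
  using smooth_at_std_iff by blast

lemma smooth_at_linear: "bounded_linear f \<Longrightarrow> smooth_at std_atlas std_atlas f x"
  by (rule smooth_at_std[of UNIV]) (auto intro: Cinf_on_linear)

lemma smooth_at_chart:
  assumes A: "atlas A" and c: "c \<in> A" "p \<in> fst c"
  shows "smooth_at A std_atlas (snd c) p"
proof (rule smooth_atI)
  show "smooth_map A (fst c) std_atlas (snd c)"
    unfolding smooth_map_def
  proof (intro conjI ballI)
    show "continuous_on (fst c) (snd c)" using A c is_chartD(3) atlasD(2) by blast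
    fix c' d assume c': "c' \<in> A" and d: "d \<in> (std_atlas :: ('b, 'b) chart set)"
    have "Cinf_on (snd c' ` (fst c' \<inter> fst c)) (snd c \<circ> cinv c')" using A c' c(1) by (rule atlasD(4))
    then show "Cinf_on (snd c' ` (fst c' \<inter> fst c \<inter> snd c -` fst d)) (snd d \<circ> snd c \<circ> cinv c')"
      using d by (simp add: std_atlas_def o_def)
  qed
  show "open (fst c)" using A c is_chartD(1) atlasD(2) by blast
qed (rule c)

text \<open>Together with \<open>smooth_at_chart\<close> this expresses the compatibility of the charts: inside compositions
a chart and its inverse may be used like any other smooth map.\<close>

lemma smooth_at_cinv:
  assumes A: "atlas A" and c: "c \<in> A" "u \<in> snd c ` fst c"
  shows "smooth_at std_atlas A (cinv c) u"
proof (rule smooth_atI)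
  have cc: "is_chart c" using A c atlasD(2) by blast
  show "smooth_map std_atlas (snd c ` fst c) A (cinv c)"
    unfolding smooth_map_def
  proof (intro conjI ballI)
    show "continuous_on (snd c ` fst c) (cinv c)" using cc is_chartD(4) by blast
    fix c' d assume c': "c' \<in> (std_atlas :: ('b, 'b) chart set)" and d: "d \<in> A"
    have "Cinf_on (snd c ` (fst c \<inter> fst d)) (snd d \<circ> cinv c)" using A c(1) d by (rule atlasD(4))
    moreover have "snd c ` fst c \<inter> cinv c -` fst d = snd c ` (fst c \<inter> fst d)"
      using is_chartD(6)[OF cc] by force
    ultimately show "Cinf_on (snd c' ` (fst c' \<inter> snd c ` fst c \<inter> cinv c -` fst d)) (snd d \<circ> cinv c \<circ> cinv c')"
      using c' by (simp add: std_atlas_def o_def inv_into_UNIV_ident)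
  qed
  show "open (snd c ` fst c)" using cc is_chartD(2) by blast
qed (rule c)

lemma smooth_at_Pair_std:
  assumes A: "atlas A" and F: "smooth_at A std_atlas F p" and G: "smooth_at A std_atlas G p"
  shows "smooth_at A std_atlas (\<lambda>x. (F x, G x)) p"
proof -
  obtain U where U: "open U" "p \<in> U" "smooth_map A U std_atlas F" using F by (rule smooth_atE)
  obtain V where V: "open V" "p \<in> V" "smooth_map A V std_atlas G" using G by (rule smooth_atE)
  have "smooth_map A (U \<inter> V) std_atlas (\<lambda>x. (F x, G x))"
    unfolding smooth_map_def
  proof (intro conjI ballI)
    show "continuous_on (U \<inter> V) (\<lambda>x. (F x, G x))"
      using continuous_on_subset[OF smooth_map_cont[OF U(3)], of "U \<inter> V"]
        continuous_on_subset[OF smooth_map_cont[OF V(3)], of "U \<inter> V"]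
      by (intro continuous_on_Pair) auto
    fix c d assume c: "c \<in> A" and d: "d \<in> (std_atlas :: ('c \<times> 'd, 'c \<times> 'd) chart set)"
    have cc: "is_chart c" using A c atlasD(2) by blast
    have "Cinf_on (snd c ` (fst c \<inter> U)) (F \<circ> cinv c)" "Cinf_on (snd c ` (fst c \<inter> V)) (G \<circ> cinv c)"
      using U(3) V(3) c by (auto simp: smooth_map_def std_atlas_def o_def)
    then have "Cinf_on (snd c ` (fst c \<inter> (U \<inter> V))) (F \<circ> cinv c)"
      "Cinf_on (snd c ` (fst c \<inter> (U \<inter> V))) (G \<circ> cinv c)"
      by (auto elim!: Cinf_on_mono simp del: comp_apply)
    then have "Cinf_on (snd c ` (fst c \<inter> (U \<inter> V))) (\<lambda>x. ((F \<circ> cinv c) x, (G \<circ> cinv c) x))"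
      using chart_image_open[OF cc open_Int[OF U(1) V(1)]] by (intro Cinf_on_Pair)
    then show "Cinf_on (snd c ` (fst c \<inter> (U \<inter> V) \<inter> (\<lambda>x. (F x, G x)) -` fst d))
        (snd d \<circ> (\<lambda>x. (F x, G x)) \<circ> cinv c)"
      using d by (simp add: std_atlas_def o_def)
  qed
  then show ?thesis using U V by (auto intro: smooth_atI)
qed

lemma ex_onb_Times:
  assumes D: "onb (D :: 'a::real_inner set)" and E: "onb (E :: 'b::real_inner set)"
  shows "\<exists>H :: ('a \<times> 'b) set. onb H"
proof (rule ex_onb)
  let ?H = "(\<lambda>d. (d, 0)) ` D \<union> (\<lambda>e. (0, e)) ` E"
  show "finite ?H" using onbD(1)[OF D] onbD(1)[OF E] by simp
  have "z \<in> span ?H" for z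
  proof -
    have "(\<Sum>d\<in>D. (fst z \<bullet> d) *\<^sub>R (d, 0)) + (\<Sum>e\<in>E. (snd z \<bullet> e) *\<^sub>R (0, e)) \<in> span ?H"
      by (intro span_add span_sum span_scale) (auto intro: span_base)
    also have "(\<Sum>d\<in>D. (fst z \<bullet> d) *\<^sub>R (d, 0)) + (\<Sum>e\<in>E. (snd z \<bullet> e) *\<^sub>R (0, e)) = z"
      by (rule prod_eqI) (simp_all add: fst_sum snd_sum onbD(2)[OF D] onbD(2)[OF E])
    finally show ?thesis .
  qed
  then show "span ?H = UNIV" by blast
qed

lemma prod_chart:
  assumes "is_chart c" "is_chart d"
  shows "is_chart (fst c \<times> fst d, map_prod (snd c) (snd d))"
    and "u \<in> snd c ` fst c \<Longrightarrow> v \<in> snd d ` fst d \<Longrightarrow>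
      inv_into (fst c \<times> fst d) (map_prod (snd c) (snd d)) (u, v) = (cinv c u, cinv d v)"
proof -
  have im: "map_prod (snd c) (snd d) ` (fst c \<times> fst d) = (snd c ` fst c) \<times> (snd d ` fst d)" by auto
  show "is_chart (fst c \<times> fst d, map_prod (snd c) (snd d))"
  proof (rule is_chartI[of _ _ "\<lambda>w. (cinv c (fst w), cinv d (snd w))"])
    show "open (fst c \<times> fst d)" using assms by (intro open_Times is_chartD)
    show "open (map_prod (snd c) (snd d) ` (fst c \<times> fst d))"
      unfolding im using assms by (intro open_Times is_chartD)
    show "continuous_on (fst c \<times> fst d) (map_prod (snd c) (snd d))"
      unfolding map_prod_def case_prod_beta
      by (intro continuous_on_Pair continuous_on_compose2[OF is_chartD(3)[OF assms(1)] continuous_on_fst[OF continuous_on_id]]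
          continuous_on_compose2[OF is_chartD(3)[OF assms(2)] continuous_on_snd[OF continuous_on_id]]) auto
    show "continuous_on (map_prod (snd c) (snd d) ` (fst c \<times> fst d)) (\<lambda>w. (cinv c (fst w), cinv d (snd w)))"
      unfolding im
      by (intro continuous_on_Pair continuous_on_compose2[OF is_chartD(4)[OF assms(1)] continuous_on_fst[OF continuous_on_id]]
          continuous_on_compose2[OF is_chartD(4)[OF assms(2)] continuous_on_snd[OF continuous_on_id]]) auto
    show "(cinv c (fst (map_prod (snd c) (snd d) p)), cinv d (snd (map_prod (snd c) (snd d) p))) = p"
      if "p \<in> fst c \<times> fst d" for p
      using that is_chartD(6)[OF assms(1)] is_chartD(6)[OF assms(2)] by auto
  qed
  from is_chartD(5)[OF this] have inj: "inj_on (map_prod (snd c) (snd d)) (fst c \<times> fst d)" by simp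
  show "inv_into (fst c \<times> fst d) (map_prod (snd c) (snd d)) (u, v) = (cinv c u, cinv d v)"
    if "u \<in> snd c ` fst c" "v \<in> snd d ` fst d"
  proof (rule inv_into_f_eq[OF inj])
    show "(cinv c u, cinv d v) \<in> fst c \<times> fst d"
      using that is_chartD(8)[OF assms(1)] is_chartD(8)[OF assms(2)] by simp
    show "map_prod (snd c) (snd d) (cinv c u, cinv d v) = (u, v)"
      using that is_chartD(7)[OF assms(1)] is_chartD(7)[OF assms(2)] by simp
  qed
qed

lemma prod_atlasI: "c \<in> A \<Longrightarrow> d \<in> B \<Longrightarrow> (fst c \<times> fst d, map_prod (snd c) (snd d)) \<in> prod_atlas A B"
  unfolding prod_atlas_def by blast

lemma prod_atlasE:
  assumes "e \<in> prod_atlas A B"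
  obtains c d where "c \<in> A" "d \<in> B" "e = (fst c \<times> fst d, map_prod (snd c) (snd d))"
  using assms unfolding prod_atlas_def by blast

lemma atlas_prod:
  assumes A: "atlas A" and B: "atlas B" shows "atlas (prod_atlas A B)"
  unfolding atlas_def
proof (intro conjI ballI)
  obtain D E where DE: "onb (D::'b set)" "onb (E::'d set)" using atlasD(1) A B by metis
  then show "\<exists>D::('b \<times> 'd) set. onb D" by (rule ex_onb_Times)
  show "is_chart c" if "c \<in> prod_atlas A B" for c
    using that
  proof (rule prod_atlasE)
    fix c1 c2 assume "c1 \<in> A" "c2 \<in> B" "c = (fst c1 \<times> fst c2, map_prod (snd c1) (snd c2))"
    then show "is_chart c" using prod_chart(1)[OF atlasD(2)[OF A] atlasD(2)[OF B]] by simp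
  qed
  show "(\<Union>c\<in>prod_atlas A B. fst c) = UNIV"
  proof -
    have "\<exists>c\<in>prod_atlas A B. (p, q) \<in> fst c" for p q
    proof -
      obtain c d where "c \<in> A" "p \<in> fst c" "d \<in> B" "q \<in> fst d" using atlasD(3) A B by metis
      then show ?thesis by (intro bexI[OF _ prod_atlasI[of c A d B]]) simp_all
    qed
    then show ?thesis by auto
  qed
  fix c d assume "c \<in> prod_atlas A B" "d \<in> prod_atlas A B"
  then obtain c1 c2 d1 d2 where cd: "c = (fst c1 \<times> fst c2, map_prod (snd c1) (snd c2))" "c1 \<in> A" "c2 \<in> B"
    "d = (fst d1 \<times> fst d2, map_prod (snd d1) (snd d2))" "d1 \<in> A" "d2 \<in> B"
    by (metis prod_atlasE)
  have ch: "is_chart c1" "is_chart d1" "is_chart c2" "is_chart d2" using cd atlasD(2) A B by blast+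
  let ?S1 = "snd c1 ` (fst c1 \<inter> fst d1)" and ?S2 = "snd c2 ` (fst c2 \<inter> fst d2)"
  have im: "snd c ` (fst c \<inter> fst d) = ?S1 \<times> ?S2" using cd by auto
  have o: "open (?S1 \<times> ?S2)"
    using ch by (intro open_Times chart_image_open is_chartD)
  have t: "Cinf_on ?S1 (snd d1 \<circ> cinv c1)" "Cinf_on ?S2 (snd d2 \<circ> cinv c2)"
    using cd atlasD(4) A B by blast+
  have "Cinf_on (?S1 \<times> ?S2) (\<lambda>w. (snd d1 \<circ> cinv c1) (fst w))"
    by (rule Cinf_on_compose[OF DE(1) o _ Cinf_on_linear[OF bounded_linear_fst o] t(1)]) auto
  moreover have "Cinf_on (?S1 \<times> ?S2) (\<lambda>w. (snd d2 \<circ> cinv c2) (snd w))"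
    by (rule Cinf_on_compose[OF DE(2) o _ Cinf_on_linear[OF bounded_linear_snd o] t(2)]) auto
  ultimately have P: "Cinf_on (?S1 \<times> ?S2) (\<lambda>w. ((snd d1 \<circ> cinv c1) (fst w), (snd d2 \<circ> cinv c2) (snd w)))"
    by (rule Cinf_on_Pair[OF o])
  have "(snd d \<circ> cinv c) w = ((snd d1 \<circ> cinv c1) (fst w), (snd d2 \<circ> cinv c2) (snd w))"
    if w: "w \<in> ?S1 \<times> ?S2" for w
  proof -
    obtain u v where uv: "w = (u, v)" "u \<in> snd c1 ` fst c1" "v \<in> snd c2 ` fst c2" using w by auto
    show ?thesis using prod_chart(2)[OF ch(1,3) uv(2,3)] by (simp add: cd uv(1))
  qed
  then show "Cinf_on (snd c ` (fst c \<inter> fst d)) (snd d \<circ> cinv c)"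
    unfolding im using P o Ck_on_cong unfolding Cinf_on_def by blast
qed

lemma prod_atlas_std: "prod_atlas std_atlas std_atlas = std_atlas"
  by (auto simp: prod_atlas_def std_atlas_def map_prod_def)

lemma
  assumes A: "atlas A" and B: "atlas B"
  shows smooth_at_fst: "smooth_at (prod_atlas A B) A fst p" and smooth_at_snd: "smooth_at (prod_atlas A B) B snd p"
proof -
  obtain c d where c: "c \<in> A" "fst p \<in> fst c" and d: "d \<in> B" "snd p \<in> fst d" using atlasD(3) A B by metis
  let ?e = "(fst c \<times> fst d, map_prod (snd c) (snd d))"
  note P = atlas_prod[OF A B]
  have e: "?e \<in> prod_atlas A B" "p \<in> fst ?e" using c d prod_atlasI[of c A d B] by (simp_all add: mem_Times_iff)
  have cc: "is_chart c" and dc: "is_chart d" using A B c d atlasD(2) by blast+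
  have ec: "is_chart ?e" using atlasD(2)[OF P e(1)] .
  note proj = smooth_at_compose[OF P atlas_std_of[OF P] _ smooth_at_chart[OF P e] smooth_at_linear]
  have "smooth_at (prod_atlas A B) A (\<lambda>q. cinv c (fst (snd ?e q))) p"
    by (rule smooth_at_compose[OF P atlas_std_of[OF A] A proj[OF atlas_std_of[OF A] bounded_linear_fst] smooth_at_cinv[OF A c(1)]])
      (use c in \<open>auto simp: map_prod_def case_prod_beta\<close>)
  then show "smooth_at (prod_atlas A B) A fst p"
    by (rule smooth_at_cong[OF P _ is_chartD(1)[OF ec] e(2) _ A]) (auto simp: is_chartD(6)[OF cc])
  have "smooth_at (prod_atlas A B) B (\<lambda>q. cinv d (snd (snd ?e q))) p"
    by (rule smooth_at_compose[OF P atlas_std_of[OF B] B proj[OF atlas_std_of[OF B] bounded_linear_snd] smooth_at_cinv[OF B d(1)]])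
      (use d in \<open>auto simp: map_prod_def case_prod_beta\<close>)
  then show "smooth_at (prod_atlas A B) B snd p"
    by (rule smooth_at_cong[OF P _ is_chartD(1)[OF ec] e(2) _ B]) (auto simp: is_chartD(6)[OF dc])
qed

lemma smooth_at_Pair:
  assumes A: "atlas A" and B: "atlas B" and Q: "atlas Q"
    and F: "smooth_at Q A F p" and G: "smooth_at Q B G p"
  shows "smooth_at Q (prod_atlas A B) (\<lambda>x. (F x, G x)) p"
proof -
  obtain c d where c: "c \<in> A" "F p \<in> fst c" and d: "d \<in> B" "G p \<in> fst d" using atlasD(3) A B by metis
  let ?e = "(fst c \<times> fst d, map_prod (snd c) (snd d))"
  note P = atlas_prod[OF A B]
  have e: "?e \<in> prod_atlas A B" using c d prod_atlasI[of c A d B] by simp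
  have cc: "is_chart c" "is_chart d" using A B c d atlasD(2) by blast+
  obtain U where U: "open U" "p \<in> U" "smooth_map Q U A F" using F by (rule smooth_atE)
  obtain V where V: "open V" "p \<in> V" "smooth_map Q V B G" using G by (rule smooth_atE)
  let ?W = "(U \<inter> F -` fst c) \<inter> (V \<inter> G -` fst d)"
  have W: "open ?W" "p \<in> ?W"
    using smooth_map_open_vimage[OF U(3,1) is_chartD(1)[OF cc(1)]]
      smooth_map_open_vimage[OF V(3,1) is_chartD(1)[OF cc(2)]] U V c d by auto
  have 1: "smooth_at Q std_atlas (\<lambda>x. (snd c (F x), snd d (G x))) p"
    by (rule smooth_at_Pair_std[OF Q smooth_at_compose[OF Q A atlas_std_of[OF A] F smooth_at_chart[OF A c]]
          smooth_at_compose[OF Q B atlas_std_of[OF B] G smooth_at_chart[OF B d]]])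
  have "smooth_at Q (prod_atlas A B) (\<lambda>x. cinv ?e (snd c (F x), snd d (G x))) p"
    by (rule smooth_at_compose[OF Q atlas_std_of[OF P] P 1 smooth_at_cinv[OF P e]]) (use c d in auto)
  then show ?thesis
  proof (rule smooth_at_cong[OF Q _ W _ P])
    fix q assume q: "q \<in> ?W"
    then show "cinv ?e (snd c (F q), snd d (G q)) = (F q, G q)"
      using prod_chart(2)[OF cc, of "snd c (F q)" "snd d (G q)"] is_chartD(6)[OF cc(1)] is_chartD(6)[OF cc(2)]
      by auto
  qed
qed

lemma smooth_at_add:
  assumes A: "atlas A" and "smooth_at A std_atlas f p" "smooth_at A std_atlas (g :: _ \<Rightarrow> real) p"
  shows "smooth_at A std_atlas (\<lambda>x. f x + g x) p"
proof -
  have 1: "bounded_linear (\<lambda>w::real\<times>real. fst w + snd w)"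
    by (intro bounded_linear_add bounded_linear_fst bounded_linear_snd)
  have R: "atlas (std_atlas :: (real\<times>real, real\<times>real) chart set)"
    using atlas_prod[OF atlas_real atlas_real] by (simp add: prod_atlas_std)
  show ?thesis
    using smooth_at_compose[OF A R atlas_real smooth_at_Pair_std[OF assms] smooth_at_linear[OF 1]] by simp
qed

lemma smooth_at_linear_comp:
  assumes A: "atlas A" and "smooth_at A std_atlas (f :: _ \<Rightarrow> 'e::real_inner) p" and "bounded_linear L"
    and "onb (D::'e set)" and "onb (E::'f::real_inner set)"
  shows "smooth_at A std_atlas (\<lambda>x. L (f x) :: 'f) p"
  using smooth_at_compose[OF A atlas_std[OF assms(4)] atlas_std[OF assms(5)] assms(2) smooth_at_linear[OF assms(3)]] .

lemma smooth_at_cmult: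
  assumes A: "atlas A" and "smooth_at A std_atlas f p"
  shows "smooth_at A std_atlas (\<lambda>x. a * f x :: real) p"
  using smooth_at_linear_comp[OF A assms(2) bounded_linear_mult_right onb_real onb_real] .

lemma smooth_at_sum:
  assumes A: "atlas A" and "\<And>i. i \<in> I \<Longrightarrow> smooth_at A std_atlas (f i :: _ \<Rightarrow> real) p"
  shows "smooth_at A std_atlas (\<lambda>x. \<Sum>i\<in>I. f i x) p"
  using assms(2) by (induction I rule: infinite_finite_induct) (simp_all add: smooth_at_const smooth_at_add[OF A])

lemma smooth_at_frame_sum:
  fixes w :: "'i \<Rightarrow> 'f::real_inner"
  assumes A: "atlas A" and E: "onb (E :: 'f set)" and f: "\<And>i. i \<in> I \<Longrightarrow> smooth_at A std_atlas (f i) p"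
  shows "smooth_at A std_atlas (\<lambda>x. \<Sum>i\<in>I. f i x *\<^sub>R w i) p"
  using f
proof (induction I rule: infinite_finite_induct)
  case (insert i I)
  have 1: "smooth_at A std_atlas (\<lambda>x. f i x *\<^sub>R w i) p"
    by (rule smooth_at_linear_comp[OF A insert.prems[of i] bounded_linear_scaleR_left onb_real E]) simp
  have 2: "smooth_at A std_atlas (\<lambda>x. \<Sum>i\<in>I. f i x *\<^sub>R w i) p" using insert by simp
  have 3: "bounded_linear (\<lambda>z::'f\<times>'f. fst z + snd z)"
    by (intro bounded_linear_add bounded_linear_fst bounded_linear_snd)
  obtain H :: "('f \<times> 'f) set" where H: "onb H" using ex_onb_Times[OF E E] by blast
  show ?case
    using smooth_at_linear_comp[OF A smooth_at_Pair_std[OF A 1 2] 3 H E] insert by simp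
qed (simp_all add: smooth_at_const)

section \<open>Tangent vectors\<close>

text \<open>The tangent vector at \<open>p\<close> with coordinates \<open>u\<close> in the chart \<open>c\<close>. It vanishes on functions that are
not smooth near \<open>p\<close>, like the velocities of curves, so that tangent vectors can be compared by
equality.\<close>

definition tv ::
  "('m::topological_space, 'e::real_normed_vector) chart set \<Rightarrow> ('m, 'e) chart \<Rightarrow> 'm \<Rightarrow> 'e \<Rightarrow> 'm tvec" where
  "tv A c p u = (\<lambda>h. if smooth_near A p h then frechet_derivative (h \<circ> cinv c) (at (snd c p)) u else 0)"

text \<open>Differentiability of a curve tested on smooth functions only. Integral curves are given in this
form, without any smoothness in charts.\<close>

definition has_vel ::
  "('m::topological_space, 'e::real_normed_vector) chart set \<Rightarrow> (real \<Rightarrow> 'm) \<Rightarrow> real \<Rightarrow> 'm tvec \<Rightarrow> bool" where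
  "has_vel A \<gamma> t \<xi> \<longleftrightarrow> isCont \<gamma> t \<and> (\<forall>h. smooth_near A (\<gamma> t) h \<longrightarrow>
     ((\<lambda>s. h (\<gamma> s)) has_real_derivative \<xi> h) (at t))"

lemma has_velD:
  "has_vel A \<gamma> t \<xi> \<Longrightarrow> smooth_at A std_atlas h (\<gamma> t) \<Longrightarrow> ((\<lambda>s. h (\<gamma> s)) has_real_derivative \<xi> h) (at t)"
  by (simp add: has_vel_def smooth_near_iff)

lemma chart_expr_Cinf:
  assumes A: "atlas A" and c: "c \<in> A" "p \<in> fst c" and h: "smooth_at A (std_atlas :: (real, real) chart set) h p"
  shows "\<exists>U. open U \<and> snd c p \<in> U \<and> Cinf_on U (h \<circ> cinv c)"
proof -
  have cc: "is_chart c" using A c atlasD(2) by blast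
  have "smooth_at std_atlas std_atlas (\<lambda>u. h (cinv c u)) (snd c p)"
    by (rule smooth_at_compose[OF atlas_std_of[OF A] A atlas_real smooth_at_cinv[OF A c(1)]])
      (use c h is_chartD(6)[OF cc] in auto)
  then show ?thesis by (simp add: smooth_at_std_iff o_def)
qed

lemma chart_expr_derivative:
  assumes "atlas A" "c \<in> A" "p \<in> fst c" "smooth_at A (std_atlas :: (real, real) chart set) h p"
  shows "((h \<circ> cinv c) has_derivative (\<lambda>u. tv A c p u h)) (at (snd c p))"
proof -
  have "(h \<circ> cinv c) differentiable (at (snd c p))"
    using chart_expr_Cinf[OF assms] Cinf_on_differentiable by blast
  then show ?thesis using assms(4) by (simp add: tv_def smooth_near_iff frechet_derivative_works[symmetric])
qed

lemma isCont_open_preimage: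
  fixes \<gamma> :: "real \<Rightarrow> 'm::topological_space"
  assumes "isCont \<gamma> t" "open U" "\<gamma> t \<in> U"
  shows "\<exists>V. open V \<and> t \<in> V \<and> (\<forall>s\<in>V. \<gamma> s \<in> U)"
  using assms continuous_at_open[of t \<gamma>] by blast

lemma has_vel_tv:
  assumes A: "atlas A" and c: "c \<in> A" "\<gamma> t \<in> fst c" and cont: "isCont \<gamma> t"
    and d: "((\<lambda>s. snd c (\<gamma> s)) has_vector_derivative u) (at t)"
  shows "has_vel A \<gamma> t (tv A c (\<gamma> t) u)"
  unfolding has_vel_def
proof (intro conjI allI impI)
  fix h assume "smooth_near A (\<gamma> t) h"
  then have h: "smooth_at A std_atlas h (\<gamma> t)" by (simp add: smooth_near_iff)
  have cc: "is_chart c" using A c atlasD(2) by blast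
  obtain V where V: "open V" "t \<in> V" "\<forall>s\<in>V. \<gamma> s \<in> fst c"
    using isCont_open_preimage[OF cont is_chartD(1)[OF cc] c(2)] by blast
  have "((h \<circ> cinv c) has_derivative (\<lambda>u. tv A c (\<gamma> t) u h)) (at (snd c (\<gamma> t)) within range (\<lambda>s. snd c (\<gamma> s)))"
    using chart_expr_derivative[OF A c h] by (rule has_derivative_at_withinI)
  from vector_derivative_diff_chain_within[OF d this]
  have "((h \<circ> cinv c \<circ> (\<lambda>s. snd c (\<gamma> s))) has_vector_derivative tv A c (\<gamma> t) u h) (at t)" .
  then have "((\<lambda>s. h (\<gamma> s)) has_vector_derivative tv A c (\<gamma> t) u h) (at t)"
    by (rule has_vector_derivative_transform_within_open[OF _ V(1,2)]) (use V(3) is_chartD(6)[OF cc] in auto)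
  then show "((\<lambda>s. h (\<gamma> s)) has_real_derivative tv A c (\<gamma> t) u h) (at t)"
    by (simp add: has_real_derivative_iff_has_vector_derivative)
qed (rule cont)

lemma velocity_eq_tv:
  assumes "has_vel A \<gamma> t (tv A c (\<gamma> t) u)"
  shows "velocity A \<gamma> t = tv A c (\<gamma> t) u"
  using has_velD[OF assms] by (auto simp: velocity_def tv_def smooth_near_iff fun_eq_iff DERIV_imp_deriv)

lemma smooth_at_curve_has_vel:
  assumes A: "atlas A" and c: "c \<in> A" "\<gamma> t \<in> fst c" and \<gamma>: "smooth_at std_atlas A \<gamma> t"
  shows "\<exists>u. has_vel A \<gamma> t (tv A c (\<gamma> t) u) \<and> velocity A \<gamma> t = tv A c (\<gamma> t) u"
proof -
  have "smooth_at std_atlas std_atlas (\<lambda>s. snd c (\<gamma> s)) t"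
    by (rule smooth_at_compose[OF atlas_real A atlas_std_of[OF A] \<gamma> smooth_at_chart[OF A c]])
  then have "(\<lambda>s. snd c (\<gamma> s)) differentiable (at t)"
    using smooth_at_std_iff Cinf_on_differentiable by blast
  then have "((\<lambda>s. snd c (\<gamma> s)) has_vector_derivative vector_derivative (\<lambda>s. snd c (\<gamma> s)) (at t)) (at t)"
    by (simp add: vector_derivative_works[symmetric])
  from has_vel_tv[OF A c smooth_at_isCont[OF \<gamma>] this] show ?thesis using velocity_eq_tv by blast
qed

lemma tv_curve:
  assumes A: "atlas A" and c: "c \<in> A" "p \<in> fst c"
  shows "\<exists>\<gamma> \<epsilon>. \<gamma> 0 = p \<and> \<epsilon> > 0 \<and> smooth_map std_atlas {-\<epsilon><..<\<epsilon>} A \<gamma> \<and>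
    has_vel A \<gamma> 0 (tv A c p u) \<and> velocity A \<gamma> 0 = tv A c p u"
proof -
  have cc: "is_chart c" using A c atlasD(2) by blast
  define \<gamma> where "\<gamma> = (\<lambda>s. cinv c (snd c p + s *\<^sub>R u))"
  have g0: "\<gamma> 0 = p" using is_chartD(6)[OF cc c(2)] by (simp add: \<gamma>_def)
  have cont: "continuous_on UNIV (\<lambda>s. snd c p + s *\<^sub>R u)" by (intro continuous_intros)
  have "open ((\<lambda>s. snd c p + s *\<^sub>R u) -` (snd c ` fst c))"
    using continuous_open_vimage[of "snd c ` fst c" "\<lambda>s. snd c p + s *\<^sub>R u"] is_chartD(2)[OF cc] cont
    by (simp add: continuous_on_eq_continuous_at)
  moreover have "0 \<in> (\<lambda>s. snd c p + s *\<^sub>R u) -` (snd c ` fst c)" using c by simp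
  ultimately obtain \<epsilon> where e: "\<epsilon> > 0" "ball 0 \<epsilon> \<subseteq> (\<lambda>s. snd c p + s *\<^sub>R u) -` (snd c ` fst c)"
    using open_contains_ball by blast
  have iv: "{-\<epsilon><..<\<epsilon>} = ball 0 \<epsilon>" by (auto simp: dist_real_def)
  have sm: "smooth_at std_atlas A \<gamma> s" if "s \<in> {-\<epsilon><..<\<epsilon>}" for s
  proof -
    have C: "Cinf_on UNIV (\<lambda>s. snd c p + s *\<^sub>R u)"
      unfolding Cinf_on_def
      by (rule allI, rule Ck_on_add[OF open_UNIV Ck_on_const
            Ck_on_linear_comp[OF bounded_linear_scaleR_left open_UNIV Ck_on_id]])
    show ?thesis unfolding \<gamma>_def
      by (rule smooth_at_compose[OF atlas_real atlas_std_of[OF A] A smooth_at_std[OF C] smooth_at_cinv[OF A c(1)]])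
        (use that e iv in auto)
  qed
  have "smooth_map std_atlas {-\<epsilon><..<\<epsilon>} A \<gamma>"
    by (rule smooth_map_of_smooth_at[OF atlas_real A _ sm]) auto
  moreover have hv: "has_vel A \<gamma> 0 (tv A c (\<gamma> 0) u)"
  proof (rule has_vel_tv[OF A c(1)])
    show "\<gamma> 0 \<in> fst c" using g0 c by simp
    show "isCont \<gamma> 0" using smooth_at_isCont[OF sm] e by simp
    have "((\<lambda>s. snd c p + s *\<^sub>R u) has_vector_derivative u) (at 0)"
      by (auto intro!: derivative_eq_intros simp: has_vector_derivative_def)
    then show "((\<lambda>s. snd c (\<gamma> s)) has_vector_derivative u) (at 0)"
      by (rule has_vector_derivative_transform_within_open[of _ _ _ "ball 0 \<epsilon>"])
        (use e is_chartD(7)[OF cc] in \<open>auto simp: \<gamma>_def\<close>)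
  qed
  ultimately show ?thesis using g0 e(1) velocity_eq_tv[OF hv]
    by (intro exI[of _ \<gamma>] exI[of _ \<epsilon>]) simp
qed

lemma tangent_space_tv:
  assumes A: "atlas A" and c: "c \<in> A" "p \<in> fst c"
  shows "tangent_space A p = range (tv A c p)"
proof
  show "tangent_space A p \<subseteq> range (tv A c p)"
  proof
    fix v assume "v \<in> tangent_space A p"
    then obtain \<gamma> \<epsilon> where g: "v = velocity A \<gamma> 0" "\<gamma> 0 = p" "\<epsilon> > 0" "smooth_map std_atlas {-\<epsilon><..<\<epsilon>} A \<gamma>"
      by (auto simp: tangent_space_def)
    have "smooth_at std_atlas A \<gamma> 0" using g by (auto intro: smooth_atI)
    then show "v \<in> range (tv A c p)" using smooth_at_curve_has_vel[OF A c(1), of \<gamma> 0] g c by auto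
  qed
  show "range (tv A c p) \<subseteq> tangent_space A p"
  proof (rule image_subsetI)
    fix u
    show "tv A c p u \<in> tangent_space A p"
    proof -
      obtain \<gamma> \<epsilon> where "\<gamma> 0 = p" "\<epsilon> > 0" "smooth_map std_atlas {-\<epsilon><..<\<epsilon>} A \<gamma>" "velocity A \<gamma> 0 = tv A c p u"
        using tv_curve[OF A c, of u] by blast
      then show ?thesis unfolding tangent_space_def by (intro CollectI exI[of _ \<gamma>]) auto
    qed
  qed
qed

lemma tangent_curve:
  assumes A: "atlas A" and v: "v \<in> tangent_space A p"
  obtains \<gamma> \<epsilon> where "\<gamma> 0 = p" "\<epsilon> > 0" "smooth_map std_atlas {-\<epsilon><..<\<epsilon>} A \<gamma>" "has_vel A \<gamma> 0 v"
    "v = velocity A \<gamma> 0"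
proof -
  obtain c where c: "c \<in> A" "p \<in> fst c" using atlasD(3)[OF A] by blast
  then obtain u where "v = tv A c p u" using tangent_space_tv[OF A c] v by auto
  then show ?thesis using tv_curve[OF A c, of u] that by auto
qed

lemma velocity_tangent:
  assumes "\<gamma> 0 = p" "\<epsilon> > 0" "\<And>t. t \<in> {-\<epsilon><..<\<epsilon>} \<Longrightarrow> smooth_at std_atlas A \<gamma> t" and A: "atlas A"
  shows "velocity A \<gamma> 0 \<in> tangent_space A p"
proof -
  have "smooth_map std_atlas {-\<epsilon><..<\<epsilon>} A \<gamma>"
    by (rule smooth_map_of_smooth_at[OF atlas_real A _ assms(3)]) auto
  then show ?thesis using assms unfolding tangent_space_def by blast
qed

lemma linear_tv:
  assumes "atlas A" "c \<in> A" "p \<in> fst c" "smooth_at A (std_atlas :: (real, real) chart set) h p"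
  shows "linear (\<lambda>u. tv A c p u h)"
  by (rule has_derivative_linear[OF chart_expr_derivative[OF assms]])

lemma tv_linear:
  assumes A: "atlas A" and c: "c \<in> A" "p \<in> fst c"
  shows "tv A c p (a *\<^sub>R u + b *\<^sub>R w) = tscale a (tv A c p u) + tscale b (tv A c p w)"
proof
  fix h
  show "tv A c p (a *\<^sub>R u + b *\<^sub>R w) h = (tscale a (tv A c p u) + tscale b (tv A c p w)) h"
  proof (cases "smooth_near A p h")
    case True
    then have l: "linear (\<lambda>u. tv A c p u h)" by (intro linear_tv[OF A c]) (simp add: smooth_near_iff)
    show ?thesis using linear_add[OF l] linear_cmul[OF l] by (simp add: tscale_def)
  qed (simp add: tv_def tscale_def)
qed

lemma tangent_space_comb:
  assumes A: "atlas A" and "v \<in> tangent_space A p" "w \<in> tangent_space A p"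
  shows "tscale a v + tscale b w \<in> tangent_space A p"
proof -
  obtain c where c: "c \<in> A" "p \<in> fst c" using atlasD(3)[OF A] by blast
  obtain u1 u2 where "v = tv A c p u1" "w = tv A c p u2" using assms(2,3) unfolding tangent_space_tv[OF A c] by blast
  then show ?thesis unfolding tangent_space_tv[OF A c] using tv_linear[OF A c, of a u1 b u2] by (metis rangeI)
qed

lemma tscale_simps: "tscale 1 v = v" "tscale 0 v = 0" "tscale 1 v + tscale (-1) w = v - w"
  by (auto simp: tscale_def fun_eq_iff)

lemma tangent_space_scale:
  assumes "atlas A" "v \<in> tangent_space A p" shows "tscale a v \<in> tangent_space A p"
  using tangent_space_comb[OF assms(1,2,2), of a 0] by (simp add: tscale_simps)

lemma tangent_space_diff:
  assumes "atlas A" "v \<in> tangent_space A p" "w \<in> tangent_space A p" shows "v - w \<in> tangent_space A p"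
  using tangent_space_comb[OF assms, of 1 "-1"] by (simp only: tscale_simps(3))

lemma tangent_space_zero:
  assumes A: "atlas A" shows "0 \<in> tangent_space A p"
proof -
  obtain c where c: "c \<in> A" "p \<in> fst c" using atlasD(3)[OF A] by blast
  then have "tv A c p 0 \<in> tangent_space A p" unfolding tangent_space_tv[OF A c] by simp
  from tangent_space_scale[OF A this, of 0] show ?thesis by (simp add: tscale_simps)
qed

lemma tangent_not_smooth: "v \<in> tangent_space A p \<Longrightarrow> \<not> smooth_near A p h \<Longrightarrow> v h = 0"
  by (auto simp: tangent_space_def velocity_def)

lemma
  assumes A: "atlas A" and v: "v \<in> tangent_space A p"
  shows tangent_add: "smooth_at A std_atlas f p \<Longrightarrow> smooth_at A std_atlas g p \<Longrightarrow> v (\<lambda>q. f q + g q) = v f + v g"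
    and tangent_cmult: "smooth_at A std_atlas f p \<Longrightarrow> v (\<lambda>q. a * f q) = a * v f"
    and tangent_const: "v (\<lambda>q. a) = 0"
    and tangent_local: "smooth_at A std_atlas f p \<Longrightarrow> open U \<Longrightarrow> p \<in> U \<Longrightarrow> (\<And>q. q \<in> U \<Longrightarrow> f q = g q) \<Longrightarrow> v f = v g"
proof -
  obtain \<gamma> where g: "\<gamma> 0 = p" and hv: "has_vel A \<gamma> 0 v" using tangent_curve[OF A v] by metis
  have D: "((\<lambda>s. f (\<gamma> s)) has_real_derivative v f) (at 0)" if "smooth_at A std_atlas f p" for f
    using has_velD[OF hv] that g by simp
  show "v (\<lambda>q. f q + g q) = v f + v g" if "smooth_at A std_atlas f p" "smooth_at A std_atlas g p"
    using DERIV_unique[OF D[OF smooth_at_add[OF A that]] DERIV_add[OF D[OF that(1)] D[OF that(2)]]] .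
  show "v (\<lambda>q. a * f q) = a * v f" if "smooth_at A std_atlas f p"
    using DERIV_unique[OF D[OF smooth_at_cmult[OF A that]] DERIV_cmult[OF D[OF that]]] .
  show "v (\<lambda>q. a) = 0" using DERIV_unique[OF D[OF smooth_at_const] DERIV_const] .
  show "v f = v g" if f: "smooth_at A std_atlas f p" and U: "open U" "p \<in> U" and eq: "\<And>q. q \<in> U \<Longrightarrow> f q = g q"
  proof -
    have "smooth_at A std_atlas g p" by (rule smooth_at_cong[OF A f U eq atlas_real])
    moreover have "((\<lambda>s. g (\<gamma> s)) has_real_derivative v f) (at 0)"
    proof -
      obtain V where V: "open V" "0 \<in> V" "\<forall>s\<in>V. \<gamma> s \<in> U"
        using isCont_open_preimage[where \<gamma> = \<gamma> and t = 0 and U = U] hv U g by (auto simp: has_vel_def)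
      show ?thesis
        by (rule has_field_derivative_transform_within_open[OF D[OF f] V(1,2)]) (use V(3) eq in auto)
    qed
    ultimately show ?thesis using D DERIV_unique by blast
  qed
qed

lemma tangent_sum:
  assumes A: "atlas A" and v: "v \<in> tangent_space A p" and f: "\<And>i. i \<in> I \<Longrightarrow> smooth_at A std_atlas (f i) p"
  shows "v (\<lambda>q. \<Sum>i\<in>I. a i * f i q) = (\<Sum>i\<in>I. a i * v (f i))"
  using f
proof (induction I rule: infinite_finite_induct)
  case (insert i I)
  have "v (\<lambda>q. a i * f i q + (\<Sum>i\<in>I. a i * f i q)) = v (\<lambda>q. a i * f i q) + v (\<lambda>q. \<Sum>i\<in>I. a i * f i q)"
    using insert.prems by (intro tangent_add[OF A v] smooth_at_sum[OF A] smooth_at_cmult[OF A]) auto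
  then show ?case using insert tangent_cmult[OF A v, of "f i" "a i"] by simp
qed (simp_all add: tangent_const[OF A v])

subsection \<open>Coordinates\<close>

abbreviation coord :: "('m, 'e::real_inner) chart \<Rightarrow> 'e \<Rightarrow> 'm \<Rightarrow> real" where
  "coord c d \<equiv> \<lambda>q. snd c q \<bullet> d"

lemma smooth_at_coord:
  fixes A :: "('m::topological_space, 'e::real_inner) chart set"
  assumes A: "atlas A" and c: "c \<in> A" "p \<in> fst c" shows "smooth_at A std_atlas (coord c d) p"
proof -
  obtain D where D: "onb (D :: 'e set)" using atlasD(1)[OF A] by blast
  show ?thesis using smooth_at_linear_comp[OF A smooth_at_chart[OF A c] bounded_linear_inner_left D onb_real] .
qed

lemma tv_coord:
  assumes A: "atlas A" and c: "c \<in> A" "p \<in> fst c"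
  shows "tv A c p u (coord c d) = u \<bullet> d"
proof -
  have cc: "is_chart c" using A c atlasD(2) by blast
  have "frechet_derivative (coord c d \<circ> cinv c) (at (snd c p)) = frechet_derivative (\<lambda>u. u \<bullet> d) (at (snd c p))"
    by (rule frechet_derivative_cong_open[OF is_chartD(2)[OF cc]]) (use c is_chartD(7)[OF cc] in auto)
  also have "\<dots> = (\<lambda>u. u \<bullet> d)"
    by (rule frechet_eqI, rule bounded_linear_imp_has_derivative, rule bounded_linear_inner_left)
  finally show ?thesis using smooth_at_coord[OF A c] by (simp add: tv_def smooth_near_iff)
qed

text \<open>This turns an identity between tangent vectors into identities between finitely many numbers, and a
linear map on a tangent space into a finite sum.\<close>

lemma tangent_coords:
  assumes A: "atlas A" and c: "c \<in> A" "p \<in> fst c" and D: "onb D" and v: "v \<in> tangent_space A p"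
  shows "v = tv A c p (\<Sum>d\<in>D. v (coord c d) *\<^sub>R d)"
proof -
  obtain u where u: "v = tv A c p u" using v tangent_space_tv[OF A c] by blast
  then show ?thesis using tv_coord[OF A c] onbD(2)[OF D] by simp
qed

lemma tv_sum:
  assumes A: "atlas A" and c: "c \<in> A" "p \<in> fst c"
  shows "tv A c p (\<Sum>d\<in>D. a d *\<^sub>R d) h = (\<Sum>d\<in>D. a d * tv A c p d h)"
proof (cases "smooth_near A p h")
  case True
  then have l: "linear (\<lambda>u. tv A c p u h)" by (intro linear_tv[OF A c]) (simp add: smooth_near_iff)
  show ?thesis by (subst linear_sum[OF l]) (simp add: linear_cmul[OF l])
qed (simp add: tv_def)

text \<open>The coordinates of a chart are smooth functions, so a curve that is differentiable when tested on
functions is differentiable in every chart.\<close>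

lemma has_vel_chart:
  assumes A: "atlas A" and c: "c \<in> A" "\<gamma> t \<in> fst c" and D: "onb D" and v: "has_vel A \<gamma> t \<xi>"
  shows "((\<lambda>s. snd c (\<gamma> s)) has_vector_derivative (\<Sum>d\<in>D. \<xi> (coord c d) *\<^sub>R d)) (at t)"
proof -
  have "((\<lambda>s. \<Sum>d\<in>D. (snd c (\<gamma> s) \<bullet> d) *\<^sub>R d) has_vector_derivative (\<Sum>d\<in>D. \<xi> (coord c d) *\<^sub>R d)) (at t)"
  proof (rule has_vector_derivative_sum)
    fix d
    have "((\<lambda>s. snd c (\<gamma> s) \<bullet> d) has_real_derivative \<xi> (coord c d)) (at t)"
      using has_velD[OF v smooth_at_coord[OF A c]] .
    from has_vector_derivative_scaleR[OF this has_vector_derivative_const[of d]]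
    show "((\<lambda>s. (snd c (\<gamma> s) \<bullet> d) *\<^sub>R d) has_vector_derivative \<xi> (coord c d) *\<^sub>R d) (at t)" by simp
  qed
  then show ?thesis by (simp add: onbD(2)[OF D])
qed

subsection \<open>Directional derivatives of functions on a product\<close>

lemma tv_smooth:
  assumes A: "atlas A" and c: "c \<in> A" "p \<in> fst c" and h: "smooth_at A std_atlas h p"
  shows "smooth_at A std_atlas (\<lambda>q. tv A c q u h) p"
    and "\<exists>U. open U \<and> snd c p \<in> U \<and> Cinf_on U (h \<circ> cinv c) \<and>
      tv A c p w (\<lambda>q. tv A c q u h) =
        frechet_derivative (\<lambda>z. frechet_derivative (h \<circ> cinv c) (at z) u) (at (snd c p)) w"
proof -
  have cc: "is_chart c" using A c atlasD(2) by blast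
  obtain U where U: "open U" "snd c p \<in> U" "Cinf_on U (h \<circ> cinv c)"
    using chart_expr_Cinf[OF A c h] by blast
  let ?m = "\<lambda>z. frechet_derivative (h \<circ> cinv c) (at z) u"
  obtain W where W: "open W" "p \<in> W" "\<forall>q\<in>W. smooth_at A std_atlas h q" using smooth_at_nearby[OF h] by blast
  have m: "smooth_at A std_atlas (\<lambda>q. ?m (snd c q)) p"
    by (rule smooth_at_compose[OF A atlas_std_of[OF A] atlas_real smooth_at_chart[OF A c]
          smooth_at_std[OF Cinf_on_frechet[OF U(3)] U(1,2)]])
  have eq: "?m (snd c q) = tv A c q u h" if "q \<in> W" for q
    using W that by (simp add: tv_def smooth_near_iff)
  show s: "smooth_at A std_atlas (\<lambda>q. tv A c q u h) p"
    by (rule smooth_at_cong[OF A m W(1,2) eq atlas_real])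
  have "frechet_derivative ((\<lambda>q. tv A c q u h) \<circ> cinv c) (at (snd c p)) = frechet_derivative ?m (at (snd c p))"
  proof (rule frechet_derivative_cong_open[of "snd c ` (fst c \<inter> W)"])
    show "open (snd c ` (fst c \<inter> W))" by (rule chart_image_open[OF cc W(1)])
    show "snd c p \<in> snd c ` (fst c \<inter> W)" using c W by auto
    show "((\<lambda>q. tv A c q u h) \<circ> cinv c) y = ?m y" if "y \<in> snd c ` (fst c \<inter> W)" for y
      using that eq is_chartD(6)[OF cc] by force
  qed
  then show "\<exists>U. open U \<and> snd c p \<in> U \<and> Cinf_on U (h \<circ> cinv c) \<and>
      tv A c p w (\<lambda>q. tv A c q u h) = frechet_derivative ?m (at (snd c p)) w"
    using U s by (intro exI[of _ U]) (simp add: tv_def smooth_near_iff)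
qed

text \<open>Symmetry of second derivatives: both sides are derivatives of the same chart expression along two
constant coordinate fields.\<close>

lemma tv_commute:
  assumes A: "atlas A" and c: "c \<in> A" "p \<in> fst c" and h: "smooth_at A std_atlas h p"
  shows "tv A c p w (\<lambda>q. tv A c q u h) = tv A c p u (\<lambda>q. tv A c q w h)"
  using tv_smooth(2)[OF assms, of w u] tv_smooth(2)[OF assms, of u w] mixed_partials_commute by metis

lemma has_vel_pair_tv:
  assumes P: "atlas P" and Q: "atlas Q" and c: "c \<in> P" "\<gamma> t \<in> fst c" and d: "d \<in> Q" "\<delta> t \<in> fst d"
    and D: "onb D" and E: "onb E" and g: "has_vel P \<gamma> t \<xi>" and k: "has_vel Q \<delta> t \<zeta>"
  shows "has_vel (prod_atlas P Q) (\<lambda>s. (\<gamma> s, \<delta> s)) t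
    (tv (prod_atlas P Q) (fst c \<times> fst d, map_prod (snd c) (snd d)) (\<gamma> t, \<delta> t)
      (\<Sum>x\<in>D. \<xi> (coord c x) *\<^sub>R x, \<Sum>x\<in>E. \<zeta> (coord d x) *\<^sub>R x))"
proof (rule has_vel_tv[OF atlas_prod[OF P Q] prod_atlasI[OF c(1) d(1)]])
  show "(\<gamma> t, \<delta> t) \<in> fst (fst c \<times> fst d, map_prod (snd c) (snd d))" using c d by simp
  show "isCont (\<lambda>s. (\<gamma> s, \<delta> s)) t" using g k by (auto simp: has_vel_def intro: isCont_Pair)
  show "((\<lambda>s. snd (fst c \<times> fst d, map_prod (snd c) (snd d)) (\<gamma> s, \<delta> s)) has_vector_derivative
     (\<Sum>x\<in>D. \<xi> (coord c x) *\<^sub>R x, \<Sum>x\<in>E. \<zeta> (coord d x) *\<^sub>R x)) (at t)"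
    using has_vector_derivative_Pair[OF has_vel_chart[OF P c D g] has_vel_chart[OF Q d E k]] by simp
qed

lemma has_vel_const: "has_vel A (\<lambda>s. p) t 0"
  by (simp add: has_vel_def)

text \<open>The chain rule for a function of two variables along a pair of curves: in a product chart the
derivative is linear in the pair of velocities, and each of its two summands is found by holding the
other curve fixed.\<close>

lemma has_vel_pair:
  fixes P :: "('m::topological_space, 'e::real_inner) chart set"
    and Q :: "('n::topological_space, 'f::real_inner) chart set"
  assumes P: "atlas P" and Q: "atlas Q" and g: "has_vel P \<gamma> t \<xi>" and k: "has_vel Q \<delta> t \<zeta>"
    and K: "smooth_at (prod_atlas P Q) std_atlas K (\<gamma> t, \<delta> t)"
  shows "((\<lambda>s. K (\<gamma> s, \<delta> s)) has_real_derivative \<xi> (\<lambda>p. K (p, \<delta> t)) + \<zeta> (\<lambda>q. K (\<gamma> t, q))) (at t)"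
proof -
  let ?PQ = "prod_atlas P Q"
  obtain c where c: "c \<in> P" "\<gamma> t \<in> fst c" using atlasD(3)[OF P] by blast
  obtain d where d: "d \<in> Q" "\<delta> t \<in> fst d" using atlasD(3)[OF Q] by blast
  obtain D where D: "onb (D :: 'e set)" using atlasD(1)[OF P] by blast
  obtain E where E: "onb (E :: 'f set)" using atlasD(1)[OF Q] by blast
  let ?e = "(fst c \<times> fst d, map_prod (snd c) (snd d))"
  note PQ = atlas_prod[OF P Q]
  let ?T = "\<lambda>u w. tv (?PQ) ?e (\<gamma> t, \<delta> t) (u, w) K"
  let ?u = "\<Sum>x\<in>D. \<xi> (coord c x) *\<^sub>R x" and ?w = "\<Sum>x\<in>E. \<zeta> (coord d x) *\<^sub>R x"
  note calc = has_velD[OF has_vel_pair_tv[OF P Q _ _ _ _ D E]]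
  have 1: "((\<lambda>s. K (\<gamma> s, \<delta> s)) has_real_derivative ?T ?u ?w) (at t)"
    by (rule calc[OF c d g k K])
  have "((\<lambda>s. K (\<gamma> s, \<delta> t)) has_real_derivative ?T ?u (\<Sum>x\<in>E. 0 (coord d x) *\<^sub>R x)) (at t)"
    using calc[OF c _ _ g has_vel_const K] d by simp
  moreover have "((\<lambda>s. K (\<gamma> s, \<delta> t)) has_real_derivative \<xi> (\<lambda>p. K (p, \<delta> t))) (at t)"
    by (rule has_velD[OF g smooth_at_compose[OF P PQ atlas_real smooth_at_Pair[OF P Q P smooth_at_ident[OF P] smooth_at_const] K]])
  ultimately have 2: "?T ?u 0 = \<xi> (\<lambda>p. K (p, \<delta> t))" using DERIV_unique by fastforce
  have "((\<lambda>s. K (\<gamma> t, \<delta> s)) has_real_derivative ?T (\<Sum>x\<in>D. 0 (coord c x) *\<^sub>R x) ?w) (at t)"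
    using calc[OF _ _ d has_vel_const k K] c by simp
  moreover have "((\<lambda>s. K (\<gamma> t, \<delta> s)) has_real_derivative \<zeta> (\<lambda>q. K (\<gamma> t, q))) (at t)"
    by (rule has_velD[OF k smooth_at_compose[OF Q PQ atlas_real smooth_at_Pair[OF P Q Q smooth_at_const smooth_at_ident[OF Q]] K]])
  ultimately have 3: "?T 0 ?w = \<zeta> (\<lambda>q. K (\<gamma> t, q))" using DERIV_unique by fastforce
  have e: "?e \<in> ?PQ" "(\<gamma> t, \<delta> t) \<in> fst ?e" using c d prod_atlasI[OF c(1) d(1)] by simp_all
  from linear_add[OF linear_tv[OF PQ e K], of "(?u, 0)" "(0, ?w)"]
  have "?T ?u ?w = ?T ?u 0 + ?T 0 ?w" by simp
  then show ?thesis using 1 2 3 by simp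
qed

lemma tv_prod:
  fixes P :: "('m::topological_space, 'e::real_inner) chart set"
    and Q :: "('n::topological_space, 'f::real_inner) chart set"
  assumes P: "atlas P" and Q: "atlas Q" and c: "c \<in> P" "p \<in> fst c" and d: "d \<in> Q" "q \<in> fst d"
    and K: "smooth_at (prod_atlas P Q) std_atlas K (p, q)"
  defines "e \<equiv> (fst c \<times> fst d, map_prod (snd c) (snd d))"
  shows "tv P c p u (\<lambda>p. K (p, q)) = tv (prod_atlas P Q) e (p, q) (u, 0) K"
    and "tv Q d q w (\<lambda>q. K (p, q)) = tv (prod_atlas P Q) e (p, q) (0, w) K"
proof -
  obtain D where D: "onb (D :: 'e set)" using atlasD(1)[OF P] by blast
  obtain E where E: "onb (E :: 'f set)" using atlasD(1)[OF Q] by blast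
  note PQ = atlas_prod[OF P Q]
  note calc = has_velD[OF has_vel_pair_tv[OF P Q _ _ _ _ D E]]
  obtain \<gamma> where g: "\<gamma> 0 = p" "has_vel P \<gamma> 0 (tv P c p u)" using tv_curve[OF P c] by blast
  obtain \<delta> where k: "\<delta> 0 = q" "has_vel Q \<delta> 0 (tv Q d q w)" using tv_curve[OF Q d] by blast
  have Kg: "smooth_at (prod_atlas P Q) std_atlas K (\<gamma> 0, q)" and Kk: "smooth_at (prod_atlas P Q) std_atlas K (p, \<delta> 0)"
    using K g k by simp_all
  have "((\<lambda>s. K (\<gamma> s, q)) has_real_derivative tv (prod_atlas P Q) e (p, q) (u, 0) K) (at 0)"
    using calc[OF c(1) _ d(1) _ g(2) has_vel_const Kg] c d g
    by (simp add: e_def tv_coord[OF P c] onbD(2)[OF D])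
  moreover have "((\<lambda>s. K (\<gamma> s, q)) has_real_derivative tv P c p u (\<lambda>p. K (p, q))) (at 0)"
    by (rule has_velD[OF g(2) smooth_at_compose[OF P PQ atlas_real smooth_at_Pair[OF P Q P smooth_at_ident[OF P] smooth_at_const]]])
      (simp add: g K)
  ultimately show "tv P c p u (\<lambda>p. K (p, q)) = tv (prod_atlas P Q) e (p, q) (u, 0) K"
    using DERIV_unique by blast
  have "((\<lambda>s. K (p, \<delta> s)) has_real_derivative tv (prod_atlas P Q) e (p, q) (0, w) K) (at 0)"
    using calc[OF c(1) _ d(1) _ has_vel_const k(2) Kk] c d k
    by (simp add: e_def tv_coord[OF Q d] onbD(2)[OF E])
  moreover have "((\<lambda>s. K (p, \<delta> s)) has_real_derivative tv Q d q w (\<lambda>q. K (p, q))) (at 0)"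
    by (rule has_velD[OF k(2) smooth_at_compose[OF Q PQ atlas_real smooth_at_Pair[OF P Q Q smooth_at_const smooth_at_ident[OF Q]]]])
      (simp add: k K)
  ultimately show "tv Q d q w (\<lambda>q. K (p, q)) = tv (prod_atlas P Q) e (p, q) (0, w) K"
    using DERIV_unique by blast
qed

lemma prod_nbhd:
  assumes "smooth_at (prod_atlas P Q) B K (p, q)"
  obtains U V where "open U" "p \<in> U" "open V" "q \<in> V" "\<And>x y. x \<in> U \<Longrightarrow> y \<in> V \<Longrightarrow> smooth_at (prod_atlas P Q) B K (x, y)"
proof -
  obtain W where W: "open W" "(p, q) \<in> W" "\<forall>r\<in>W. smooth_at (prod_atlas P Q) B K r" using smooth_at_nearby[OF assms] by blast
  then obtain U V where "open U" "open V" "(p, q) \<in> U \<times> V" "U \<times> V \<subseteq> W" by (metis open_prod_elim)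
  then show ?thesis using W(3) that by blast
qed

text \<open>Differentiating \<open>K\<close> in its second variable along \<open>y\<close> is, in a product chart, differentiating in
a constant direction \<open>(0, w)\<close>, which preserves smoothness.\<close>

lemma smooth_at_partial:
  assumes P: "atlas P" and Q: "atlas Q" and K: "smooth_at (prod_atlas P Q) std_atlas K (p, q)"
    and y: "y \<in> tangent_space Q q"
  shows "smooth_at P std_atlas (\<lambda>p. y (\<lambda>q. K (p, q))) p"
proof -
  let ?PQ = "prod_atlas P Q"
  obtain c where c: "c \<in> P" "p \<in> fst c" using atlasD(3)[OF P] by blast
  obtain d where d: "d \<in> Q" "q \<in> fst d" using atlasD(3)[OF Q] by blast
  obtain w where w: "y = tv Q d q w" using y tangent_space_tv[OF Q d] by blast
  let ?e = "(fst c \<times> fst d, map_prod (snd c) (snd d))"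
  note PQ = atlas_prod[OF P Q]
  have e: "?e \<in> ?PQ" "(p, q) \<in> fst ?e" using c d prod_atlasI[OF c(1) d(1)] by simp_all
  obtain U V where UV: "open U" "p \<in> U" "open V" "q \<in> V"
    "\<And>x y. x \<in> U \<Longrightarrow> y \<in> V \<Longrightarrow> smooth_at (?PQ) std_atlas K (x, y)" using prod_nbhd[OF K] by blast
  have 1: "smooth_at P std_atlas (\<lambda>x. tv (?PQ) ?e (x, q) (0, w) K) p"
    by (rule smooth_at_compose[OF P PQ atlas_real smooth_at_Pair[OF P Q P smooth_at_ident[OF P] smooth_at_const] tv_smooth(1)[OF PQ e K]])
  show ?thesis
  proof (rule smooth_at_cong[OF P 1, of "U \<inter> fst c"])
    show "open (U \<inter> fst c)" using UV(1) is_chartD(1)[OF atlasD(2)[OF P c(1)]] by blast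
    show "p \<in> U \<inter> fst c" using UV c by simp
    show "tv (?PQ) ?e (x, q) (0, w) K = y (\<lambda>q. K (x, q))" if "x \<in> U \<inter> fst c" for x
      using tv_prod(2)[OF P Q c(1) _ d, of x K w] UV that w by simp
  qed simp
qed

text \<open>In a product chart \<open>x\<close> and \<open>y\<close> become the constant directions \<open>(u, 0)\<close> and \<open>(0, w)\<close>, whose
derivatives commute.\<close>

lemma partials_commute:
  assumes P: "atlas P" and Q: "atlas Q" and K: "smooth_at (prod_atlas P Q) std_atlas K (p, q)"
    and x: "x \<in> tangent_space P p" and y: "y \<in> tangent_space Q q"
  shows "x (\<lambda>p. y (\<lambda>q. K (p, q))) = y (\<lambda>q. x (\<lambda>p. K (p, q)))"
proof -
  let ?PQ = "prod_atlas P Q"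
  obtain c where c: "c \<in> P" "p \<in> fst c" using atlasD(3)[OF P] by blast
  obtain d where d: "d \<in> Q" "q \<in> fst d" using atlasD(3)[OF Q] by blast
  obtain u where u: "x = tv P c p u" using x tangent_space_tv[OF P c] by blast
  obtain w where w: "y = tv Q d q w" using y tangent_space_tv[OF Q d] by blast
  let ?e = "(fst c \<times> fst d, map_prod (snd c) (snd d))"
  note PQ = atlas_prod[OF P Q]
  have e: "?e \<in> ?PQ" "(p, q) \<in> fst ?e" using c d prod_atlasI[OF c(1) d(1)] by simp_all
  obtain U V where UV: "open U" "p \<in> U" "open V" "q \<in> V"
    "\<And>x y. x \<in> U \<Longrightarrow> y \<in> V \<Longrightarrow> smooth_at (?PQ) std_atlas K (x, y)" using prod_nbhd[OF K] by blast
  note sm = tv_smooth(1)[OF PQ e K]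
  have "x (\<lambda>p. y (\<lambda>q. K (p, q))) = x (\<lambda>p. tv (?PQ) ?e (p, q) (0, w) K)"
  proof (rule tangent_local[OF P x smooth_at_partial[OF P Q K y], of "U \<inter> fst c"])
    show "open (U \<inter> fst c)" using UV(1) is_chartD(1)[OF atlasD(2)[OF P c(1)]] by blast
    show "p \<in> U \<inter> fst c" using UV c by simp
    show "y (\<lambda>q. K (x, q)) = tv (?PQ) ?e (x, q) (0, w) K" if "x \<in> U \<inter> fst c" for x
      using tv_prod(2)[OF P Q c(1) _ d, of x K w] UV that w by simp
  qed
  also have "\<dots> = tv (?PQ) ?e (p, q) (u, 0) (\<lambda>r. tv (?PQ) ?e r (0, w) K)"
    using tv_prod(1)[OF P Q c d sm[of "(0, w)"], of u] u by simp
  also have "\<dots> = tv (?PQ) ?e (p, q) (0, w) (\<lambda>r. tv (?PQ) ?e r (u, 0) K)"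
    by (rule tv_commute[OF PQ e K])
  also have "\<dots> = y (\<lambda>q. tv (?PQ) ?e (p, q) (u, 0) K)"
    using tv_prod(2)[OF P Q c d sm[of "(u, 0)"], of w] w by simp
  also have "\<dots> = y (\<lambda>q. x (\<lambda>p. K (p, q)))"
  proof (rule tangent_local[OF Q y, of _ "V \<inter> fst d"])
    show "smooth_at Q std_atlas (\<lambda>q. tv (?PQ) ?e (p, q) (u, 0) K) q"
      by (rule smooth_at_compose[OF Q PQ atlas_real smooth_at_Pair[OF P Q Q smooth_at_const smooth_at_ident[OF Q]] sm])
    show "open (V \<inter> fst d)" using UV(3) is_chartD(1)[OF atlasD(2)[OF Q d(1)]] by blast
    show "q \<in> V \<inter> fst d" using UV d by simp
    show "tv (?PQ) ?e (p, y) (u, 0) K = x (\<lambda>p. K (p, y))" if "y \<in> V \<inter> fst d" for y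
      using tv_prod(1)[OF P Q c d(1), of y K u] UV that u by simp
  qed
  finally show ?thesis .
qed

subsection \<open>Differentials, extensions and functions with vanishing derivative\<close>

lemma differential_tangent:
  assumes A: "atlas A" and B: "atlas B" and F: "\<And>q. smooth_at A B F q" and v: "v \<in> tangent_space A p"
  shows "differential B F p v \<in> tangent_space B (F p)"
proof -
  obtain \<gamma> \<epsilon> where g: "\<gamma> 0 = p" "\<epsilon> > 0" "smooth_map std_atlas {-\<epsilon><..<\<epsilon>} A \<gamma>" "v = velocity A \<gamma> 0"
    using tangent_curve[OF A v] by metis
  have "velocity B (\<lambda>t. F (\<gamma> t)) 0 \<in> tangent_space B (F p)"
  proof (rule velocity_tangent[OF _ g(2) _ B])
    show "smooth_at std_atlas B (\<lambda>t. F (\<gamma> t)) t" if "t \<in> {-\<epsilon><..<\<epsilon>}" for t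
      by (rule smooth_at_compose[OF atlas_real A B smooth_atI[OF g(3) _ that] F]) simp
  qed (simp add: g)
  moreover have "velocity B (\<lambda>t. F (\<gamma> t)) 0 = differential B F p v"
  proof
    fix h
    show "velocity B (\<lambda>t. F (\<gamma> t)) 0 h = differential B F p v h"
      using smooth_at_compose[OF A B atlas_real F[of p], of h] g(1)
      by (auto simp: velocity_def differential_def g(4) smooth_near_iff o_def)
  qed
  ultimately show ?thesis by simp
qed

text \<open>Extend a tangent vector by keeping its coordinates in a chart constant. The existence of an extension
is what makes the description in \<^const>\<open>ext_deriv\<close> determine a number.\<close>

lemma vector_field_extension:
  assumes A: "atlas A" and v: "v \<in> tangent_space A p"
  shows "\<exists>U X. open U \<and> p \<in> U \<and> vector_field_on A U X \<and> X p = v"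
proof -
  obtain c where c: "c \<in> A" "p \<in> fst c" using atlasD(3)[OF A] by blast
  obtain u where u: "v = tv A c p u" using v tangent_space_tv[OF A c] by blast
  have "vector_field_on A (fst c) (\<lambda>q. tv A c q u)"
    unfolding vector_field_on_def
  proof (intro conjI ballI allI impI)
    show "tv A c q u \<in> tangent_space A q" if "q \<in> fst c" for q
      using tangent_space_tv[OF A c(1) that] by blast
    fix V h assume V: "open V \<and> V \<subseteq> fst c \<and> smooth_fun_on A V h"
    show "smooth_fun_on A V (\<lambda>q. tv A c q u h)"
      unfolding smooth_fun_on_def
    proof (rule smooth_map_of_smooth_at[OF A atlas_real])
      fix q assume "q \<in> V"
      then show "smooth_at A std_atlas (\<lambda>q. tv A c q u h) q"
        using V by (intro tv_smooth(1)[OF A c(1)]) (auto simp: smooth_fun_on_def intro: smooth_atI)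
    qed (use V in simp)
  qed
  then show ?thesis using u c is_chartD(1)[OF atlasD(2)[OF A c(1)]] by blast
qed

lemma ext_deriv_zero_form:
  assumes A: "atlas A"
  shows "ext_deriv A 0 (zero_form h) = (\<lambda>p vs. if tangent_list A 1 p vs then hd vs h else 0)"
proof (intro ext)
  fix p vs
  show "ext_deriv A 0 (zero_form h) p vs = (if tangent_list A 1 p vs then hd vs h else 0)"
  proof (cases "tangent_list A 1 p vs")
    case True
    then obtain v where v: "vs = [v]" "v \<in> tangent_space A p" by (auto simp: tangent_list_def length_Suc_conv)
    obtain U X where UX: "open U" "p \<in> U" "vector_field_on A U X" "X p = v"
      using vector_field_extension[OF A v(2)] by blast
    have c: "cartan_formula A 0 (zero_form h) Xs p = v h" if "map (\<lambda>X. X p) Xs = vs" for Xs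
      using that v by (auto simp: cartan_formula_def zero_form_def)
    have "(THE r. \<forall>U Xs. open U \<and> p \<in> U \<and> (\<forall>X\<in>set Xs. vector_field_on A U X) \<and> map (\<lambda>X. X p) Xs = vs
            \<longrightarrow> cartan_formula A 0 (zero_form h) Xs p = r) = v h"
    proof (rule the_equality)
      fix r assume *: "\<forall>U Xs. open U \<and> p \<in> U \<and> (\<forall>X\<in>set Xs. vector_field_on A U X) \<and> map (\<lambda>X. X p) Xs = vs
            \<longrightarrow> cartan_formula A 0 (zero_form h) Xs p = r"
      show "r = v h" using *[rule_format, of U "[X]"] c[of "[X]"] UX v by simp
    qed (use c in blast)
    then show ?thesis using True v by (simp add: ext_deriv_def)
  qed (simp add: ext_deriv_def)
qed

text \<open>In a chart the derivative of \<open>h\<close> vanishes on a ball, so \<open>h\<close> is locally constant.\<close>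

lemma zero_derivative_constant:
  fixes h :: "'m::topological_space \<Rightarrow> real"
  assumes A: "atlas A" and conn: "connected (UNIV :: 'm set)" and h: "\<And>p. smooth_at A std_atlas h p"
    and zero: "\<And>p v. v \<in> tangent_space A p \<Longrightarrow> v h = 0"
  shows "h p = h q"
proof -
  have "h constant_on UNIV"
  proof (rule locally_constant_imp_constant[OF conn])
    fix p
    obtain c where c: "c \<in> A" "p \<in> fst c" using atlasD(3)[OF A] by blast
    have cc: "is_chart c" using A c atlasD(2) by blast
    obtain r where r: "r > 0" "ball (snd c p) r \<subseteq> snd c ` fst c"
      using is_chartD(2)[OF cc] c open_contains_ball by blast
    have const: "(h \<circ> cinv c) x = (h \<circ> cinv c) (snd c p)" if x: "x \<in> ball (snd c p) r" for x
    proof (rule has_derivative_zero_unique[of "ball (snd c p) r"])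
      fix y assume y: "y \<in> ball (snd c p) r"
      then have y': "y \<in> snd c ` fst c" by (rule set_mp[OF r(2)])
      let ?q = "cinv c y"
      have q: "?q \<in> fst c" "snd c ?q = y" using is_chartD(7,8)[OF cc] y' by auto
      have "tv A c ?q u h = 0" for u by (rule zero[of _ ?q]) (simp add: tangent_space_tv[OF A c(1) q(1)])
      then have "((h \<circ> cinv c) has_derivative (\<lambda>u. 0)) (at y)"
        using chart_expr_derivative[OF A c(1) q(1) h] q(2) by simp
      then show "((h \<circ> cinv c) has_derivative (\<lambda>u. 0)) (at y within ball (snd c p) r)"
        by (rule has_derivative_at_withinI)
    qed (use x r(1) in simp_all)
    let ?T = "fst c \<inter> snd c -` ball (snd c p) r"
    have "open ?T" by (rule continuous_open_preimage[OF is_chartD(3,1)[OF cc]]) simp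
    then have "openin (top_of_set UNIV) ?T" by simp
    moreover have "\<forall>x\<in>?T. h x = h p"
    proof
      fix x assume x: "x \<in> ?T"
      then have "(h \<circ> cinv c) (snd c x) = (h \<circ> cinv c) (snd c p)" by (intro const) simp
      then show "h x = h p" using x is_chartD(6)[OF cc, of x] is_chartD(6)[OF cc c(2)] by simp
    qed
    moreover have "p \<in> ?T" using c r by simp
    ultimately show "\<exists>T. openin (top_of_set UNIV) T \<and> p \<in> T \<and> (\<forall>x\<in>T. h x = h p)" by blast
  qed
  then obtain y where "\<And>x. h x = y" by (auto simp: constant_on_def)
  then show ?thesis by simp
qed

section \<open>Local solutions of autonomous differential equations\<close>

text \<open>The contraction principle for \<open>c \<mapsto> e + \<integral>\<^sub>0\<^sup>t X(c(s)) ds\<close>. The upper limit of the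
integral is clamped to \<open>[-\<epsilon>, \<epsilon>]\<close>, so that the map acts on bounded continuous functions on the whole
line; those with values in the closed ball form a complete set.\<close>

lemma picard_local:
  fixes X :: "'e::banach \<Rightarrow> 'e"
  assumes r: "r > 0" and L: "L > 0"
    and lip: "\<And>u v. u \<in> cball e r \<Longrightarrow> v \<in> cball e r \<Longrightarrow> norm (X u - X v) \<le> L * norm (u - v)"
  shows "\<exists>\<epsilon>>0. \<exists>c. c 0 = e \<and> (\<forall>t. \<bar>t\<bar> < \<epsilon> \<longrightarrow> c t \<in> cball e r \<and> (c has_vector_derivative X (c t)) (at t))"
proof -
  define M where "M = norm (X e) + L * r"
  have M: "M > 0" using r L by (simp add: M_def add_nonneg_pos)
  have XM: "norm (X u) \<le> M" if "u \<in> cball e r" for u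
  proof -
    have "norm (X u) \<le> norm (X e) + norm (X u - X e)" using norm_triangle_sub[of "X u" "X e"] by simp
    also have "\<dots> \<le> norm (X e) + L * norm (u - e)" using lip[OF that, of e] r by simp
    also have "\<dots> \<le> M" using that L by (simp add: M_def dist_norm norm_minus_commute)
    finally show ?thesis .
  qed
  \<comment> \<open>the first bound keeps the image in the ball of radius \<open>r\<close>, the second makes the map a contraction with factor \<open>1/2\<close>\<close>
  define \<epsilon> where "\<epsilon> = min (r / (4 * M)) (1 / (8 * L))"
  have e: "\<epsilon> > 0" using r L M by (simp add: \<epsilon>_def)
  have eM: "M * (2 * \<epsilon>) + M * (2 * \<epsilon>) \<le> r"
  proof -
    have "\<epsilon> \<le> r / (4 * M)" by (simp add: \<epsilon>_def)
    then show ?thesis using M by (simp add: field_simps)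
  qed
  have eL: "L * (2 * \<epsilon>) + L * (2 * \<epsilon>) \<le> 1 / 2"
  proof -
    have "\<epsilon> \<le> 1 / (8 * L)" by (simp add: \<epsilon>_def)
    then show ?thesis using L by (simp add: field_simps)
  qed
  have Xcont: "continuous_on (cball e r) X"
  proof (rule lipschitz_on_continuous_on[of L])
    show "L-lipschitz_on (cball e r) X"
      using lip L by (intro lipschitz_onI) (simp_all add: dist_norm)
  qed
  define S :: "(real \<Rightarrow>\<^sub>C 'e) set" where "S = PiC UNIV (\<lambda>_. cball e r)"
  have S: "f \<in> S \<longleftrightarrow> (\<forall>t. apply_bcontfun f t \<in> cball e r)" for f by (simp add: S_def mem_PiC_iff Pi_def)
  define \<pi> where "\<pi> t = max (- \<epsilon>) (min \<epsilon> t)" for t :: real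
  have \<pi>: "- \<epsilon> \<le> \<pi> t" "\<pi> t \<le> \<epsilon>" for t using e by (auto simp: \<pi>_def)
  define I where "I f t = integral {- \<epsilon>..t} (\<lambda>s. X (apply_bcontfun f s))" for f t
  \<comment> \<open>the integral from \<open>0\<close> to \<open>t\<close>, for either sign of \<open>t\<close>, as a difference of integrals that start at \<open>-\<epsilon>\<close>\<close>
  define \<Phi> where "\<Phi> f t = e + (I f (\<pi> t) - I f 0)" for f t
  have Xf: "continuous_on T (\<lambda>s. X (apply_bcontfun f s))" if "f \<in> S" for f T
    by (rule continuous_on_compose2[OF Xcont]) (use that S in auto)
  have Ibd: "norm (I f t) \<le> M * (2 * \<epsilon>)" if "f \<in> S" "- \<epsilon> \<le> t" "t \<le> \<epsilon>" for f t
  proof -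
    have "norm (I f t) \<le> M * (t - (- \<epsilon>))"
      unfolding I_def using that S XM by (intro integral_bound Xf) auto
    also have "\<dots> \<le> M * (2 * \<epsilon>)" using that M by (intro mult_left_mono) auto
    finally show ?thesis .
  qed
  have Idiff: "norm (I f t - I g t) \<le> L * (2 * \<epsilon>) * dist f g" if "f \<in> S" "g \<in> S" "- \<epsilon> \<le> t" "t \<le> \<epsilon>" for f g t
  proof -
    have "I f t - I g t = integral {- \<epsilon>..t} (\<lambda>s. X (apply_bcontfun f s) - X (apply_bcontfun g s))"
      unfolding I_def using that by (intro Henstock_Kurzweil_Integration.integral_diff[symmetric] integrable_continuous_real Xf)
    also have "norm \<dots> \<le> L * dist f g * (t - (- \<epsilon>))"
    proof (rule integral_bound)
      show "continuous_on {- \<epsilon>..t} (\<lambda>s. X (apply_bcontfun f s) - X (apply_bcontfun g s))"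
        using that by (intro continuous_on_diff Xf)
      fix s
      have "norm (X (apply_bcontfun f s) - X (apply_bcontfun g s)) \<le> L * norm (apply_bcontfun f s - apply_bcontfun g s)"
        using that S by (intro lip) auto
      also have "\<dots> \<le> L * dist f g" using dist_bounded[of f s g] L by (simp add: dist_norm)
      finally show "norm (X (apply_bcontfun f s) - X (apply_bcontfun g s)) \<le> L * dist f g" .
    qed (use that in simp)
    also have "\<dots> \<le> L * dist f g * (2 * \<epsilon>)" using that L by (intro mult_left_mono) auto
    finally show ?thesis by (simp add: mult_ac)
  qed
  have Icont: "continuous_on {- \<epsilon>..\<epsilon>} (I f)" if "f \<in> S" for f
    unfolding I_def by (rule indefinite_integral_continuous_1) (rule integrable_continuous_real[OF Xf[OF that]])
  have \<Phi>ball: "\<Phi> f t \<in> cball e r" if "f \<in> S" for f t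
  proof -
    have "norm (I f (\<pi> t) - I f 0) \<le> M * (2 * \<epsilon>) + M * (2 * \<epsilon>)"
      using e by (intro order_trans[OF norm_triangle_ineq4] add_mono Ibd that \<pi>) auto
    then show ?thesis using eM by (simp add: \<Phi>_def dist_norm norm_minus_commute)
  qed
  have \<Phi>b: "\<Phi> f \<in> bcontfun" if "f \<in> S" for f
  proof (rule bcontfun_normI)
    have "continuous_on UNIV (\<lambda>t. I f (\<pi> t))"
    proof (rule continuous_on_compose2[OF Icont[OF that]])
      show "continuous_on UNIV \<pi>" unfolding \<pi>_def by (intro continuous_intros)
    qed (use \<pi> in auto)
    then show "continuous_on UNIV (\<Phi> f)" unfolding \<Phi>_def by (intro continuous_intros)
    show "norm (\<Phi> f t) \<le> norm e + r" for t
      using \<Phi>ball[OF that, of t] norm_triangle_sub[of "\<Phi> f t" e] by (simp add: dist_norm norm_minus_commute)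
  qed
  have ap: "apply_bcontfun (Bcontfun (\<Phi> f)) = \<Phi> f" if "f \<in> S" for f
    using \<Phi>b[OF that] by (rule Bcontfun_inverse)
  have "\<exists>!f\<in>S. Bcontfun (\<Phi> f) = f"
  proof (rule Banach_fix)
    show "complete S" unfolding S_def complete_eq_closed by (rule closed_PiC) simp
    show "S \<noteq> {}"
    proof -
      have "const_bcontfun e \<in> S" using r by (simp add: S const_bcontfun.rep_eq)
      then show ?thesis by blast
    qed
    show "(\<lambda>f. Bcontfun (\<Phi> f)) ` S \<subseteq> S"
    proof (rule image_subsetI)
      fix f assume f: "f \<in> S"
      show "Bcontfun (\<Phi> f) \<in> S" unfolding S[of "Bcontfun (\<Phi> f)"] ap[OF f] using \<Phi>ball[OF f] by blast
    qed
    show "dist (Bcontfun (\<Phi> f)) (Bcontfun (\<Phi> g)) \<le> 1 / 2 * dist f g" if fg: "f \<in> S" "g \<in> S" for f g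
    proof (rule dist_bound)
      fix t
      have "\<Phi> f t - \<Phi> g t = (I f (\<pi> t) - I g (\<pi> t)) - (I f 0 - I g 0)" by (simp add: \<Phi>_def)
      also have "norm \<dots> \<le> L * (2 * \<epsilon>) * dist f g + L * (2 * \<epsilon>) * dist f g"
        using e by (intro order_trans[OF norm_triangle_ineq4] add_mono Idiff fg \<pi>) auto
      also have "\<dots> = (L * (2 * \<epsilon>) + L * (2 * \<epsilon>)) * dist f g" by (simp only: distrib_right)
      also have "\<dots> \<le> 1 / 2 * dist f g" using eL by (rule mult_right_mono) simp
      finally show "dist (apply_bcontfun (Bcontfun (\<Phi> f)) t) (apply_bcontfun (Bcontfun (\<Phi> g)) t) \<le> 1 / 2 * dist f g"
        by (simp add: ap fg dist_norm)
    qed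
  qed auto
  then obtain f where f: "f \<in> S" "Bcontfun (\<Phi> f) = f" by blast
  define c where "c = apply_bcontfun f"
  have c: "c t = \<Phi> f t" for t using ap[OF f(1)] f(2) by (simp add: c_def)
  have cS: "c t \<in> cball e r" for t using f(1) S by (simp add: c_def)
  have "c 0 = e" using e by (simp add: c \<Phi>_def \<pi>_def)
  moreover have "(c has_vector_derivative X (c t)) (at t)" if t: "\<bar>t\<bar> < \<epsilon>" for t
  proof -
    have "(I f has_vector_derivative X (c t)) (at t within {- \<epsilon>..\<epsilon>})"
      unfolding I_def c_def by (rule integral_has_vector_derivative[OF Xf[OF f(1)]]) (use t in auto)
    then have "(I f has_vector_derivative X (c t)) (at t within {- \<epsilon><..<\<epsilon>})"
      by (rule has_vector_derivative_within_subset) auto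
    then have "(I f has_vector_derivative X (c t)) (at t)"
      using t by (subst (asm) at_within_open) auto
    then have "((\<lambda>t. e + (I f t - I f 0)) has_vector_derivative X (c t)) (at t)"
      by (auto intro!: derivative_eq_intros)
    then show ?thesis
    proof (rule has_vector_derivative_transform_within_open[of _ _ _ "{- \<epsilon><..<\<epsilon>}"])
      show "e + (I f s - I f 0) = c s" if "s \<in> {- \<epsilon><..<\<epsilon>}" for s
        using that by (simp add: c \<Phi>_def \<pi>_def)
    qed (use t in auto)
  qed
  ultimately show ?thesis using e cS by blast
qed

text \<open>The derivative is bounded near \<open>e\<close> in each of the finitely many basis directions by continuity, hence
bounded in operator norm; the mean value inequality on a ball does the rest.\<close>

lemma Cinf_on_locally_lipschitz:
  fixes X :: "'e::real_inner \<Rightarrow> 'f::real_normed_vector"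
  assumes D: "onb (D :: 'e set)" and U: "open U" "e \<in> U" and X: "Cinf_on U X"
  shows "\<exists>r>0. \<exists>L>0. cball e r \<subseteq> U \<and> (\<forall>u\<in>cball e r. \<forall>v\<in>cball e r. norm (X u - X v) \<le> L * norm (u - v))"
proof -
  let ?X' = "\<lambda>y. frechet_derivative X (at y)"
  define b where "b d = norm (?X' e d) + 1" for d
  have "\<forall>d\<in>D. \<exists>W. open W \<and> e \<in> W \<and> (\<forall>y\<in>W. norm (?X' y d) < b d)"
  proof
    fix d
    have c: "continuous_on U (\<lambda>y. norm (?X' y d))"
      by (rule continuous_on_norm[OF Cinf_on_continuous[OF Cinf_on_frechet[OF X]]])
    have "open (U \<inter> (\<lambda>y. norm (?X' y d)) -` {..< b d})"
      by (rule continuous_open_preimage[OF c U(1)]) simp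
    then show "\<exists>W. open W \<and> e \<in> W \<and> (\<forall>y\<in>W. norm (?X' y d) < b d)"
      using U(2) by (intro exI[of _ "U \<inter> (\<lambda>y. norm (?X' y d)) -` {..< b d}"]) (simp add: b_def)
  qed
  from bchoice[OF this] obtain W where
    "\<forall>d\<in>D. open (W d) \<and> e \<in> W d \<and> (\<forall>y\<in>W d. norm (?X' y d) < b d)" by blast
  then have W: "\<And>d. d \<in> D \<Longrightarrow> open (W d)" "\<And>d. d \<in> D \<Longrightarrow> e \<in> W d"
    "\<And>d y. d \<in> D \<Longrightarrow> y \<in> W d \<Longrightarrow> norm (?X' y d) < b d" by blast+
  define V where "V = U \<inter> (\<Inter>d\<in>D. W d)"
  have "open V" unfolding V_def using W(1) by (intro open_Int open_INT U(1) onbD(1)[OF D]) blast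
  moreover have "e \<in> V" unfolding V_def using U(2) W(2) by blast
  ultimately obtain r where "r > 0" "cball e r \<subseteq> V"
    using open_contains_cball by blast
  then have r: "r > 0" "cball e r \<subseteq> U \<inter> (\<Inter>d\<in>D. W d)" by (simp_all add: V_def)
  define L where "L = (\<Sum>d\<in>D. norm d * b d) + 1"
  have b0: "b d \<ge> 0" for d by (simp add: b_def)
  have L: "L > 0" using sum_nonneg[of D "\<lambda>d. norm d * b d"] b0 by (simp add: L_def add_nonneg_pos)
  have on: "onorm (?X' y) \<le> L" if y: "y \<in> cball e r" for y
  proof (rule onorm_bound)
    show "0 \<le> L" using L by simp
    have "X differentiable (at y)" using y r(2) by (intro Cinf_on_differentiable[OF X]) blast
    then have lin: "linear (?X' y)" by (rule linear_frechet_derivative)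
    fix u
    have "norm (?X' y u) = norm (\<Sum>d\<in>D. (u \<bullet> d) *\<^sub>R ?X' y d)" by (simp only: linear_onb[OF D lin, of u])
    also have "\<dots> \<le> (\<Sum>d\<in>D. norm ((u \<bullet> d) *\<^sub>R ?X' y d))" by (rule norm_sum)
    also have "\<dots> \<le> (\<Sum>d\<in>D. norm d * b d * norm u)"
    proof (rule sum_mono)
      fix d assume d: "d \<in> D"
      have "norm ((u \<bullet> d) *\<^sub>R ?X' y d) = \<bar>u \<bullet> d\<bar> * norm (?X' y d)" by simp
      also have "\<dots> \<le> (norm u * norm d) * b d"
      proof (rule mult_mono)
        have "y \<in> W d" using y r(2) d by blast
        then show "norm (?X' y d) \<le> b d" using W(3)[OF d] by (simp add: less_imp_le)
      qed (simp_all add: Cauchy_Schwarz_ineq2)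
      finally show "norm ((u \<bullet> d) *\<^sub>R ?X' y d) \<le> norm d * b d * norm u" by (simp add: mult_ac)
    qed
    also have "\<dots> = (\<Sum>d\<in>D. norm d * b d) * norm u" by (rule sum_distrib_right[symmetric])
    also have "\<dots> \<le> L * norm u" unfolding L_def by (rule mult_right_mono) simp_all
    finally show "norm (?X' y u) \<le> L * norm u" .
  qed
  have "norm (X u - X v) \<le> L * norm (u - v)" if "u \<in> cball e r" "v \<in> cball e r" for u v
  proof (rule differentiable_bound[OF convex_cball _ on that])
    fix x assume "x \<in> cball e r"
    then have "X differentiable (at x)" using r(2) by (intro Cinf_on_differentiable[OF X]) blast
    then show "(X has_derivative ?X' x) (at x within cball e r)"
      by (rule has_derivative_at_withinI[OF frechet_works])
  qed
  moreover have "cball e r \<subseteq> U" using r(2) by blast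
  ultimately show ?thesis using r(1) L by blast
qed

section \<open>One-parameter subgroups\<close>

lemma has_vel_shift: "has_vel A \<gamma> (t - r) \<xi> \<Longrightarrow> has_vel A (\<lambda>s. \<gamma> (s - r)) t \<xi>"
  unfolding has_vel_def
proof (intro conjI allI impI)
  assume a: "isCont \<gamma> (t - r) \<and> (\<forall>h. smooth_near A (\<gamma> (t - r)) h \<longrightarrow>
     ((\<lambda>s. h (\<gamma> s)) has_real_derivative \<xi> h) (at (t - r)))"
  have "isCont (\<lambda>s. s - r) t" by (intro continuous_intros)
  from isCont_o2[OF this] show "isCont (\<lambda>s. \<gamma> (s - r)) t" using a by blast
  fix h assume "smooth_near A (\<gamma> (t - r)) h"
  then have "((\<lambda>s. h (\<gamma> s)) has_real_derivative \<xi> h) (at (t + (- r)))" using a by simp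
  then show "((\<lambda>s. h (\<gamma> (s - r))) has_real_derivative \<xi> h) (at t)" using DERIV_shift[of "\<lambda>s. h (\<gamma> s)" "\<xi> h" t "- r"] by simp
qed

lemma has_vel_cong_open:
  fixes \<gamma> :: "real \<Rightarrow> 'm::topological_space"
  assumes "has_vel A \<gamma> t \<xi>" "open V" "t \<in> V" "\<And>s. s \<in> V \<Longrightarrow> \<delta> s = \<gamma> s"
  shows "has_vel A \<delta> t \<xi>"
  unfolding has_vel_def
proof (intro conjI allI impI)
  have "isCont \<gamma> t" using assms(1) by (simp add: has_vel_def)
  moreover have "eventually (\<lambda>s. \<delta> s = \<gamma> s) (nhds t)"
    using assms(2-4) eventually_nhds by blast
  ultimately show "isCont \<delta> t" using isCont_cong by blast
  fix h assume "smooth_near A (\<delta> t) h"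
  then have "((\<lambda>s. h (\<gamma> s)) has_real_derivative \<xi> h) (at t)"
    using assms by (simp add: has_vel_def)
  then show "((\<lambda>s. h (\<delta> s)) has_real_derivative \<xi> h) (at t)"
    by (rule has_field_derivative_transform_within_open[OF _ assms(2,3)]) (simp add: assms(4))
qed

lemma zero_velocity_constant:
  fixes A :: "('m::topological_space, 'e::real_inner) chart set"
  assumes A: "atlas A" and J: "open J" "connected J" and c: "\<And>t. t \<in> J \<Longrightarrow> has_vel A \<gamma> t 0"
    and st: "s \<in> J" "t \<in> J"
  shows "\<gamma> s = \<gamma> t"
proof -
  have "\<gamma> constant_on J"
  proof (rule locally_constant_imp_constant[OF J(2)])
    fix t assume t: "t \<in> J"
    obtain d where d: "d \<in> A" "\<gamma> t \<in> fst d" using atlasD(3)[OF A] by blast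
    have dc: "is_chart d" using A d atlasD(2) by blast
    obtain D where D: "onb (D :: 'e set)" using atlasD(1)[OF A] by blast
    have "isCont \<gamma> t" using c[OF t] by (simp add: has_vel_def)
    then obtain V where V: "open V" "t \<in> V" "\<forall>s\<in>V. \<gamma> s \<in> fst d"
      using isCont_open_preimage is_chartD(1)[OF dc] d(2) by blast
    have "open (V \<inter> J)" "t \<in> V \<inter> J" using V J t by auto
    then obtain r where r: "r > 0" "ball t r \<subseteq> V \<inter> J" using open_contains_ball by blast
    have const: "snd d (\<gamma> s) = snd d (\<gamma> t)" if s: "s \<in> ball t r" for s
    proof (rule has_derivative_zero_unique[of "ball t r" "\<lambda>s. snd d (\<gamma> s)"])
      fix x assume "x \<in> ball t r"
      then have x: "x \<in> J" "\<gamma> x \<in> fst d" using r(2) V(3) by auto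
      have "((\<lambda>s. snd d (\<gamma> s)) has_vector_derivative 0) (at x)"
        using has_vel_chart[OF A d(1) x(2) D c[OF x(1)]] by simp
      then show "((\<lambda>s. snd d (\<gamma> s)) has_derivative (\<lambda>h. 0)) (at x within ball t r)"
        unfolding has_vector_derivative_def by (simp add: has_derivative_at_withinI)
    qed (use s r(1) in simp_all)
    have "\<forall>s\<in>ball t r. \<gamma> s = \<gamma> t"
    proof
      fix s assume s: "s \<in> ball t r"
      then have "\<gamma> s \<in> fst d" using r(2) V(3) by auto
      then show "\<gamma> s = \<gamma> t" using const[OF s] is_chartD(5)[OF dc] d(2) by (simp add: inj_on_eq_iff)
    qed
    moreover have "openin (top_of_set J) (ball t r)" using J(1) r(2) by (simp add: openin_open_eq)
    moreover have "t \<in> ball t r" using r by simp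
    ultimately show "\<exists>T. openin (top_of_set J) T \<and> t \<in> T \<and> (\<forall>x\<in>T. \<gamma> x = \<gamma> t)" by blast
  qed
  then obtain y where "\<And>x. x \<in> J \<Longrightarrow> \<gamma> x = y" by (auto simp: constant_on_def)
  then show ?thesis using st by simp
qed

locale lie_grp =
  fixes G :: "'g::{second_countable_topology,t2_space} monoid" (structure)
    and C :: "('g, 'k::{real_inner,banach}) chart set"
  assumes lie: "lie_group G C"
begin

lemma C: "atlas C" using lie smooth_manifold_atlas by (auto simp: lie_group_def)

lemma grp: "group G" using lie by (simp add: lie_group_def)

lemma carr [simp]: "carrier G = UNIV" using lie by (simp add: lie_group_def)

lemma group_simps [simp]:
  "\<one> \<otimes> a = a" "a \<otimes> \<one> = a" "inv a \<otimes> a = \<one>" "a \<otimes> inv a = \<one>" "inv \<one> = \<one>" "inv (inv a) = a"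
  "inv (a \<otimes> b) = inv b \<otimes> inv a" "inv a \<otimes> (a \<otimes> b) = b" "a \<otimes> (inv a \<otimes> b) = b"
proof -
  interpret group G by (rule grp)
  show "\<one> \<otimes> a = a" "a \<otimes> \<one> = a" "inv a \<otimes> a = \<one>" "a \<otimes> inv a = \<one>" "inv \<one> = \<one>" "inv (inv a) = a"
    "inv (a \<otimes> b) = inv b \<otimes> inv a" by (simp_all add: inv_mult_group)
  show "inv a \<otimes> (a \<otimes> b) = b" "a \<otimes> (inv a \<otimes> b) = b" by (simp_all add: m_assoc[symmetric])
qed

lemma assoc: "(a \<otimes> b) \<otimes> c = a \<otimes> (b \<otimes> c)"
  using group.is_monoid[OF grp] monoid.m_assoc by fastforce

lemma smooth_at_mult:
  assumes Q: "atlas Q" and "smooth_at Q C F p" "smooth_at Q C H p"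
  shows "smooth_at Q C (\<lambda>x. F x \<otimes> H x) p"
proof -
  have "smooth_at (prod_atlas C C) C (\<lambda>(a, b). a \<otimes> b) (F p, H p)"
    using lie by (intro smooth_map_UNIV_at) (simp add: lie_group_def)
  from smooth_at_compose[OF Q atlas_prod[OF C C] C smooth_at_Pair[OF C C assms] this]
  show ?thesis by simp
qed

lemma smooth_at_inv:
  assumes Q: "atlas Q" and F: "smooth_at Q C F p" shows "smooth_at Q C (\<lambda>x. inv (F x)) p"
proof -
  have "smooth_at C C (\<lambda>a. inv a) (F p)"
    using lie by (intro smooth_map_UNIV_at) (simp add: lie_group_def)
  from smooth_at_compose[OF Q C C F this] show ?thesis .
qed

abbreviation "T1 \<equiv> tangent_space C \<one>"

abbreviation lif :: "'g tvec \<Rightarrow> 'g \<Rightarrow> 'g tvec" where "lif \<equiv> left_invariant_field G C"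

lemma smooth_at_lmult: "smooth_at C C (\<lambda>b. a \<otimes> b) p"
  by (rule smooth_at_mult[OF C smooth_at_const smooth_at_ident[OF C]])

lemma lif_apply: "smooth_at C std_atlas h a \<Longrightarrow> lif x a h = x (\<lambda>b. h (a \<otimes> b))"
  by (simp add: left_invariant_field_def differential_def smooth_near_iff o_def)

lemma lif_not_smooth: "\<not> smooth_at C std_atlas h a \<Longrightarrow> lif x a h = 0"
  by (simp add: left_invariant_field_def differential_def smooth_near_iff)

lemma lif_tangent: "x \<in> T1 \<Longrightarrow> lif x a \<in> tangent_space C a"
  using differential_tangent[OF C C smooth_at_lmult, of x \<one> a] by (simp add: left_invariant_field_def)

lemma lif_one: assumes "x \<in> T1" shows "lif x \<one> = x"
proof
  fix h show "lif x \<one> h = x h"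
    using lif_apply[of h \<one> x] lif_not_smooth[of h \<one> x] tangent_not_smooth[OF assms, of h]
    by (cases "smooth_at C std_atlas h \<one>") (auto simp: smooth_near_iff)
qed

lemma lif_translate:
  assumes h: "smooth_at C std_atlas h (a \<otimes> b)"
  shows "lif x (a \<otimes> b) h = lif x b (\<lambda>q. h (a \<otimes> q))"
  using smooth_at_compose_real[OF C C h smooth_at_lmult, of a b] lif_apply[OF h]
  by (simp add: lif_apply assoc)

text \<open>Inversion has differential \<open>-1\<close> at the unit: differentiate the constant \<open>k (a a\<inverse>)\<close> along a curve with
velocity \<open>x\<close>.\<close>

lemma inv_derivative:
  assumes x: "x \<in> T1" and k: "smooth_at C std_atlas k \<one>"
  shows "x (\<lambda>b. k (inv b)) = - x k"
proof -
  obtain \<gamma> where g: "\<gamma> 0 = \<one>" "has_vel C \<gamma> 0 x" using tangent_curve[OF C x] by metis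
  note P = atlas_prod[OF C C]
  have K: "smooth_at (prod_atlas C C) std_atlas (\<lambda>w. k (fst w \<otimes> inv (snd w))) (\<gamma> 0, \<gamma> 0)"
    by (rule smooth_at_compose_real[OF P C k])
      (simp_all add: g smooth_at_mult[OF P smooth_at_fst[OF C C] smooth_at_inv[OF P smooth_at_snd[OF C C]]])
  have "((\<lambda>s. k \<one>) has_real_derivative x k + x (\<lambda>b. k (inv b))) (at 0)"
    using has_vel_pair[OF C C g(2) g(2) K] by (simp add: g)
  then show ?thesis using DERIV_unique[OF _ DERIV_const] by fastforce
qed

text \<open>By the chain rule for the product and by left invariance, the velocity of \<open>\<gamma> \<delta>\<inverse>\<close> is the sum of \<open>x k\<close>
and \<open>x (k \<circ> inv)\<close> for one function \<open>k\<close>, so it is zero.\<close>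

lemma integral_curves_agree:
  assumes x: "x \<in> T1" and J: "open J" "connected J"
    and g: "\<And>t. t \<in> J \<Longrightarrow> has_vel C \<gamma> t (lif x (\<gamma> t))" and d: "\<And>t. t \<in> J \<Longrightarrow> has_vel C \<delta> t (lif x (\<delta> t))"
    and s: "s \<in> J" "\<gamma> s = \<delta> s" and t: "t \<in> J"
  shows "\<gamma> t = \<delta> t"
proof -
  note P = atlas_prod[OF C C]
  have q: "smooth_at (prod_atlas C C) C (\<lambda>w. fst w \<otimes> inv (snd w)) w" for w
    by (rule smooth_at_mult[OF P smooth_at_fst[OF C C] smooth_at_inv[OF P smooth_at_snd[OF C C]]])
  have "has_vel C (\<lambda>t. \<gamma> t \<otimes> inv (\<delta> t)) t 0" if t: "t \<in> J" for t
    unfolding has_vel_def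
  proof (intro conjI allI impI)
    have c: "isCont (\<lambda>t. (\<gamma> t, \<delta> t)) t" using g[OF t] d[OF t] by (auto simp: has_vel_def intro: isCont_Pair)
    have "isCont (\<lambda>w. fst w \<otimes> inv (snd w)) (\<gamma> t, \<delta> t)" using smooth_at_isCont[OF q] .
    from isCont_o2[OF c this] show "isCont (\<lambda>t. \<gamma> t \<otimes> inv (\<delta> t)) t" by simp
    fix h assume "smooth_near C (\<gamma> t \<otimes> inv (\<delta> t)) h"
    then have h: "smooth_at C std_atlas h (\<gamma> t \<otimes> inv (\<delta> t))" by (simp add: smooth_near_iff)
    let ?k = "\<lambda>b. h (\<gamma> t \<otimes> b \<otimes> inv (\<delta> t))"
    have k: "smooth_at C std_atlas ?k \<one>"
      by (rule smooth_at_compose_real[OF C C h smooth_at_mult[OF C smooth_at_lmult smooth_at_const]]) simp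
    have K: "smooth_at (prod_atlas C C) std_atlas (\<lambda>w. h (fst w \<otimes> inv (snd w))) (\<gamma> t, \<delta> t)"
      by (rule smooth_at_compose_real[OF P C h q]) simp
    have 1: "smooth_at C std_atlas (\<lambda>p. h (p \<otimes> inv (\<delta> t))) (\<gamma> t)"
      by (rule smooth_at_compose_real[OF C C h smooth_at_mult[OF C smooth_at_ident[OF C] smooth_at_const]]) simp
    have 2: "smooth_at C std_atlas (\<lambda>q. h (\<gamma> t \<otimes> inv q)) (\<delta> t)"
      by (rule smooth_at_compose_real[OF C C h smooth_at_mult[OF C smooth_at_const smooth_at_inv[OF C smooth_at_ident[OF C]]]]) simp
    have "lif x (\<gamma> t) (\<lambda>p. h (p \<otimes> inv (\<delta> t))) = x ?k" by (simp add: lif_apply[OF 1])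
    moreover have "lif x (\<delta> t) (\<lambda>q. h (\<gamma> t \<otimes> inv q)) = x (\<lambda>b. ?k (inv b))" by (simp add: lif_apply[OF 2] assoc)
    ultimately have "lif x (\<gamma> t) (\<lambda>p. h (p \<otimes> inv (\<delta> t))) + lif x (\<delta> t) (\<lambda>q. h (\<gamma> t \<otimes> inv q)) = 0"
      using inv_derivative[OF x k] by simp
    then show "((\<lambda>s. h (\<gamma> s \<otimes> inv (\<delta> s))) has_real_derivative 0 h) (at t)"
      using has_vel_pair[OF C C g[OF t] d[OF t] K] by simp
  qed
  from zero_velocity_constant[OF C J this s(1) t]
  have "\<gamma> t \<otimes> inv (\<delta> t) = \<one>" using s(2) by simp
  then have "\<gamma> t \<otimes> inv (\<delta> t) \<otimes> \<delta> t = \<delta> t" by simp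
  then show ?thesis by (simp add: assoc)
qed

text \<open>In a chart around the unit the left-invariant field becomes a smooth vector-valued function \<open>X\<close>, whose
solution curve is provided by \<open>picard_local\<close>.\<close>

lemma integral_curve_local:
  assumes x: "x \<in> T1"
  shows "\<exists>\<epsilon>>0. \<exists>\<gamma>. \<gamma> 0 = \<one> \<and> (\<forall>t. \<bar>t\<bar> < \<epsilon> \<longrightarrow> has_vel C \<gamma> t (lif x (\<gamma> t)))"
proof -
  obtain c where c: "c \<in> C" "\<one> \<in> fst c" using atlasD(3)[OF C] by blast
  have cc: "is_chart c" using C c atlasD(2) by blast
  obtain D where D: "onb (D :: 'k set)" using atlasD(1)[OF C] by blast
  let ?e = "snd c \<one>"
  define X where "X u = (\<Sum>d\<in>D. lif x (cinv c u) (coord c d) *\<^sub>R d)" for u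
  note P = atlas_prod[OF C C]
  have l: "smooth_at C std_atlas (\<lambda>q. lif x q (coord c d)) \<one>" for d
  proof -
    have "smooth_at (prod_atlas C C) std_atlas (\<lambda>w. coord c d (fst w \<otimes> snd w)) (\<one>, \<one>)"
      by (rule smooth_at_compose_real[OF P C smooth_at_coord[OF C c]])
        (simp_all add: smooth_at_mult[OF P smooth_at_fst[OF C C] smooth_at_snd[OF C C]])
    from smooth_at_partial[OF C C this x]
    have "smooth_at C std_atlas (\<lambda>q. x (\<lambda>b. coord c d (q \<otimes> b))) \<one>" by simp
    then show ?thesis
      by (rule smooth_at_cong[OF C _ is_chartD(1)[OF cc] c(2)])
        (simp_all add: lif_apply smooth_at_coord[OF C c(1)])
  qed
  have S: "atlas (std_atlas :: ('k, 'k) chart set)" by (rule atlas_std[OF D])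
  have e: "?e \<in> snd c ` fst c" using c by blast
  have ce: "cinv c ?e = \<one>" using is_chartD(6)[OF cc c(2)] .
  have "smooth_at std_atlas std_atlas (\<lambda>u. \<Sum>d\<in>D. lif x (cinv c u) (coord c d) *\<^sub>R d) ?e"
    by (rule smooth_at_frame_sum[OF S D smooth_at_compose_real[OF S C l smooth_at_cinv[OF C c(1) e] ce]])
  then obtain U where U: "open U" "?e \<in> U" "Cinf_on U X" unfolding smooth_at_std_iff X_def by blast
  have "open (U \<inter> snd c ` fst c)" "?e \<in> U \<inter> snd c ` fst c" "Cinf_on (U \<inter> snd c ` fst c) X"
    using U e is_chartD(2)[OF cc] Cinf_on_mono[OF U(3), of "U \<inter> snd c ` fst c"] by auto
  from Cinf_on_locally_lipschitz[OF D this]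
  obtain r L where rL: "r > 0" "L > 0" "cball ?e r \<subseteq> U \<inter> snd c ` fst c"
    "\<forall>u\<in>cball ?e r. \<forall>v\<in>cball ?e r. norm (X u - X v) \<le> L * norm (u - v)" by blast
  obtain \<epsilon> y where y: "\<epsilon> > 0" "y 0 = ?e"
    "\<And>t. \<bar>t\<bar> < \<epsilon> \<Longrightarrow> y t \<in> cball ?e r" "\<And>t. \<bar>t\<bar> < \<epsilon> \<Longrightarrow> (y has_vector_derivative X (y t)) (at t)"
    using picard_local[OF rL(1,2), of ?e X] rL(4) by blast
  define \<gamma> where "\<gamma> t = cinv c (y t)" for t
  have yc: "y t \<in> snd c ` fst c" if "\<bar>t\<bar> < \<epsilon>" for t using y(3)[OF that] rL(3) by blast
  have "has_vel C \<gamma> t (lif x (\<gamma> t))" if t: "\<bar>t\<bar> < \<epsilon>" for t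
  proof -
    have gc: "\<gamma> t \<in> fst c" using is_chartD(8)[OF cc yc[OF t]] by (simp add: \<gamma>_def)
    have cont: "isCont y t" using y(4)[OF t] has_vector_derivative_continuous by blast
    have "isCont (cinv c) (y t)" using smooth_at_isCont[OF smooth_at_cinv[OF C c(1) yc[OF t]]] .
    from isCont_o2[OF cont this] have "isCont \<gamma> t" unfolding \<gamma>_def .
    moreover have "((\<lambda>s. snd c (\<gamma> s)) has_vector_derivative X (y t)) (at t)"
    proof (rule has_vector_derivative_transform_within_open[OF y(4)[OF t]])
      show "open {- \<epsilon><..<\<epsilon>}" "t \<in> {- \<epsilon><..<\<epsilon>}" using t by auto
      show "y s = snd c (\<gamma> s)" if "s \<in> {- \<epsilon><..<\<epsilon>}" for s
        using is_chartD(7)[OF cc yc[of s]] that by (simp add: \<gamma>_def abs_less_iff)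
    qed
    ultimately have "has_vel C \<gamma> t (tv C c (\<gamma> t) (X (y t)))" by (rule has_vel_tv[where \<gamma> = \<gamma> and t = t, OF C c(1) gc])
    moreover have "tv C c (\<gamma> t) (X (y t)) = lif x (\<gamma> t)"
      using tangent_coords[OF C c(1) gc D lif_tangent[OF x]] by (simp add: X_def \<gamma>_def)
    ultimately show ?thesis by simp
  qed
  moreover have "\<gamma> 0 = \<one>" by (simp add: \<gamma>_def y(2) ce)
  ultimately show ?thesis using y(1) by blast
qed

lemma has_vel_lmult:
  assumes "has_vel C \<gamma> t (lif x (\<gamma> t))"
  shows "has_vel C (\<lambda>s. a \<otimes> \<gamma> s) t (lif x (a \<otimes> \<gamma> t))"
  unfolding has_vel_def
proof (intro conjI allI impI)
  have "isCont \<gamma> t" using assms by (simp add: has_vel_def)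
  from isCont_o2[OF this smooth_at_isCont[OF smooth_at_lmult]] show "isCont (\<lambda>s. a \<otimes> \<gamma> s) t" .
  fix h assume "smooth_near C (a \<otimes> \<gamma> t) h"
  then have h: "smooth_at C std_atlas h (a \<otimes> \<gamma> t)" by (simp add: smooth_near_iff)
  show "((\<lambda>s. h (a \<otimes> \<gamma> s)) has_real_derivative lif x (a \<otimes> \<gamma> t) h) (at t)"
    using has_velD[OF assms smooth_at_compose_real[OF C C h smooth_at_lmult refl]]
    by (simp add: lif_translate[OF h])
qed

text \<open>A solution on a small interval is prolonged to the line by \<open>\<gamma>(k\<delta> + s) = \<gamma>(\<delta>)\<^sup>k \<gamma>(s)\<close>. The pieces fit
together because \<open>s \<mapsto> \<gamma>(\<delta> + s)\<close> and \<open>s \<mapsto> \<gamma>(\<delta>) \<gamma>(s)\<close> are integral curves through the same point.\<close>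

lemma integral_curve_global:
  assumes x: "x \<in> T1"
  shows "\<exists>\<gamma>. \<gamma> 0 = \<one> \<and> (\<forall>t. has_vel C \<gamma> t (lif x (\<gamma> t)))"
proof -
  interpret group G by (rule grp)
  obtain \<epsilon> \<gamma>\<^sub>0 where g0: "\<epsilon> > 0" "\<gamma>\<^sub>0 0 = \<one>" "\<And>t. \<bar>t\<bar> < \<epsilon> \<Longrightarrow> has_vel C \<gamma>\<^sub>0 t (lif x (\<gamma>\<^sub>0 t))"
    using integral_curve_local[OF x] by blast
  define \<delta> where "\<delta> = \<epsilon> / 2"
  have \<delta>: "\<delta> > 0" "\<epsilon> = 2 * \<delta>" using g0(1) by (simp_all add: \<delta>_def)
  let ?a = "\<gamma>\<^sub>0 \<delta>"
  have add: "\<gamma>\<^sub>0 (\<delta> + s) = ?a \<otimes> \<gamma>\<^sub>0 s" if s: "\<bar>s\<bar> < \<delta>" for s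
  proof (rule integral_curves_agree[OF x, of "{- \<delta><..<\<delta>}" "\<lambda>s. \<gamma>\<^sub>0 (\<delta> + s)" "\<lambda>s. ?a \<otimes> \<gamma>\<^sub>0 s" 0 s])
    show "has_vel C (\<lambda>s. \<gamma>\<^sub>0 (\<delta> + s)) t (lif x (\<gamma>\<^sub>0 (\<delta> + t)))" if "t \<in> {- \<delta><..<\<delta>}" for t
      using has_vel_shift[of C \<gamma>\<^sub>0 t "- \<delta>", OF g0(3)] that \<delta> by (simp add: add.commute abs_less_iff)
    show "has_vel C (\<lambda>s. ?a \<otimes> \<gamma>\<^sub>0 s) t (lif x (?a \<otimes> \<gamma>\<^sub>0 t))" if "t \<in> {- \<delta><..<\<delta>}" for t
      using that \<delta> by (intro has_vel_lmult g0(3)) (simp add: abs_less_iff)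
  qed (use s \<delta> g0(2) in \<open>auto simp: abs_less_iff\<close>)
  define k where "k t = \<lfloor>t / \<delta>\<rfloor>" for t
  define \<gamma> where "\<gamma> t = ?a [^] k t \<otimes> \<gamma>\<^sub>0 (t - k t * \<delta>)" for t
  \<comment> \<open>consecutive pieces overlap, so each instant is interior to the domain of one of them\<close>
  have piece: "\<gamma> t = ?a [^] j \<otimes> \<gamma>\<^sub>0 (t - j * \<delta>)" if "(j - 1) * \<delta> < t" "t < (j + 1) * \<delta>" for j :: int and t
  proof -
    have "real_of_int j - 1 < t / \<delta>" "t / \<delta> < real_of_int j + 1" using that \<delta>(1) by (simp_all add: field_simps)
    then have "k t = j \<or> k t = j - 1" unfolding k_def by linarith
    then show ?thesis
    proof
      assume k: "k t = j - 1"
      have "t < real_of_int j * \<delta>"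
      proof -
        have "t / \<delta> < real_of_int j" using k unfolding k_def by linarith
        then show ?thesis using \<delta>(1) by (simp add: field_simps)
      qed
      then have "\<gamma>\<^sub>0 (\<delta> + (t - j * \<delta>)) = ?a \<otimes> \<gamma>\<^sub>0 (t - j * \<delta>)"
        using that(1) by (intro add) (simp add: abs_less_iff algebra_simps)
      moreover have "t - (real_of_int j - 1) * \<delta> = \<delta> + (t - real_of_int j * \<delta>)" by (simp add: algebra_simps)
      moreover have "?a [^] j = ?a [^] (j - 1) \<otimes> ?a" using int_pow_mult[of ?a "j - 1" 1] by (simp add: int_pow_1)
      ultimately show ?thesis by (simp only: \<gamma>_def k of_int_diff of_int_1 assoc)
    qed (simp add: \<gamma>_def)
  qed
  have "has_vel C \<gamma> t (lif x (\<gamma> t))" for t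
  proof -
    define j where "j = k t"
    have "real_of_int j \<le> t / \<delta>" "t / \<delta> < real_of_int j + 1" unfolding j_def k_def by linarith+
    then have j: "j * \<delta> \<le> t" "t < (j + 1) * \<delta>" using \<delta>(1) by (simp_all add: field_simps)
    have "\<bar>t - j * \<delta>\<bar> < \<epsilon>" using j \<delta> by (simp add: abs_less_iff algebra_simps)
    from has_vel_lmult[OF has_vel_shift[OF g0(3)[OF this]], of "?a [^] j"]
    have v: "has_vel C (\<lambda>s. ?a [^] j \<otimes> \<gamma>\<^sub>0 (s - j * \<delta>)) t (lif x (?a [^] j \<otimes> \<gamma>\<^sub>0 (t - j * \<delta>)))" .
    have t: "t \<in> {(j - 1) * \<delta><..<(j + 1) * \<delta>}" using j \<delta> by (simp add: algebra_simps)
    have "\<gamma> t = ?a [^] j \<otimes> \<gamma>\<^sub>0 (t - j * \<delta>)" using t by (intro piece) simp_all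
    moreover have "has_vel C \<gamma> t (lif x (?a [^] j \<otimes> \<gamma>\<^sub>0 (t - j * \<delta>)))"
      by (rule has_vel_cong_open[OF v _ t]) (use piece in simp_all)
    ultimately show ?thesis by simp
  qed
  moreover have "\<gamma> 0 = \<one>" by (simp add: \<gamma>_def k_def g0(2))
  ultimately show ?thesis by blast
qed

lemma integral_curve_iff: "integral_curve C (lif x) \<gamma> \<longleftrightarrow> (\<forall>t. has_vel C \<gamma> t (lif x (\<gamma> t)))"
  by (auto simp: integral_curve_def has_vel_def continuous_on_eq_continuous_at)

definition one_param :: "'g tvec \<Rightarrow> real \<Rightarrow> 'g" where
  "one_param x = (THE \<gamma>. integral_curve C (lif x) \<gamma> \<and> \<gamma> 0 = \<one>)"

lemma one_param_eqI:
  assumes x: "x \<in> T1" and "\<And>t. has_vel C \<gamma> t (lif x (\<gamma> t))" "\<gamma> 0 = \<one>"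
  shows "one_param x = \<gamma>"
  unfolding one_param_def
proof (rule the_equality)
  show "integral_curve C (lif x) \<gamma> \<and> \<gamma> 0 = \<one>" using assms by (simp add: integral_curve_iff)
  fix \<delta> assume "integral_curve C (lif x) \<delta> \<and> \<delta> 0 = \<one>"
  then show "\<delta> = \<gamma>"
    using integral_curves_agree[OF x open_UNIV connected_UNIV, of \<delta> \<gamma> 0] assms(2,3)
    by (auto simp: integral_curve_iff)
qed

lemma one_param:
  assumes x: "x \<in> T1"
  shows "one_param x 0 = \<one>" "has_vel C (one_param x) t (lif x (one_param x t))"
  using integral_curve_global[OF x] one_param_eqI[OF x] by (metis, metis)

lemma lif_tscale: "lif (tscale s x) a = tscale s (lif x a)"
  by (auto simp: left_invariant_field_def differential_def tscale_def fun_eq_iff)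

text \<open>The curve \<open>t \<mapsto> exp(t x)\<close> is the integral curve of \<open>x\<close> itself, by rescaling time.\<close>

lemma lie_exp_scale:
  assumes x: "x \<in> T1" shows "lie_exp G C (tscale s x) = one_param x s"
proof -
  have "one_param (tscale s x) = (\<lambda>t. one_param x (s * t))"
  proof (rule one_param_eqI[OF tangent_space_scale[OF C x]])
    show "has_vel C (\<lambda>t. one_param x (s * t)) t (lif (tscale s x) (one_param x (s * t)))" for t
      unfolding has_vel_def
    proof (intro conjI allI impI)
      have "isCont (\<lambda>t. s * t) t" by (intro continuous_intros)
      moreover have "isCont (one_param x) (s * t)" using one_param(2)[OF x] by (simp add: has_vel_def)
      ultimately show "isCont (\<lambda>t. one_param x (s * t)) t" by (rule isCont_o2)
      fix h assume "smooth_near C (one_param x (s * t)) h"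
      then have "((\<lambda>t. h (one_param x t)) has_real_derivative lif x (one_param x (s * t)) h) (at (s * t))"
        by (intro has_velD[OF one_param(2)[OF x]]) (simp add: smooth_near_iff)
      moreover have "((\<lambda>t. s * t) has_real_derivative s) (at t)" by (auto intro!: derivative_eq_intros)
      ultimately have "((\<lambda>t. h (one_param x (s * t))) has_real_derivative lif x (one_param x (s * t)) h * s) (at t)"
        by (rule DERIV_chain2)
      then show "((\<lambda>t. h (one_param x (s * t))) has_real_derivative lif (tscale s x) (one_param x (s * t)) h) (at t)"
        unfolding lif_tscale by (simp add: tscale_def mult.commute)
    qed
  qed (simp add: one_param(1)[OF x])
  then show ?thesis by (simp add: lie_exp_def one_param_def)
qed

section \<open>The adjoint representation\<close>

lemma Ad_apply: "smooth_at C std_atlas h \<one> \<Longrightarrow> lie_Ad G C a y h = y (\<lambda>b. h (a \<otimes> b \<otimes> inv a))"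
  by (simp add: lie_Ad_def differential_def smooth_near_iff o_def)

lemma Ad_tangent: assumes "y \<in> T1" shows "lie_Ad G C a y \<in> T1"
proof -
  have "smooth_at C C (\<lambda>b. a \<otimes> b \<otimes> inv a) q" for q
    by (rule smooth_at_mult[OF C smooth_at_lmult smooth_at_const])
  from differential_tangent[OF C C this assms] show ?thesis by (simp add: lie_Ad_def)
qed

lemma lie_bracket_apply:
  assumes x: "x \<in> T1" and y: "y \<in> T1" and h: "smooth_at C std_atlas h \<one>"
  shows "lie_bracket G C x y h = x (\<lambda>q. lif y q h) - y (\<lambda>q. lif x q h)"
  using h by (simp add: lie_bracket_def vf_bracket_def smooth_near_iff lif_one x y)

text \<open>With \<open>Q(a\<^sub>1, a\<^sub>2) = y(b \<mapsto> h(a\<^sub>1\<inverse> b a\<^sub>2))\<close> the function on the left is \<open>Q(a, a)\<close>, and the chain rule splits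
its derivative into two terms. The one from \<open>a\<^sub>1\<close> is \<open>- x(q \<mapsto> y(b \<mapsto> h(qb)))\<close> by the differential of
the inversion; the one from \<open>a\<^sub>2\<close> is \<open>x(q \<mapsto> y(b \<mapsto> h(bq))) = y(b \<mapsto> x(q \<mapsto> h(bq)))\<close> by symmetry of
second derivatives. These are the two terms of the bracket of left-invariant fields.\<close>

lemma Ad_derivative:
  assumes x: "x \<in> T1" and y: "y \<in> T1" and h: "smooth_at C std_atlas h \<one>"
  shows "smooth_at C std_atlas (\<lambda>a. lie_Ad G C (inv a) y h) \<one>"
    and "x (\<lambda>a. lie_Ad G C (inv a) y h) = - lie_bracket G C x y h"
proof -
  note P = atlas_prod[OF C C]
  note PP = atlas_prod[OF P C]
  note f = smooth_at_fst[OF P C] and s = smooth_at_snd[OF P C]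
  note fund = smooth_at_compose[OF PP P C f smooth_at_fst[OF C C]]
    and sf = smooth_at_compose[OF PP P C f smooth_at_snd[OF C C]]
  define Q where "Q = (\<lambda>w. y (\<lambda>b. h (inv (fst w) \<otimes> b \<otimes> snd w)))"
  have K: "smooth_at (prod_atlas (prod_atlas C C) C) std_atlas (\<lambda>z. h (inv (fst (fst z)) \<otimes> snd z \<otimes> snd (fst z))) ((\<one>, \<one>), \<one>)"
    by (rule smooth_at_compose_real[OF PP C h smooth_at_mult[OF PP smooth_at_mult[OF PP smooth_at_inv[OF PP fund] s] sf]]) simp
  have Q: "smooth_at (prod_atlas C C) std_atlas Q (\<one>, \<one>)"
    using smooth_at_partial[OF P C K y] by (simp add: Q_def)
  have QA: "lie_Ad G C (inv a) y h = Q (a, a)" for a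
    using h by (simp add: Ad_apply Q_def)
  show S: "smooth_at C std_atlas (\<lambda>a. lie_Ad G C (inv a) y h) \<one>"
    unfolding QA by (rule smooth_at_compose_real[OF C P Q smooth_at_Pair[OF C C C smooth_at_ident[OF C] smooth_at_ident[OF C]] refl])
  obtain \<gamma> where g: "\<gamma> 0 = \<one>" "has_vel C \<gamma> 0 x" using tangent_curve[OF C x] by metis
  have "((\<lambda>s. Q (\<gamma> s, \<gamma> s)) has_real_derivative x (\<lambda>p. Q (p, \<one>)) + x (\<lambda>q. Q (\<one>, q))) (at 0)"
    using has_vel_pair[OF C C g(2) g(2), of Q] Q g by simp
  moreover have "((\<lambda>s. Q (\<gamma> s, \<gamma> s)) has_real_derivative x (\<lambda>a. lie_Ad G C (inv a) y h)) (at 0)"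
    using has_velD[OF g(2), of "\<lambda>a. lie_Ad G C (inv a) y h"] S g by (simp add: QA)
  ultimately have 1: "x (\<lambda>a. lie_Ad G C (inv a) y h) = x (\<lambda>p. Q (p, \<one>)) + x (\<lambda>q. Q (\<one>, q))"
    using DERIV_unique by blast
  have m: "smooth_at (prod_atlas C C) std_atlas (\<lambda>w. h (fst w \<otimes> snd w)) (\<one>, \<one>)"
    by (rule smooth_at_compose_real[OF P C h smooth_at_mult[OF P smooth_at_fst[OF C C] smooth_at_snd[OF C C]]]) simp
  have m': "smooth_at (prod_atlas C C) std_atlas (\<lambda>w. h (snd w \<otimes> fst w)) (\<one>, \<one>)"
    by (rule smooth_at_compose_real[OF P C h smooth_at_mult[OF P smooth_at_snd[OF C C] smooth_at_fst[OF C C]]]) simp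
  obtain U where U: "open U" "\<one> \<in> U" "\<And>q. q \<in> U \<Longrightarrow> smooth_at C std_atlas h q" using smooth_at_nearby[OF h] by blast
  have k: "smooth_at C std_atlas (\<lambda>q. z (\<lambda>b. h (q \<otimes> b))) \<one>" if "z \<in> T1" for z
    using smooth_at_partial[OF C C m that] by simp
  have l: "w (\<lambda>q. lif z q h) = w (\<lambda>q. z (\<lambda>b. h (q \<otimes> b)))" if "z \<in> T1" "w \<in> T1" for z w
    by (rule tangent_local[OF C that(2) k[OF that(1)] U(1,2), symmetric]) (simp add: lif_apply U(3))
  have "x (\<lambda>p. Q (p, \<one>)) = x (\<lambda>p. (\<lambda>q. y (\<lambda>b. h (q \<otimes> b))) (inv p))" by (simp add: Q_def)
  also have "\<dots> = - x (\<lambda>q. y (\<lambda>b. h (q \<otimes> b)))" by (rule inv_derivative[OF x k[OF y]])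
  finally have 2: "x (\<lambda>p. Q (p, \<one>)) = - x (\<lambda>q. lif y q h)" by (simp add: l x y)
  have "x (\<lambda>q. Q (\<one>, q)) = x (\<lambda>q. y (\<lambda>b. h (b \<otimes> q)))" by (simp add: Q_def)
  also have "\<dots> = y (\<lambda>b. x (\<lambda>q. h (b \<otimes> q)))"
    using partials_commute[OF C C m' x y] by simp
  finally have 3: "x (\<lambda>q. Q (\<one>, q)) = y (\<lambda>q. lif x q h)" by (simp add: l x y)
  show "x (\<lambda>a. lie_Ad G C (inv a) y h) = - lie_bracket G C x y h"
    using 1 2 3 lie_bracket_apply[OF x y h] by simp
qed

text \<open>The bracket is a difference of second-order operators, but as a derivative of \<open>a \<mapsto> Ad(a\<inverse>) y\<close> it can
be computed coordinate by coordinate, and so is of the form \<^const>\<open>tv\<close>.\<close>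

lemma lie_bracket_tangent:
  assumes x: "x \<in> T1" and y: "y \<in> T1" shows "lie_bracket G C x y \<in> T1"
proof -
  obtain c where c: "c \<in> C" "\<one> \<in> fst c" using atlasD(3)[OF C] by blast
  obtain D where D: "onb (D :: 'k set)" using atlasD(1)[OF C] by blast
  let ?W = "\<lambda>d a. lie_Ad G C (inv a) y (coord c d)"
  let ?u = "\<Sum>d\<in>D. (- x (?W d)) *\<^sub>R d"
  have "lie_bracket G C x y h = tv C c \<one> ?u h" for h
  proof (cases "smooth_at C std_atlas h \<one>")
    case True
    have "lie_Ad G C (inv a) y h = (\<Sum>d\<in>D. tv C c \<one> d h * ?W d a)" for a
      using tangent_coords[OF C c D Ad_tangent[OF y, of "inv a"]] tv_sum[OF C c, of "\<lambda>d. ?W d a" D h]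
      by (simp add: mult.commute)
    then have "x (\<lambda>a. lie_Ad G C (inv a) y h) = (\<Sum>d\<in>D. tv C c \<one> d h * x (?W d))"
      using tangent_sum[OF C x Ad_derivative(1)[OF x y smooth_at_coord[OF C c]],
          where I = D and a = "\<lambda>d. tv C c \<one> d h"]
      by simp
    then have "lie_bracket G C x y h = (\<Sum>d\<in>D. (- x (?W d)) * tv C c \<one> d h)"
      using Ad_derivative(2)[OF x y True] by (simp add: sum_negf mult.commute)
    then show ?thesis using tv_sum[OF C c, of "\<lambda>d. - x (?W d)" D h] by simp
  next
    case False
    then show ?thesis by (simp add: lie_bracket_def vf_bracket_def tv_def smooth_near_iff)
  qed
  then show ?thesis unfolding tangent_space_tv[OF C c] by blast
qed

end

section \<open>Fundamental vector fields\<close>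

locale lie_action = lie_grp G C
  for G :: "'g::{second_countable_topology,t2_space} monoid" (structure)
    and C :: "('g, 'k::{real_inner,banach}) chart set" +
  fixes A :: "('m::topological_space, 'e::real_inner) chart set" and \<rho> :: "'g \<Rightarrow> 'm \<Rightarrow> 'm"
  assumes A: "atlas A" and act: "smooth_action G C A \<rho>"
begin

lemma act_simps [simp]: "\<rho> \<one> p = p" "\<rho> (a \<otimes> b) p = \<rho> a (\<rho> b p)"
proof -
  interpret group_action G UNIV \<rho> using act by (simp add: smooth_action_def)
  show "\<rho> \<one> p = p" using fun_cong[OF id_eq_one, of p] by simp
  show "\<rho> (a \<otimes> b) p = \<rho> a (\<rho> b p)" using composition_rule by simp
qed

lemma act_inv: "inv_into UNIV (\<rho> a) = \<rho> (inv a)"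
proof
  fix p
  have "inj (\<rho> a)" by (rule inj_on_inverseI[of _ "\<rho> (inv a)"]) (simp flip: act_simps(2))
  then show "inv_into UNIV (\<rho> a) p = \<rho> (inv a) p"
    by (rule inv_into_f_eq) (simp_all flip: act_simps(2))
qed

lemma smooth_at_act:
  assumes Q: "atlas Q" and "smooth_at Q C F p" "smooth_at Q A H p"
  shows "smooth_at Q A (\<lambda>x. \<rho> (F x) (H x)) p"
proof -
  have "smooth_at (prod_atlas C A) A (\<lambda>(a, b). \<rho> a b) (F p, H p)"
    using act by (intro smooth_map_UNIV_at) (simp add: smooth_action_def)
  from smooth_at_compose[OF Q atlas_prod[OF C A] A smooth_at_Pair[OF C A assms] this]
  show ?thesis by simp
qed

lemma smooth_at_orbit: "smooth_at C A (\<lambda>b. \<rho> b p) a"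
  by (rule smooth_at_act[OF C smooth_at_ident[OF C] smooth_at_const])

lemma smooth_at_act_by: "smooth_at A A (\<rho> a) p"
  by (rule smooth_at_act[OF A smooth_at_const smooth_at_ident[OF A]])

abbreviation fund :: "'g tvec \<Rightarrow> 'm \<Rightarrow> 'm tvec" where "fund \<equiv> fundamental_field G C A \<rho>"

text \<open>Up to sign a fundamental field is the image of \<open>x\<close> under the orbit map. All properties of
fundamental fields are read off from this formula.\<close>

lemma fund_eq:
  assumes x: "x \<in> T1"
  shows "fund x p = tscale (- 1) (differential A (\<lambda>b. \<rho> b p) \<one> x)"
proof
  fix h
  have e: "(\<lambda>t. \<rho> (lie_exp G C (tscale (- t) x)) p) = (\<lambda>t. \<rho> (one_param x (- t)) p)"
    by (simp only: lie_exp_scale[OF x])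
  have v: "fund x p h = velocity A (\<lambda>t. \<rho> (one_param x (- t)) p) 0 h" by (simp only: fundamental_field_def e)
  show "fund x p h = tscale (- 1) (differential A (\<lambda>b. \<rho> b p) \<one> x) h"
  proof (cases "smooth_at A std_atlas h p")
    case True
    have k: "smooth_at C std_atlas (\<lambda>b. h (\<rho> b p)) (one_param x 0)"
      by (rule smooth_at_compose_real[OF C A True smooth_at_orbit]) (simp add: one_param(1)[OF x])
    have "((\<lambda>s. h (\<rho> (one_param x s) p)) has_real_derivative x (\<lambda>b. h (\<rho> b p))) (at (- 0))"
      using has_velD[OF one_param(2)[OF x] k] by (simp add: one_param(1)[OF x] lif_one[OF x])
    moreover have "((\<lambda>t::real. - t) has_real_derivative - 1) (at 0)" by (auto intro!: derivative_eq_intros)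
    ultimately have "((\<lambda>t. h (\<rho> (one_param x (- t)) p)) has_real_derivative x (\<lambda>b. h (\<rho> b p)) * - 1) (at 0)"
      by (rule DERIV_chain2[where g = "\<lambda>t. - t"])
    from DERIV_imp_deriv[OF this] show ?thesis
      using True by (simp add: v velocity_def one_param(1)[OF x] smooth_near_iff tscale_def differential_def o_def)
  next
    case False
    then show ?thesis
      by (simp add: v velocity_def one_param(1)[OF x] smooth_near_iff tscale_def differential_def)
  qed
qed

lemma fund_apply:
  assumes "x \<in> T1" "smooth_at A std_atlas h p" shows "fund x p h = - x (\<lambda>b. h (\<rho> b p))"
  using assms(2) by (simp add: fund_eq[OF assms(1)] tscale_def differential_def smooth_near_iff o_def)

lemma fund_tangent:
  assumes x: "x \<in> T1" shows "fund x p \<in> tangent_space A p"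
  using tangent_space_scale[OF A differential_tangent[OF C A smooth_at_orbit x]] by (simp add: fund_eq[OF x])

text \<open>The function \<open>(q, b) \<mapsto> h(\<rho> b q)\<close> is smooth, and so is its derivative in \<open>b\<close> along \<open>x\<close>.\<close>

lemma fund_vector_field:
  assumes x: "x \<in> T1" shows "fund x \<in> vector_fields A"
  unfolding vector_fields_def vector_field_on_def
proof (intro CollectI conjI ballI allI impI)
  fix V h assume "open V \<and> V \<subseteq> UNIV \<and> smooth_fun_on A V h"
  then have V: "open V" and h: "\<And>p. p \<in> V \<Longrightarrow> smooth_at A std_atlas h p"
    by (auto simp: smooth_fun_on_def intro: smooth_atI)
  show "smooth_fun_on A V (\<lambda>p. fund x p h)"
    unfolding smooth_fun_on_def
  proof (rule smooth_map_of_smooth_at[OF A atlas_real V])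
    fix p assume p: "p \<in> V"
    note P = atlas_prod[OF A C]
    have "smooth_at (prod_atlas A C) std_atlas (\<lambda>w. h (\<rho> (snd w) (fst w))) (p, \<one>)"
      by (rule smooth_at_compose_real[OF P A h[OF p] smooth_at_act[OF P smooth_at_snd[OF A C] smooth_at_fst[OF A C]]]) simp
    from smooth_at_partial[OF A C this x]
    have "smooth_at A std_atlas (\<lambda>q. x (\<lambda>b. h (\<rho> b q))) p" by simp
    from smooth_at_cmult[OF A this, of "- 1"]
    show "smooth_at A std_atlas (\<lambda>p. fund x p h) p"
      by (rule smooth_at_cong[OF A _ V p]) (simp_all add: fund_apply[OF x] h)
  qed
qed (rule fund_tangent[OF x])

text \<open>This is \<open>a (a\<inverse> b a) = b a\<close>, differentiated in \<open>b\<close>.\<close>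

lemma fund_equivariant:
  assumes x: "x \<in> T1"
  shows "differential A (\<rho> a) p (fund (lie_Ad G C (inv a) x) p) = fund x (\<rho> a p)"
proof
  fix h
  show "differential A (\<rho> a) p (fund (lie_Ad G C (inv a) x) p) h = fund x (\<rho> a p) h"
  proof (cases "smooth_at A std_atlas h (\<rho> a p)")
    case True
    have k: "smooth_at C std_atlas (\<lambda>b. h (\<rho> a (\<rho> b p))) \<one>"
      by (rule smooth_at_compose_real[OF C A True smooth_at_act[OF C smooth_at_const smooth_at_orbit]]) simp
    have "smooth_at A std_atlas (\<lambda>q. h (\<rho> a q)) p"
      by (rule smooth_at_compose_real[OF A A True smooth_at_act_by refl])
    then have "differential A (\<rho> a) p (fund (lie_Ad G C (inv a) x) p) h = - x (\<lambda>b. h (\<rho> (a \<otimes> (inv a \<otimes> b \<otimes> a)) p))"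
      using True by (simp add: differential_def smooth_near_iff o_def fund_apply[OF Ad_tangent[OF x]] Ad_apply[OF k]
          del: group_simps(8,9))
    also have "\<dots> = fund x (\<rho> a p) h" by (simp add: fund_apply[OF x True] assoc del: act_simps(2) flip: act_simps(2))
    finally show ?thesis .
  next
    case False
    then show ?thesis using tangent_not_smooth[OF fund_tangent[OF x]] by (simp add: differential_def smooth_near_iff)
  qed
qed

end

section \<open>Functions and relative forms\<close>

lemma Cinf_iff: "atlas B \<Longrightarrow> h \<in> Cinf B \<longleftrightarrow> (\<forall>p. smooth_at B std_atlas h p)"
  unfolding Cinf_def smooth_fun_on_def mem_Collect_eq
  using smooth_map_UNIV_at smooth_map_of_smooth_at[OF _ atlas_real open_UNIV] by blast

lemma tangent_list_simps [simp]:
  "tangent_list A 0 p vs \<longleftrightarrow> vs = []"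
  "tangent_list A (Suc k) p (v # vs) \<longleftrightarrow> v \<in> tangent_space A p \<and> tangent_list A k p vs"
  "\<not> tangent_list A (Suc k) p []"
  by (auto simp: tangent_list_def)

lemma rel_d_fun:
  assumes B: "atlas B"
  shows "rel_d A B F 0 (rel_of_fun h) =
    (\<lambda>p vs. if tangent_list B 1 p vs then hd vs h else 0, \<lambda>p vs. if vs = [] then h (F p) else 0)"
  using ext_deriv_zero_form[OF B, of h]
  by (auto simp: rel_d_def rel_of_fun_def pullback_def zero_form_def fun_eq_iff)

text \<open>The two components of the Hamiltonian equation: the second one determines the values of \<open>h\<close> on the
image of \<open>F\<close>, not merely its derivatives.\<close>

lemma rel_d_fun_eqD:
  assumes B: "atlas B" and eq: "rel_d A B F 0 (rel_of_fun h) = - rel_interior v \<theta>"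
  shows "w \<in> tangent_space B p \<Longrightarrow> w h = - fst \<theta> p [fst v p, w]" and "h (F q) = snd \<theta> q [snd v q]"
proof -
  have 1: "fst (rel_d A B F 0 (rel_of_fun h)) p [w] = fst (- rel_interior v \<theta>) p [w]"
    and 2: "snd (rel_d A B F 0 (rel_of_fun h)) q [] = snd (- rel_interior v \<theta>) q []"
    by (simp_all add: eq)
  show "w h = - fst \<theta> p [fst v p, w]" if "w \<in> tangent_space B p"
    using 1 that by (simp add: rel_d_fun[OF B] rel_interior_def interior_def)
  show "h (F q) = snd \<theta> q [snd v q]"
    using 2 by (simp add: rel_d_fun[OF B] rel_interior_def interior_def)
qed

lemma Cinf_diff:
  assumes "atlas B" "h \<in> Cinf B" "k \<in> Cinf B" shows "h - k \<in> Cinf B"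
proof -
  have "smooth_at B std_atlas (\<lambda>q. h q + (- 1) * k q) p" for p
    using assms by (intro smooth_at_add smooth_at_cmult) (simp_all add: Cinf_iff)
  then show ?thesis using assms(1) by (simp add: Cinf_iff fun_diff_def)
qed

lemma tangent_diff:
  assumes B: "atlas B" and "h \<in> Cinf B" "k \<in> Cinf B" and w: "w \<in> tangent_space B p"
  shows "w (h - k) = w h - w k"
proof -
  have s: "smooth_at B std_atlas h p" "smooth_at B std_atlas k p" using assms by (simp_all add: Cinf_iff)
  have "w (\<lambda>q. h q + (- 1) * k q) = w h + (- 1) * w k"
    using tangent_add[OF B w s(1) smooth_at_cmult[OF B s(2)], of "- 1"] tangent_cmult[OF B w s(2), of "- 1"] by simp
  then show ?thesis by (simp add: fun_diff_def)
qed

text \<open>The source of all rigidity: equal differentials leave a constant on the connected space \<open>N\<close>, and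
the values on the image of \<open>F\<close> fix that constant.\<close>

lemma relative_function_eqI:
  fixes F :: "'m \<Rightarrow> 'n::topological_space"
  assumes B: "atlas B" and conn: "connected (UNIV :: 'n set)" and h: "h \<in> Cinf B" and k: "k \<in> Cinf B"
    and d: "\<And>p w. w \<in> tangent_space B p \<Longrightarrow> w h = w k" and F: "\<And>q. h (F q) = k (F q)"
  shows "h = k"
proof
  fix p
  \<comment> \<open>\<open>undefined\<close> serves as an arbitrary point of \<open>M\<close>, since types are nonempty\<close>
  have "(h - k) p = (h - k) (F undefined)"
  proof (rule zero_derivative_constant[OF B conn])
    show "smooth_at B std_atlas (h - k) p" for p using Cinf_diff[OF B h k] by (simp add: Cinf_iff[OF B])
    show "w (h - k) = 0" if "w \<in> tangent_space B p" for p w using tangent_diff[OF B h k that] d[OF that] by simp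
  qed
  then show "h p = k p" using F by simp
qed

lemma rel_d_fun_inject:
  fixes F :: "'m::topological_space \<Rightarrow> 'n::topological_space"
  assumes B: "atlas B" and conn: "connected (UNIV :: 'n set)" and h: "h \<in> Cinf B" and k: "k \<in> Cinf B"
    and eq: "rel_d A B F 0 (rel_of_fun h) = rel_d A B F 0 (rel_of_fun k)"
  shows "h = k"
proof (rule relative_function_eqI[OF B conn h k, of F])
  fix p w assume "w \<in> tangent_space B p"
  moreover have "fst (rel_d A B F 0 (rel_of_fun h)) p [w] = fst (rel_d A B F 0 (rel_of_fun k)) p [w]" by (simp add: eq)
  ultimately show "w h = w k" by (simp add: rel_d_fun[OF B])
next
  fix q
  have "snd (rel_d A B F 0 (rel_of_fun h)) q [] = snd (rel_d A B F 0 (rel_of_fun k)) q []" by (simp add: eq)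
  then show "h (F q) = k (F q)" by (simp add: rel_d_fun[OF B])
qed

lemma formsD:
  assumes "\<alpha> \<in> forms A k"
  shows "\<not> tangent_list A k p vs \<Longrightarrow> \<alpha> p vs = 0"
    and "tangent_list A k p vs \<Longrightarrow> i < k \<Longrightarrow> u \<in> tangent_space A p \<Longrightarrow> w \<in> tangent_space A p \<Longrightarrow>
      \<alpha> p (vs[i := tscale a u + tscale b w]) = a * \<alpha> p (vs[i := u]) + b * \<alpha> p (vs[i := w])"
    and "tangent_list A k p vs \<Longrightarrow> i < j \<Longrightarrow> j < k \<Longrightarrow> vs ! i = vs ! j \<Longrightarrow> \<alpha> p vs = 0"
proof -
  note a = assms[unfolded forms_def mem_Collect_eq]
  show "\<not> tangent_list A k p vs \<Longrightarrow> \<alpha> p vs = 0" by (rule a[THEN conjunct1, rule_format])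
  show "tangent_list A k p vs \<Longrightarrow> i < k \<Longrightarrow> u \<in> tangent_space A p \<Longrightarrow> w \<in> tangent_space A p \<Longrightarrow>
      \<alpha> p (vs[i := tscale a u + tscale b w]) = a * \<alpha> p (vs[i := u]) + b * \<alpha> p (vs[i := w])"
    by (rule a[THEN conjunct2, THEN conjunct1, rule_format]) (intro conjI)
  show "tangent_list A k p vs \<Longrightarrow> i < j \<Longrightarrow> j < k \<Longrightarrow> vs ! i = vs ! j \<Longrightarrow> \<alpha> p vs = 0"
    by (rule a[THEN conjunct2, THEN conjunct2, THEN conjunct1, rule_format]) (intro conjI)
qed

lemma form_head_diff:
  assumes A: "atlas A" and \<alpha>: "\<alpha> \<in> forms A (Suc k)" and u: "u \<in> tangent_space A p" "w \<in> tangent_space A p"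
  shows "\<alpha> p ((u - w) # vs) = \<alpha> p (u # vs) - \<alpha> p (w # vs)"
proof (cases "tangent_list A k p vs")
  case True
  then show ?thesis
    using formsD(2)[OF \<alpha>, where p = p and vs = "u # vs" and i = 0 and u = u and w = w and a = 1 and b = "- 1"] u
    by (simp add: tscale_simps(3) del: One_nat_def)
next
  case False
  then show ?thesis using formsD(1)[OF \<alpha>] by simp
qed

lemma form2_antisym:
  assumes A: "atlas A" and \<alpha>: "\<alpha> \<in> forms A 2" and u: "u \<in> tangent_space A p" "w \<in> tangent_space A p"
  shows "\<alpha> p [u, w] = - \<alpha> p [w, u]"
proof -
  have two: "2 = Suc (Suc 0)" by simp
  have z: "\<alpha> p [v, v] = 0" if "v \<in> tangent_space A p" for v
    using formsD(3)[OF \<alpha>, of p "[v, v]" 0 1] that by (simp add: two)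
  have d: "u - w \<in> tangent_space A p" using tangent_space_diff[OF A u] .
  have h: "\<alpha> p [v - v', v''] = \<alpha> p [v, v''] - \<alpha> p [v', v'']"
    if "v \<in> tangent_space A p" "v' \<in> tangent_space A p" for v v' v''
    using form_head_diff[OF A \<alpha>[unfolded two] that] by simp
  have t: "\<alpha> p [v'', v - v'] = \<alpha> p [v'', v] - \<alpha> p [v'', v']"
    if "v \<in> tangent_space A p" "v' \<in> tangent_space A p" "v'' \<in> tangent_space A p" for v v' v''
    using formsD(2)[OF \<alpha>, where p = p and vs = "[v'', v]" and i = 1 and u = v and w = v' and a = 1 and b = "- 1"] that
    by (simp add: two tscale_simps(3))
  have "0 = \<alpha> p [u - w, u - w]" using z[OF d] by simp
  also have "\<dots> = \<alpha> p [u, u - w] - \<alpha> p [w, u - w]" by (rule h[OF u])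
  also have "\<dots> = - \<alpha> p [u, w] - \<alpha> p [w, u]"
    unfolding t[OF u u(1)] t[OF u u(2)] z[OF u(1)] z[OF u(2)] by simp
  finally show ?thesis by simp
qed

lemma F_pairsD:
  assumes "v \<in> F_pairs A B F"
  shows "fst v p \<in> tangent_space B p" "snd v q \<in> tangent_space A q"
  using assms by (auto simp: F_pairs_def vector_fields_def vector_field_on_def)

lemma vector_fields_diff:
  assumes A: "atlas A" and X: "X \<in> vector_fields A" and Y: "Y \<in> vector_fields A"
  shows "X - Y \<in> vector_fields A"
  unfolding vector_fields_def vector_field_on_def
proof (intro CollectI conjI ballI allI impI)
  show "(X - Y) p \<in> tangent_space A p" for p
    using tangent_space_diff[OF A] X Y by (simp add: vector_fields_def vector_field_on_def)
  fix V h assume V: "open V \<and> V \<subseteq> UNIV \<and> smooth_fun_on A V h"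
  then have "smooth_fun_on A V (\<lambda>p. X p h)" "smooth_fun_on A V (\<lambda>p. Y p h)"
    using X Y by (auto simp: vector_fields_def vector_field_on_def)
  then have s: "smooth_at A std_atlas (\<lambda>p. X p h) p" "smooth_at A std_atlas (\<lambda>p. Y p h) p" if "p \<in> V" for p
    using V that by (auto simp: smooth_fun_on_def intro: smooth_atI)
  show "smooth_fun_on A V (\<lambda>p. (X - Y) p h)"
    unfolding smooth_fun_on_def
  proof (rule smooth_map_of_smooth_at[OF A atlas_real])
    show "smooth_at A std_atlas (\<lambda>p. (X - Y) p h) p" if "p \<in> V" for p
      using smooth_at_add[OF A s(1)[OF that] smooth_at_cmult[OF A s(2)[OF that], of "- 1"]] by simp
  qed (use V in simp)
qed

lemma F_pairs_diff:
  assumes A: "atlas A" and B: "atlas B" and v: "v \<in> F_pairs A B F" and w: "w \<in> F_pairs A B F"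
  shows "v - w \<in> F_pairs A B F"
proof -
  have "differential B F p (snd v p - snd w p) = fst v (F p) - fst w (F p)" for p
  proof -
    have "differential B F p (snd v p - snd w p) = differential B F p (snd v p) - differential B F p (snd w p)"
      by (auto simp: differential_def fun_eq_iff)
    then show ?thesis using v w by (simp add: F_pairs_def)
  qed
  then show ?thesis using v w vector_fields_diff[OF A] vector_fields_diff[OF B] by (simp add: F_pairs_def)
qed

lemma zero_vector_field: assumes A: "atlas A" shows "0 \<in> vector_fields A"
  using tangent_space_zero[OF A] smooth_map_of_smooth_at[OF A atlas_real _ smooth_at_const]
  by (simp add: vector_fields_def vector_field_on_def smooth_fun_on_def)

lemma F_pairs_zero:
  assumes A: "atlas A" and B: "atlas B" shows "0 \<in> F_pairs A B F"
proof -
  have "differential B F p 0 = 0" for p by (auto simp: differential_def fun_eq_iff)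
  then show ?thesis by (simp add: F_pairs_def zero_vector_field[OF A] zero_vector_field[OF B])
qed

lemma rel_interior_diff:
  assumes A: "atlas A" and B: "atlas B" and \<theta>: "\<theta> \<in> rel_forms A B 2"
    and v: "v \<in> F_pairs A B F" and w: "w \<in> F_pairs A B F"
  shows "rel_interior (v - w) \<theta> = rel_interior v \<theta> - rel_interior w \<theta>"
proof (rule prod_eqI)
  have 2: "fst \<theta> \<in> forms B (Suc 1)" and 1: "snd \<theta> \<in> forms A (Suc 0)"
    using \<theta> by (auto simp: rel_forms_def numeral_2_eq_2)
  show "fst (rel_interior (v - w) \<theta>) = fst (rel_interior v \<theta> - rel_interior w \<theta>)"
    using form_head_diff[OF B 2 F_pairsD(1)[OF v] F_pairsD(1)[OF w]]
    by (simp add: rel_interior_def interior_def fun_eq_iff)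
  show "snd (rel_interior (v - w) \<theta>) = snd (rel_interior v \<theta> - rel_interior w \<theta>)"
    using form_head_diff[OF A 1 F_pairsD(2)[OF v] F_pairsD(2)[OF w]]
    by (simp add: rel_interior_def interior_def fun_eq_iff)
qed

section \<open>Comoment maps\<close>

locale comoment_setting = lie_grp G C
  for G :: "'g::{second_countable_topology,t2_space} monoid" (structure)
    and C :: "('g, 'k::{real_inner,banach}) chart set" +
  fixes F :: "'m::topological_space \<Rightarrow> 'n::topological_space"
    and A :: "('m, 'e::real_inner) chart set" and B :: "('n, 'f::real_inner) chart set"
    and rN :: "'g \<Rightarrow> 'n \<Rightarrow> 'n" and rM :: "'g \<Rightarrow> 'm \<Rightarrow> 'm" and \<theta> :: "('n, 'm) rel_form"
  assumes A: "atlas A" and B: "atlas B" and F: "\<And>p. smooth_at A B F p"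
    and conn: "connected (UNIV :: 'n set)" and form: "\<theta> \<in> rel_forms A B 2"
    and action: "action_on_map G C A B F rN rM" and preserving: "preserves_rel_form A B rN rM 2 \<theta>"
begin

sublocale N: lie_action G C B rN
  by unfold_locales (use B action in \<open>auto simp: action_on_map_def\<close>)

sublocale M: lie_action G C A rM
  by unfold_locales (use A action in \<open>auto simp: action_on_map_def\<close>)

abbreviation "\<omega> \<equiv> fst \<theta>"
abbreviation "\<eta> \<equiv> snd \<theta>"

lemma F_act: "F (rM a p) = rN a (F p)" using action by (simp add: action_on_map_def)

lemma \<omega>: "\<omega> \<in> forms B 2" and \<eta>: "\<eta> \<in> forms A 1" using form by (auto simp: rel_forms_def)

abbreviation fpair :: "'g tvec \<Rightarrow> ('n, 'm) rel_field" where "fpair \<equiv> fundamental_pair G C A B rN rM"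

lemma fpair_F_pair: assumes x: "x \<in> T1" shows "fpair x \<in> F_pairs A B F"
proof -
  have "differential B F p (M.fund x p) = N.fund x (F p)" for p
  proof
    fix h
    show "differential B F p (M.fund x p) h = N.fund x (F p) h"
    proof (cases "smooth_at B std_atlas h (F p)")
      case True
      have "smooth_at A std_atlas (\<lambda>q. h (F q)) p" by (rule smooth_at_compose_real[OF A B True F refl])
      then show ?thesis
        using True by (simp add: differential_def smooth_near_iff o_def M.fund_apply[OF x] N.fund_apply[OF x] F_act)
    next
      case False
      then show ?thesis using tangent_not_smooth[OF N.fund_tangent[OF x]]
        by (simp add: differential_def smooth_near_iff)
    qed
  qed
  then show ?thesis
    using N.fund_vector_field[OF x] M.fund_vector_field[OF x] by (simp add: F_pairs_def fundamental_pair_def)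
qed

end

locale comoment = comoment_setting G C F A B rN rM \<theta>
  for G :: "'g::{second_countable_topology,t2_space} monoid" (structure)
    and C :: "('g, 'k::{real_inner,banach}) chart set"
    and F :: "'m::topological_space \<Rightarrow> 'n::topological_space"
    and A :: "('m, 'e::real_inner) chart set" and B :: "('n, 'f::real_inner) chart set"
    and rN :: "'g \<Rightarrow> 'n \<Rightarrow> 'n" and rM :: "'g \<Rightarrow> 'm \<Rightarrow> 'm" and \<theta> :: "('n, 'm) rel_form" +
  fixes f :: "'g tvec \<Rightarrow> 'n \<Rightarrow> real"
  assumes comoment: "comoment_map G C A B F rN rM \<theta> f"
begin

lemma f_Cinf: "x \<in> T1 \<Longrightarrow> f x \<in> Cinf B"
  using comoment by (simp add: comoment_map_def linear_to_fun_def lie_algebra_def)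

lemma f_lin: "x \<in> T1 \<Longrightarrow> y \<in> T1 \<Longrightarrow> f (tscale a x + tscale b y) p = a * f x p + b * f y p"
  using comoment by (simp add: comoment_map_def linear_to_fun_def lie_algebra_def)

lemma f_rel_d: "x \<in> T1 \<Longrightarrow> rel_d A B F 0 (rel_of_fun (f x)) = - rel_interior (fpair x) \<theta>"
  using comoment by (simp add: comoment_map_def lie_algebra_def)

lemma f_d: "x \<in> T1 \<Longrightarrow> w \<in> tangent_space B p \<Longrightarrow> w (f x) = - \<omega> p [N.fund x p, w]"
  using rel_d_fun_eqD(1)[OF B f_rel_d] by (simp add: fundamental_pair_def)

lemma f_F: "x \<in> T1 \<Longrightarrow> f x (F q) = \<eta> q [M.fund x q]"
  using rel_d_fun_eqD(2)[OF B f_rel_d] by (simp add: fundamental_pair_def)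

lemma f_hamiltonian: "x \<in> T1 \<Longrightarrow> hamiltonian_pair A B F \<theta> (f x) (fpair x)"
  by (simp add: hamiltonian_pair_def fpair_F_pair f_rel_d)

text \<open>Both sides have differential \<open>- \<omega>(v, \<cdot>)\<close> and pullback \<open>\<eta>(v)\<close> for the fundamental fields \<open>v\<close> of
\<open>Ad(a\<inverse>) x\<close>: for the right-hand side this is the invariance of \<open>\<omega>\<close> and \<open>\<eta>\<close> under \<open>a\<close> combined with
\<open>fund_equivariant\<close>.\<close>

lemma equivariant:
  assumes x: "x \<in> T1" shows "f (lie_Ad G C (inv a) x) = f x \<circ> rN a"
proof (rule relative_function_eqI[OF B conn, of _ _ F])
  let ?x' = "lie_Ad G C (inv a) x"
  have x': "?x' \<in> T1" by (rule Ad_tangent[OF x])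
  have s: "smooth_at B std_atlas (f x) p" for p using f_Cinf[OF x] by (simp add: Cinf_iff[OF B])
  have s': "smooth_at B std_atlas (f x \<circ> rN a) p" for p
    unfolding o_def by (rule smooth_at_compose_real[OF B B s N.smooth_at_act_by refl])
  show "f ?x' \<in> Cinf B" by (rule f_Cinf[OF x'])
  show "f x \<circ> rN a \<in> Cinf B" using s' by (simp add: Cinf_iff[OF B])
  show "w (f ?x') = w (f x \<circ> rN a)" if w: "w \<in> tangent_space B p" for p w
  proof -
    let ?d = "differential B (rN a) p"
    have dw: "?d w \<in> tangent_space B (rN a p)" by (rule differential_tangent[OF B B N.smooth_at_act_by w])
    have pb: "pullback B B (rN a) 2 \<omega> = \<omega>" using preserving by (simp add: preserves_rel_form_def)
    have "w (f x \<circ> rN a) = ?d w (f x)" using s[of "rN a p"] by (simp add: differential_def smooth_near_iff)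
    also have "\<dots> = - \<omega> (rN a p) [N.fund x (rN a p), ?d w]" by (rule f_d[OF x dw])
    also have "\<dots> = - \<omega> (rN a p) [?d (N.fund ?x' p), ?d w]" by (simp only: N.fund_equivariant[OF x])
    also have "\<dots> = - pullback B B (rN a) 2 \<omega> p [N.fund ?x' p, w]"
      using N.fund_tangent[OF x', of p] w by (simp add: pullback_def numeral_2_eq_2)
    also have "\<dots> = w (f ?x')" unfolding pb using f_d[OF x' w] by simp
    finally show ?thesis by simp
  qed
  show "f ?x' (F q) = (f x \<circ> rN a) (F q)" for q
  proof -
    let ?d = "differential A (rM a) q"
    have pb: "pullback A A (rM a) 1 \<eta> = \<eta>" using preserving by (simp add: preserves_rel_form_def)
    have "(f x \<circ> rN a) (F q) = \<eta> (rM a q) [M.fund x (rM a q)]" using f_F[OF x, of "rM a q"] by (simp add: F_act)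
    also have "\<dots> = \<eta> (rM a q) [?d (M.fund ?x' q)]" by (simp only: M.fund_equivariant[OF x])
    also have "\<dots> = pullback A A (rM a) 1 \<eta> q [M.fund ?x' q]"
      using M.fund_tangent[OF x', of q] by (simp add: pullback_def)
    also have "\<dots> = f ?x' (F q)" unfolding pb by (simp add: f_F[OF x'])
    finally show ?thesis by simp
  qed
qed

lemma f_coords:
  assumes c: "c \<in> C" "\<one> \<in> fst c" and D: "onb D" and z: "z \<in> T1"
  shows "f z p = (\<Sum>d\<in>D. f (tv C c \<one> d) p * z (coord c d))"
proof -
  have T: "tv C c \<one> u \<in> T1" for u using tangent_space_tv[OF C c] by blast
  have l: "linear (\<lambda>u. f (tv C c \<one> u) p)"
  proof (rule linearI)
    show "f (tv C c \<one> (u + w)) p = f (tv C c \<one> u) p + f (tv C c \<one> w) p" for u w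
      using tv_linear[OF C c, of 1 u 1 w] f_lin[OF T T, of 1 u 1 w p] by simp
    show "f (tv C c \<one> (r *\<^sub>R u)) p = r *\<^sub>R f (tv C c \<one> u) p" for r u
      using tv_linear[OF C c, of r u 0 u] f_lin[OF T T, of r u 0 u p] by simp
  qed
  have "f z p = f (tv C c \<one> (\<Sum>d\<in>D. z (coord c d) *\<^sub>R d)) p" using tangent_coords[OF C c D z] by simp
  also have "\<dots> = (\<Sum>d\<in>D. f (tv C c \<one> d) p * z (coord c d))"
    by (subst linear_sum[OF l]) (simp add: linear_cmul[OF l] mult.commute)
  finally show ?thesis .
qed

text \<open>Differentiate \<open>f y (rN b p) = f (Ad(b\<inverse>) y) p\<close> in \<open>b\<close> at the unit along \<open>x\<close>. Coordinates on the Lie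
algebra reduce the right-hand side to the derivative of the real functions \<open>Ad(b\<inverse>) y (coord c d)\<close>.\<close>

lemma infinitesimally_equivariant:
  assumes x: "x \<in> T1" and y: "y \<in> T1"
  shows "N.fund x p (f y) = f (lie_bracket G C x y) p"
proof -
  obtain c where c: "c \<in> C" "\<one> \<in> fst c" using atlasD(3)[OF C] by blast
  obtain D where D: "onb (D :: 'k set)" using atlasD(1)[OF C] by blast
  have s: "smooth_at B std_atlas (f y) p" using f_Cinf[OF y] by (simp add: Cinf_iff[OF B])
  have "f y (rN b p) = (\<Sum>d\<in>D. f (tv C c \<one> d) p * lie_Ad G C (inv b) y (coord c d))" for b
    using f_coords[OF c D Ad_tangent[OF y], of "inv b" p] equivariant[OF y, of b] by simp
  then have "N.fund x p (f y) = - x (\<lambda>b. \<Sum>d\<in>D. f (tv C c \<one> d) p * lie_Ad G C (inv b) y (coord c d))"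
    by (simp add: N.fund_apply[OF x s])
  also have "\<dots> = - (\<Sum>d\<in>D. f (tv C c \<one> d) p * x (\<lambda>b. lie_Ad G C (inv b) y (coord c d)))"
    using tangent_sum[OF C x Ad_derivative(1)[OF x y smooth_at_coord[OF C c]],
        where I = D and a = "\<lambda>d. f (tv C c \<one> d) p"] by simp
  also have "\<dots> = (\<Sum>d\<in>D. f (tv C c \<one> d) p * lie_bracket G C x y (coord c d))"
    using Ad_derivative(2)[OF x y smooth_at_coord[OF C c]] by (simp add: sum_negf)
  also have "\<dots> = f (lie_bracket G C x y) p" by (rule f_coords[OF c D lie_bracket_tangent[OF x y], symmetric])
  finally show ?thesis .
qed

lemma strict:
  assumes x: "x \<in> T1" and y: "y \<in> T1"
  shows "\<omega> p [N.fund x p, N.fund y p] = f (lie_bracket G C x y) p"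
  using f_d[OF y N.fund_tangent[OF x]] form2_antisym[OF B \<omega> N.fund_tangent[OF x] N.fund_tangent[OF y]]
    infinitesimally_equivariant[OF x y] by simp

text \<open>The Hamiltonian pairs behind the bracket are arbitrary choices. Replacing one of them leaves \<open>\<omega>\<close> of
the two fields unchanged, because up to sign it is the derivative of the corresponding Hamiltonian
along the other field; so both may be replaced by fundamental pairs.\<close>

lemma bracket:
  assumes x: "x \<in> T1" and y: "y \<in> T1"
  shows "ham_bracket A B F \<theta> (f x) (f y) = f (lie_bracket G C x y)"
proof
  fix p
  define v where "v = (SOME v. hamiltonian_pair A B F \<theta> (f x) v)"
  define w where "w = (SOME v. hamiltonian_pair A B F \<theta> (f y) v)"
  have v: "hamiltonian_pair A B F \<theta> (f x) v" unfolding v_def using f_hamiltonian[OF x] by (rule someI)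
  have w: "hamiltonian_pair A B F \<theta> (f y) w" unfolding w_def using f_hamiltonian[OF y] by (rule someI)
  have wp: "fst w p \<in> tangent_space B p" using F_pairsD(1)[of w A B F] w by (simp add: hamiltonian_pair_def)
  have dv: "u (f x) = - \<omega> p [fst v p, u]" and dw: "u (f y) = - \<omega> p [fst w p, u]" if "u \<in> tangent_space B p" for u
    using rel_d_fun_eqD(1)[OF B] v w that unfolding hamiltonian_pair_def by blast+
  have "ham_bracket A B F \<theta> (f x) (f y) p = \<omega> p [fst v p, fst w p]"
    by (simp add: ham_bracket_def v_def[symmetric] w_def[symmetric] fun_of_rel_def rel_interior2_def
        rel_interior_def interior_def)
  also have "\<dots> = \<omega> p [N.fund x p, fst w p]" using dv[OF wp] f_d[OF x wp] by simp
  also have "\<dots> = N.fund x p (f y)"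
    using dw[OF N.fund_tangent[OF x]] form2_antisym[OF B \<omega> N.fund_tangent[OF x] wp] by simp
  also have "\<dots> = f (lie_bracket G C x y) p" by (rule infinitesimally_equivariant[OF x y])
  finally show "ham_bracket A B F \<theta> (f x) (f y) p = f (lie_bracket G C x y) p" .
qed

lemma strict_moment_map: "strict_moment_map G C A B F rN rM \<theta> f"
  unfolding strict_moment_map_def lie_algebra_def
proof (intro conjI ballI)
  show "linear_to_fun G C B f" using comoment by (simp add: comoment_map_def)
  fix x assume x: "x \<in> T1"
  show "rel_d A B F 0 (rel_of_fun (f x)) + rel_interior (fpair x) \<theta> = 0" by (simp add: f_rel_d[OF x])
  fix y assume y: "y \<in> T1"
  show "rel_of_fun (f (lie_bracket G C x y)) = rel_interior2 (fpair x) (fpair y) \<theta>"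
  proof (rule prod_eqI)
    have "zero_form (f (lie_bracket G C x y)) p vs = \<omega> p (N.fund x p # N.fund y p # vs)" for p vs
      using strict[OF x y, of p] formsD(1)[OF \<omega>, of p "N.fund x p # N.fund y p # vs"]
      by (cases "vs = []") (auto simp: zero_form_def numeral_2_eq_2)
    then show "fst (rel_of_fun (f (lie_bracket G C x y))) = fst (rel_interior2 (fpair x) (fpair y) \<theta>)"
      by (simp add: rel_of_fun_def rel_interior2_def rel_interior_def interior_def fundamental_pair_def fun_eq_iff)
    have "\<eta> q (M.fund x q # M.fund y q # vs) = 0" for q vs
      using formsD(1)[OF \<eta>, of q "M.fund x q # M.fund y q # vs"] by simp
    then show "snd (rel_of_fun (f (lie_bracket G C x y))) = snd (rel_interior2 (fpair x) (fpair y) \<theta>)"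
      by (simp add: rel_of_fun_def rel_interior2_def rel_interior_def interior_def fundamental_pair_def fun_eq_iff)
  qed
qed

end

theorem theorem7p1:
  fixes F :: "'m::{second_countable_topology,t2_space} \<Rightarrow> 'n::{second_countable_topology,t2_space}"
    and A :: "('m, 'e::{real_inner,banach}) chart set"
    and B :: "('n, 'f::{real_inner,banach}) chart set"
    and G :: "'g::{second_countable_topology,t2_space} monoid"
    and C :: "('g, 'k::{real_inner,banach}) chart set"
    and rN :: "'g \<Rightarrow> 'n \<Rightarrow> 'n"
    and rM :: "'g \<Rightarrow> 'm \<Rightarrow> 'm"
    and \<theta> :: "('n, 'm) rel_form"
    and f :: "'g tvec \<Rightarrow> 'n \<Rightarrow> real"
  assumes M: "smooth_manifold A" and N: "smooth_manifold B"
    and F: "smooth_map A UNIV B F"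
    and N_connected: "connected (UNIV :: 'n set)"
    and M_nonempty: "(UNIV :: 'm set) \<noteq> {}"
    and form: "\<theta> \<in> rel_forms A B 2" and closed: "rel_d A B F 2 \<theta> = 0"
    and G: "lie_group G C"
    and action: "action_on_map G C A B F rN rM"
    and preserving: "preserves_rel_form A B rN rM 2 \<theta>"
    and comoment: "comoment_map G C A B F rN rM \<theta> f"
  shows
    "(\<forall>f'. comoment_map G C A B F rN rM \<theta> f' \<longrightarrow> (\<forall>x\<in>lie_algebra G C. f' x = f x)) \<and>

     ((\<forall>x\<in>lie_algebra G C. f x \<in> Ham0 A B F \<theta>) \<and>
      (\<forall>x\<in>lie_algebra G C. \<forall>y\<in>lie_algebra G C.
         f (lie_bracket G C x y) = ham_bracket A B F \<theta> (f x) (f y)) \<and>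
      (\<forall>x\<in>lie_algebra G C. \<forall>y\<in>lie_algebra G C.
         kostant_souriau_cocycle G C A B F \<theta> f x y = 0) \<and>
      strict_moment_map G C A B F rN rM \<theta> f) \<and>

     ((\<forall>x\<in>lie_algebra G C. \<forall>y\<in>lie_algebra G C.
         lie_deriv (fst (fundamental_pair G C A B rN rM x)) (f y) = f (lie_bracket G C x y)) \<and>
      (connected (UNIV :: 'g set) \<longrightarrow>
         (\<forall>a. \<forall>x\<in>lie_algebra G C. f (lie_Ad G C a x) = f x \<circ> inv_into UNIV (rN a)))) \<and>

     ((strongly_nondegenerate A B F \<theta> \<longrightarrow>
         (\<forall>\<sigma>\<in>Ham0 A B F \<theta>. \<exists>!v. hamiltonian_pair A B F \<theta> \<sigma> v) \<and>
         (\<lambda>\<sigma>. THE v. hamiltonian_pair A B F \<theta> \<sigma> v) \<in> Ham0 A B F \<theta> \<rightarrow> F_pairs A B F \<and>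
         inj_on (\<lambda>\<sigma>. THE v. hamiltonian_pair A B F \<theta> \<sigma> v) (Ham0 A B F \<theta>)) \<and>
      (\<forall>\<sigma>\<in>Ham0 A B F \<theta>. hamiltonian_pair A B F \<theta> \<sigma> 0 \<longrightarrow>
         rel_d A B F 0 (rel_of_fun \<sigma>) = 0 \<and> \<sigma> = 0) \<and>
      (\<forall>\<sigma>\<^sub>1\<in>Ham0 A B F \<theta>. \<forall>\<sigma>\<^sub>2\<in>Ham0 A B F \<theta>. \<forall>v.
         hamiltonian_pair A B F \<theta> \<sigma>\<^sub>1 v \<and> hamiltonian_pair A B F \<theta> \<sigma>\<^sub>2 v \<longrightarrow>
         rel_d A B F 0 (rel_of_fun (\<sigma>\<^sub>1 - \<sigma>\<^sub>2)) = 0 \<and> \<sigma>\<^sub>1 = \<sigma>\<^sub>2) \<and>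
      {\<sigma> \<in> Ham0 A B F \<theta>. hamiltonian_pair A B F \<theta> \<sigma> 0} = {0})"
proof -
  let ?Ham = "Ham0 A B F \<theta>"
  let ?H = "hamiltonian_pair A B F \<theta>"
  have A: "atlas A" and B: "atlas B" using M N smooth_manifold_atlas by blast+
  interpret comoment G C F A B rN rM \<theta> f
    by unfold_locales
      (use A B F G action preserving comoment form N_connected in \<open>simp_all add: smooth_map_UNIV_at\<close>)
  have LA: "lie_algebra G C = T1" by (simp add: lie_algebra_def)
  have uniq: "f' x = f x" if f': "comoment_map G C A B F rN rM \<theta> f'" and x: "x \<in> T1" for f' x
  proof -
    interpret f': comoment G C F A B rN rM \<theta> f' by unfold_locales (rule f')
    show ?thesis by (rule rel_d_fun_inject[OF B conn f'.f_Cinf[OF x] f_Cinf[OF x], of A F])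
      (simp add: f'.f_rel_d[OF x] f_rel_d[OF x])
  qed
  have equi: "f (lie_Ad G C a x) = f x \<circ> inv_into UNIV (rN a)" if "x \<in> T1" for a x
    using equivariant[OF that, of "inv\<^bsub>G\<^esub> a"] by (simp add: N.act_inv)
  have Ham_Cinf: "\<sigma> \<in> Cinf B" if "\<sigma> \<in> ?Ham" for \<sigma> using that by (simp add: Ham0_def)
  have common: "\<sigma> = \<tau>" if "\<sigma> \<in> ?Ham" "\<tau> \<in> ?Ham"
    "?H \<sigma> v" "?H \<tau> v" for \<sigma> \<tau> v
    by (rule rel_d_fun_inject[OF B conn Ham_Cinf[OF that(1)] Ham_Cinf[OF that(2)], of A F])
      (use that(3,4) in \<open>simp add: hamiltonian_pair_def\<close>)
  have d0: "rel_d A B F 0 (rel_of_fun 0) = 0"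
  proof -
    have "v 0 = 0" if "v \<in> tangent_space B p" for v p
      using tangent_const[OF B that, of 0] by (simp add: zero_fun_def)
    then show ?thesis
      by (auto simp: rel_d_fun[OF B] zero_prod_def fun_eq_iff tangent_list_def length_Suc_conv)
  qed
  have zero_pair: "0 \<in> F_pairs A B F" by (rule F_pairs_zero[OF A B])
  have i0: "rel_interior 0 \<theta> = 0" using rel_interior_diff[OF A B form zero_pair zero_pair] by simp
  have ham0: "?H 0 0" by (simp add: hamiltonian_pair_def zero_pair d0 i0)
  have Ham0_0: "0 \<in> ?Ham"
  proof -
    have "smooth_at B std_atlas 0 p" for p using smooth_at_const[of B std_atlas 0 p] by (simp add: zero_fun_def)
    then show ?thesis using ham0 unfolding Ham0_def Cinf_iff[OF B] mem_Collect_eq by blast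
  qed
  have ex1: "\<exists>!v. ?H \<sigma> v"
    if nd: "strongly_nondegenerate A B F \<theta>" and \<sigma>: "\<sigma> \<in> ?Ham" for \<sigma>
  proof -
    obtain v where v: "?H \<sigma> v" using \<sigma> by (auto simp: Ham0_def)
    have "w = v" if w: "?H \<sigma> w" for w
    proof -
      have p: "w \<in> F_pairs A B F" "v \<in> F_pairs A B F" using v w by (simp_all add: hamiltonian_pair_def)
      have "- rel_interior w \<theta> = - rel_interior v \<theta>" using v w by (simp add: hamiltonian_pair_def)
      then have "rel_interior (w - v) \<theta> = 0" using rel_interior_diff[OF A B form p] by simp
      then have "w - v = 0" using nd F_pairs_diff[OF A B p] unfolding strongly_nondegenerate_def by blast
      then show ?thesis by simp
    qed
    then show ?thesis using v by blast
  qed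
  have zero: "rel_d A B F 0 (rel_of_fun \<sigma>) = 0 \<and> \<sigma> = 0"
    if "\<sigma> \<in> ?Ham" "?H \<sigma> 0" for \<sigma>
    using common[OF that(1) Ham0_0 that(2) ham0] d0 by simp
  have nondeg: "(\<forall>\<sigma>\<in>?Ham. \<exists>!v. ?H \<sigma> v) \<and>
         (\<lambda>\<sigma>. THE v. ?H \<sigma> v) \<in> ?Ham \<rightarrow> F_pairs A B F \<and>
         inj_on (\<lambda>\<sigma>. THE v. ?H \<sigma> v) (?Ham)"
    if nd: "strongly_nondegenerate A B F \<theta>"
  proof -
    have the: "?H \<sigma> (THE v. ?H \<sigma> v)" if "\<sigma> \<in> ?Ham" for \<sigma>
      using theI'[OF ex1[OF nd that]] .
    have "inj_on (\<lambda>\<sigma>. THE v. ?H \<sigma> v) (?Ham)"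
    proof (rule inj_onI)
      fix \<sigma> \<tau> assume *: "\<sigma> \<in> ?Ham" "\<tau> \<in> ?Ham"
        "(THE v. ?H \<sigma> v) = (THE v. ?H \<tau> v)"
      show "\<sigma> = \<tau>" using common[OF *(1,2) the[OF *(1)]] the[OF *(2)] *(3) by simp
    qed
    moreover have "(\<lambda>\<sigma>. THE v. ?H \<sigma> v) \<in> ?Ham \<rightarrow> F_pairs A B F"
      using the by (auto simp: hamiltonian_pair_def)
    ultimately show ?thesis using ex1[OF nd] by blast
  qed
  show ?thesis
    unfolding LA
  proof (intro conjI ballI allI impI)
    show "f' x = f x" if "comoment_map G C A B F rN rM \<theta> f'" "x \<in> T1" for f' x using uniq that .
    show "f x \<in> ?Ham" if "x \<in> T1" for x
      using f_Cinf[OF that] f_hamiltonian[OF that] unfolding Ham0_def mem_Collect_eq by blast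
    show "f (lie_bracket G C x y) = ham_bracket A B F \<theta> (f x) (f y)" if "x \<in> T1" "y \<in> T1" for x y
      using bracket[OF that] by simp
    show "kostant_souriau_cocycle G C A B F \<theta> f x y = 0" if "x \<in> T1" "y \<in> T1" for x y
      using bracket[OF that] by (simp add: kostant_souriau_cocycle_def)
    show "strict_moment_map G C A B F rN rM \<theta> f" by (rule strict_moment_map)
    show "lie_deriv (fst (fundamental_pair G C A B rN rM x)) (f y) = f (lie_bracket G C x y)"
      if "x \<in> T1" "y \<in> T1" for x y
      using infinitesimally_equivariant[OF that] by (simp add: lie_deriv_def fundamental_pair_def fun_eq_iff)
    show "f (lie_Ad G C a x) = f x \<circ> inv_into UNIV (rN a)" if "x \<in> T1" for a x using equi[OF that] .
    show "\<exists>!v. ?H \<sigma> v"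
      if "strongly_nondegenerate A B F \<theta>" "\<sigma> \<in> ?Ham" for \<sigma> using ex1 that .
    show "(\<lambda>\<sigma>. THE v. ?H \<sigma> v) \<in> ?Ham \<rightarrow> F_pairs A B F"
      "inj_on (\<lambda>\<sigma>. THE v. ?H \<sigma> v) (?Ham)"
      if "strongly_nondegenerate A B F \<theta>" using nondeg[OF that] by blast+
    show "rel_d A B F 0 (rel_of_fun \<sigma>) = 0" "\<sigma> = 0"
      if "\<sigma> \<in> ?Ham" "?H \<sigma> 0" for \<sigma> using zero[OF that] by blast+
    show "\<sigma>\<^sub>1 = \<sigma>\<^sub>2" "rel_d A B F 0 (rel_of_fun (\<sigma>\<^sub>1 - \<sigma>\<^sub>2)) = 0"
      if "\<sigma>\<^sub>1 \<in> ?Ham" "\<sigma>\<^sub>2 \<in> ?Ham"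
        "?H \<sigma>\<^sub>1 v \<and> ?H \<sigma>\<^sub>2 v" for \<sigma>\<^sub>1 \<sigma>\<^sub>2 v
      using common[OF that(1,2) conjunct1[OF that(3)] conjunct2[OF that(3)]] d0 by simp_all
    show "{\<sigma> \<in> ?Ham. ?H \<sigma> 0} = {0}" using zero Ham0_0 ham0 by blast
  qed
qed

end
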